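(* Let the Pick matrix $P$ of an interpolation data set $\Omega$ be invertible. A function $w$ meromorphic on $\mathbb{C}^+$ of the form $w=\mathbf{T}_\Theta[\varphi]$ with $\varphi\in\widetilde{\mathbf{N}}_0$ is a solution of the Boundary Interpolation Problem with inequalities for $\Omega$ if and only if the corresponding parameter $\varphi$ meets, at each interpolation node $x_i$, one of the conditions $\mathbf C_1,\mathbf C_2,\mathbf C_3$ (if $\tilde e_i\ne0$), respectively one of $\widetilde{\mathbf C}_1,\widetilde{\mathbf C}_2,\widetilde{\mathbf C}_3$ (if $\tilde e_i=0$).
   Context: Classes. $\mathbb{C}^+$ is the open upper half plane. For $w$ meromorphic on $\mathbb{C}^+$, $\rho(w)\subset\mathbb{C}^+$ is its domain of analyticity and $K_w(z,\zeta)=\frac{w(z)-\overline{w(\zeta)}}{z-\bar\zeta}$. For an integer $\kappa\ge 0$, $\mathbf{N}_\kappa$ is the set of $w$ meromorphic on $\mathbb{C}^+$ such that all matrices $[K_w(z_j,z_i)]_{i,j=1}^m$ ($m\ge1$, $z_i\in\rho(w)$) have at most $\kappa$ negative eigenvalues, and at least one has exactly $\kappa$; $\mathbf{N}_0$ is the Nevanlinna class. $\widetilde{\mathbf{N}}_0=\mathbf{N}_0\cup\{\infty\}$, where $\infty$ is the function identically $\infty$. $\mathrm{sq}_-A$ is the number of negative eigenvalues of a Hermitian matrix $A$. Boundary limits. For $x\in\mathbb{R}$, $f(x)$, $f'(x)$, $f_{-1}(x)$ and $K_f(x,x)$ denote the nontangential limits as $z\to x$ of $f(z)$, $f'(z)$,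 $(z-x)f(z)$ and $K_f(z,z)$, when they exist; $f_{-1}(x)=\infty$ is allowed, with $1/\infty=0$ (while $1/0$ is not finite). If $f\equiv\infty$, then $f_{-1}(x)=\infty$. Data. $\Omega$ consists of distinct real numbers $x_1,\dots,x_n$ (nodes), an integer $0\le\ell\le n$, $w_j,\gamma_j\in\mathbb{R}$ $(1\le j\le\ell)$, $\xi_k\in\mathbb{R}\setminus\{0\}$ $(\ell<k\le n)$. The Pick matrix $P=[p_{ij}]_{i,j=1}^n$ is the real symmetric matrix with: $p_{ij}=\frac{w_j-w_i}{x_j-x_i}$ for $i\ne j$ and $p_{ii}=\gamma_i$, for $i,j\le\ell$; $p_{ij}=p_{ji}=\frac{\xi_j}{x_j-x_i}$ for $i\le\ell<j$; $p_{ii}=-\xi_i$ and $p_{ij}=0$ $(i\neq j)$ for $i,j>\ell$. Also $X=\mathrm{diag}(x_1,\dots,x_n)$, $C=[w_1\ \cdots\ w_\ell\ \xi_{\ell+1}\ \cdots\ \xi_n]$, $E=[1\ \cdots\ 1\ 0\ \cdots\ 0]$ ($\ell$ ones), $J=\begin{bmatrix}0&-i\\ i&0\end{bmatrix}$. For $P$ invertible, $\Theta(z)=[\Theta_{ij}(z)]_{i,j=1}^2=I_2-i\begin{bmatrix}C\\ E\end{bmatrix}(zI-X)^{-1}P^{-1}\begin{bmatrix}C^*&E^*\end{bmatrix}J$ and $\mathbf{T}_\Theta[\varphi]=\frac{\Theta_{11}\varphi+\Theta_{12}}{\Theta_{21}\varphi+\Theta_{22}}$, with $\mathbf{T}_\Theta[\infty]=\Theta_{11}/\Theta_{21}$.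 Boundary Interpolation Problem with inequalities: find all $w\in\mathbf{N}_\kappa$, $\kappa=\mathrm{sq}_-P$, such that $w(x_i)=w_i$ and $-\infty<w'(x_i)\le\gamma_i$ for $i=1,\dots,\ell$, and $-\infty<-\frac1{w_{-1}(x_j)}\le-\frac1{\xi_j}$ for $j=\ell+1,\dots,n$. Let $\tilde c_i$, $\tilde e_i$ be the $i$-th entries of the row vectors $CP^{-1}$, $EP^{-1}$ (real, not both zero), $\eta_i=\tilde c_i/\tilde e_i$, and $\tilde p_{ii}$ the $i$-th diagonal entry of $P^{-1}$. Conditions on $\varphi\in\widetilde{\mathbf{N}}_0$ at $x_i$: when $\tilde e_i\ne0$: $\mathbf C_1$: the limit $\varphi(x_i)$ does not exist, or exists and is not equal to $\eta_i$; $\mathbf C_2$: $\varphi(x_i)=\eta_i$ and $K_\varphi(x_i,x_i)=\infty$; $\mathbf C_3$: $\varphi(x_i)=\eta_i$ and $-\tilde p_{ii}/\tilde e_i^2<\varphi'(x_i)<\infty$; when $\tilde e_i=0$: $\widetilde{\mathbf C}_1$: it is not the case that the limit $\varphi(x_i)$ exists and equals $\infty$; $\widetilde{\mathbf C}_2$: $\varphi(x_i)=\infty$ and $\varphi_{-1}(x_i)=0$; $\widetilde{\mathbf C}_3$: $\varphi(x_i)=\infty$ and $-\tilde p_{ii}/\tilde c_i^2<-1/\varphi_{-1}(x_i)<\infty$. *)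

theory Defs
  imports
    "HOL-Complex_Analysis.Complex_Analysis"
    "Jordan_Normal_Form.Schur_Decomposition"
    "Jordan_Normal_Form.Gauss_Jordan_Elimination"
begin

subsection \<open>Generalized Nevanlinna classes\<close>

definition upper_half_plane :: "complex set" where
  "upper_half_plane = {z. 0 < Im z}"

text \<open>
  A function meromorphic on the upper half plane is represented by its canonical representative,
  i.e. by \<open>w\<close> with \<open>w nicely_meromorphic_on upper_half_plane\<close>: removable singularities are removed,
  and \<open>w\<close> takes the dummy value 0 at its poles. Values outside the half plane are irrelevant.
\<close>

definition analyticity_domain :: "(complex \<Rightarrow> complex) \<Rightarrow> complex set" where
  "analyticity_domain w = {z \<in> upper_half_plane. w analytic_on {z}}"

definition nev_kernel :: "(complex \<Rightarrow> complex) \<Rightarrow> complex \<Rightarrow> complex \<Rightarrow> complex" where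
  "nev_kernel w z \<zeta> = (w z - cnj (w \<zeta>)) / (z - cnj \<zeta>)"

definition kernel_mat :: "(complex \<Rightarrow> complex) \<Rightarrow> nat \<Rightarrow> (nat \<Rightarrow> complex) \<Rightarrow> complex mat" where
  "kernel_mat w m z = Matrix.mat m m (\<lambda>(i, j). nev_kernel w (z j) (z i))"

text \<open>Negative eigenvalues are counted with multiplicity.\<close>

definition sq_neg :: "complex mat \<Rightarrow> nat" where
  "sq_neg A = size {# a \<in># proots (char_poly A). a \<in> \<real> \<and> Re a < 0 #}"

definition nev_class :: "nat \<Rightarrow> (complex \<Rightarrow> complex) set" where
  "nev_class \<kappa> = {w. w nicely_meromorphic_on upper_half_plane \<and>
     (\<forall>m\<ge>1. \<forall>z. (\<forall>i<m. z i \<in> analyticity_domain w) \<longrightarrow> sq_neg (kernel_mat w m z) \<le> \<kappa>) \<and>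
     (\<exists>m\<ge>1. \<exists>z. (\<forall>i<m. z i \<in> analyticity_domain w) \<and> sq_neg (kernel_mat w m z) = \<kappa>)}"

text \<open>
  \<open>'a with_inf\<close> serves both for points of the Riemann sphere and for parameters, which are
  functions on the half plane or the function identically infinite.
\<close>

datatype 'a with_inf = Fin 'a | Infty

definition nev0_ext :: "(complex \<Rightarrow> complex) with_inf set" where
  "nev0_ext = insert Infty (Fin ` nev_class 0)"


subsection \<open>Nontangential boundary limits\<close>

text \<open>
  A limit along \<open>nontangential x\<close> is a limit along every angle
  \<open>\<bar>Re z - x\<bar> \<le> M * Im z\<close>, \<open>M > 0\<close>, with vertex \<open>x\<close>.
\<close>

definition nontangential :: "real \<Rightarrow> complex filter" where
  "nontangential x =
     (SUP M\<in>{0<..}. at (complex_of_real x) within {z. 0 < Im z \<and> \<bar>Re z - x\<bar> \<le> M * Im z})"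

fun nt_limit :: "(complex \<Rightarrow> complex) \<Rightarrow> real \<Rightarrow> complex with_inf \<Rightarrow> bool" where
  "nt_limit f x (Fin c) \<longleftrightarrow> (f \<longlongrightarrow> c) (nontangential x)"
| "nt_limit f x Infty \<longleftrightarrow> filterlim f at_infinity (nontangential x)"

text \<open>
  The predicates below say that \<open>f(x)\<close>, \<open>f\<^sub>-\<^sub>1(x)\<close>, \<open>f'(x)\<close> and \<open>K\<^sub>f(x, x)\<close>,
  respectively, exist and are equal to \<open>L\<close>.
\<close>

fun bd_value :: "(complex \<Rightarrow> complex) with_inf \<Rightarrow> real \<Rightarrow> complex with_inf \<Rightarrow> bool" where
  "bd_value (Fin f) x L \<longleftrightarrow> nt_limit f x L"
| "bd_value Infty x L \<longleftrightarrow> L = Infty"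

fun bd_residue :: "(complex \<Rightarrow> complex) with_inf \<Rightarrow> real \<Rightarrow> complex with_inf \<Rightarrow> bool" where
  "bd_residue (Fin f) x L \<longleftrightarrow> nt_limit (\<lambda>z. (z - complex_of_real x) * f z) x L"
| "bd_residue Infty x L \<longleftrightarrow> L = Infty"

fun bd_deriv :: "(complex \<Rightarrow> complex) with_inf \<Rightarrow> real \<Rightarrow> complex with_inf \<Rightarrow> bool" where
  "bd_deriv (Fin f) x L \<longleftrightarrow> nt_limit (deriv f) x L"
| "bd_deriv Infty x L \<longleftrightarrow> False"

fun bd_kernel :: "(complex \<Rightarrow> complex) with_inf \<Rightarrow> real \<Rightarrow> complex with_inf \<Rightarrow> bool" where
  "bd_kernel (Fin f) x L \<longleftrightarrow> nt_limit (\<lambda>z. nev_kernel f z z) x L"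
| "bd_kernel Infty x L \<longleftrightarrow> False"

fun neg_recip :: "complex with_inf \<Rightarrow> complex with_inf" where
  "neg_recip (Fin c) = (if c = 0 then Infty else Fin (- 1 / c))"
| "neg_recip Infty = Fin 0"

text \<open>\<open>- 1 / f\<^sub>-\<^sub>1(x)\<close> exists and is the (finite) real number \<open>t\<close>.\<close>

definition bd_neg_recip_residue :: "(complex \<Rightarrow> complex) with_inf \<Rightarrow> real \<Rightarrow> real \<Rightarrow> bool" where
  "bd_neg_recip_residue f x t \<longleftrightarrow>
     (\<exists>L. bd_residue f x L \<and> neg_recip L = Fin (complex_of_real t))"


subsection \<open>Interpolation data\<close>

text \<open>
  Indices are 0-based: the nodes are \<open>node \<Omega> i\<close> for \<open>i < num_nodes \<Omega>\<close>, the first \<open>num_reg \<Omega>\<close>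
  (the \<open>\<ell>\<close> of the problem) being the regular ones. \<open>wval\<close> and \<open>gam\<close> matter only for
  \<open>i < num_reg \<Omega>\<close>, and \<open>xi\<close> only for \<open>num_reg \<Omega> \<le> i < num_nodes \<Omega>\<close>.
\<close>

record interp_data =
  num_nodes :: nat
  num_reg :: nat
  node :: "nat \<Rightarrow> real"
  wval :: "nat \<Rightarrow> real"
  gam :: "nat \<Rightarrow> real"
  xi :: "nat \<Rightarrow> real"

definition interp_data_set :: "interp_data \<Rightarrow> bool" where
  "interp_data_set \<Omega> \<longleftrightarrow>
     inj_on (node \<Omega>) {..<num_nodes \<Omega>} \<and> num_reg \<Omega> \<le> num_nodes \<Omega> \<and>
     (\<forall>k. num_reg \<Omega> \<le> k \<and> k < num_nodes \<Omega> \<longrightarrow> xi \<Omega> k \<noteq> 0)"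

definition pick_mat :: "interp_data \<Rightarrow> real mat" where
  "pick_mat \<Omega> = Matrix.mat (num_nodes \<Omega>) (num_nodes \<Omega>) (\<lambda>(i, j).
     if i < num_reg \<Omega> \<and> j < num_reg \<Omega> then
       if i = j then gam \<Omega> i else (wval \<Omega> j - wval \<Omega> i) / (node \<Omega> j - node \<Omega> i)
     else if i < num_reg \<Omega> then xi \<Omega> j / (node \<Omega> j - node \<Omega> i)
     else if j < num_reg \<Omega> then xi \<Omega> i / (node \<Omega> i - node \<Omega> j)
     else if i = j then - xi \<Omega> i else 0)"

text \<open>Used only when the Pick matrix is invertible.\<close>

definition pick_inv :: "interp_data \<Rightarrow> real mat" where
  "pick_inv \<Omega> = the (mat_inverse (pick_mat \<Omega>))"

definition pick_kappa :: "interp_data \<Rightarrow> nat" where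
  "pick_kappa \<Omega> = sq_neg (map_mat complex_of_real (pick_mat \<Omega>))"

definition X_mat :: "interp_data \<Rightarrow> real mat" where
  "X_mat \<Omega> = mat_diag (num_nodes \<Omega>) (node \<Omega>)"

definition C_row :: "interp_data \<Rightarrow> real mat" where
  "C_row \<Omega> = Matrix.mat 1 (num_nodes \<Omega>) (\<lambda>(_, j). if j < num_reg \<Omega> then wval \<Omega> j else xi \<Omega> j)"

definition E_row :: "interp_data \<Rightarrow> real mat" where
  "E_row \<Omega> = Matrix.mat 1 (num_nodes \<Omega>) (\<lambda>(_, j). if j < num_reg \<Omega> then 1 else 0)"

definition J_mat :: "complex mat" where
  "J_mat = mat_of_rows_list 2 [[0, - \<i>], [\<i>, 0]]"

definition CE_mat :: "interp_data \<Rightarrow> complex mat" where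
  "CE_mat \<Omega> = map_mat complex_of_real (C_row \<Omega> @\<^sub>r E_row \<Omega>)"

definition Theta :: "interp_data \<Rightarrow> complex \<Rightarrow> complex mat" where
  "Theta \<Omega> z = 1\<^sub>m 2 - \<i> \<cdot>\<^sub>m
     (CE_mat \<Omega> * the (mat_inverse (z \<cdot>\<^sub>m 1\<^sub>m (num_nodes \<Omega>) - map_mat complex_of_real (X_mat \<Omega>)))
       * map_mat complex_of_real (pick_inv \<Omega>) * mat_adjoint (CE_mat \<Omega>) * J_mat)"


subsection \<open>The linear fractional transformation\<close>

fun lft_num :: "(complex \<Rightarrow> complex mat) \<Rightarrow> (complex \<Rightarrow> complex) with_inf \<Rightarrow> complex \<Rightarrow> complex" where
  "lft_num \<Theta> (Fin \<phi>) z = \<Theta> z $$ (0, 0) * \<phi> z + \<Theta> z $$ (0, 1)"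
| "lft_num \<Theta> Infty z = \<Theta> z $$ (0, 0)"

fun lft_den :: "(complex \<Rightarrow> complex mat) \<Rightarrow> (complex \<Rightarrow> complex) with_inf \<Rightarrow> complex \<Rightarrow> complex" where
  "lft_den \<Theta> (Fin \<phi>) z = \<Theta> z $$ (1, 0) * \<phi> z + \<Theta> z $$ (1, 1)"
| "lft_den \<Theta> Infty z = \<Theta> z $$ (1, 0)"

text \<open>
  \<open>w\<close> equals \<open>T\<^sub>\<Theta>[\<phi>]\<close> as a meromorphic function, i.e. off a discrete set. In particular, the
  denominator must not vanish identically (if it does, \<open>T\<^sub>\<Theta>[\<phi>]\<close> is identically infinite).
\<close>

definition is_lft :: "(complex \<Rightarrow> complex mat) \<Rightarrow> (complex \<Rightarrow> complex) with_inf \<Rightarrow> (complex \<Rightarrow> complex) \<Rightarrow> bool" where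
  "is_lft \<Theta> \<phi> w \<longleftrightarrow>
     (\<forall>\<^sub>\<approx>z\<in>upper_half_plane. lft_den \<Theta> \<phi> z \<noteq> 0 \<and> w z = lft_num \<Theta> \<phi> z / lft_den \<Theta> \<phi> z)"


subsection \<open>The interpolation problem and the conditions on the parameter\<close>

definition solves_bip_ineq :: "interp_data \<Rightarrow> (complex \<Rightarrow> complex) \<Rightarrow> bool" where
  "solves_bip_ineq \<Omega> w \<longleftrightarrow> w \<in> nev_class (pick_kappa \<Omega>) \<and>
     (\<forall>i<num_reg \<Omega>.
        bd_value (Fin w) (node \<Omega> i) (Fin (complex_of_real (wval \<Omega> i))) \<and>
        (\<exists>d. bd_deriv (Fin w) (node \<Omega> i) (Fin (complex_of_real d)) \<and> d \<le> gam \<Omega> i)) \<and>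
     (\<forall>j. num_reg \<Omega> \<le> j \<and> j < num_nodes \<Omega> \<longrightarrow>
        (\<exists>t. bd_neg_recip_residue (Fin w) (node \<Omega> j) t \<and> t \<le> - 1 / xi \<Omega> j))"

definition c_til :: "interp_data \<Rightarrow> nat \<Rightarrow> real" where
  "c_til \<Omega> i = (C_row \<Omega> * pick_inv \<Omega>) $$ (0, i)"

definition e_til :: "interp_data \<Rightarrow> nat \<Rightarrow> real" where
  "e_til \<Omega> i = (E_row \<Omega> * pick_inv \<Omega>) $$ (0, i)"

definition p_til :: "interp_data \<Rightarrow> nat \<Rightarrow> real" where
  "p_til \<Omega> i = pick_inv \<Omega> $$ (i, i)"

definition eta :: "interp_data \<Rightarrow> nat \<Rightarrow> real" where
  "eta \<Omega> i = c_til \<Omega> i / e_til \<Omega> i"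

definition cond_C1 :: "interp_data \<Rightarrow> (complex \<Rightarrow> complex) with_inf \<Rightarrow> nat \<Rightarrow> bool" where
  "cond_C1 \<Omega> \<phi> i \<longleftrightarrow> \<not> bd_value \<phi> (node \<Omega> i) (Fin (complex_of_real (eta \<Omega> i)))"

definition cond_C2 :: "interp_data \<Rightarrow> (complex \<Rightarrow> complex) with_inf \<Rightarrow> nat \<Rightarrow> bool" where
  "cond_C2 \<Omega> \<phi> i \<longleftrightarrow> bd_value \<phi> (node \<Omega> i) (Fin (complex_of_real (eta \<Omega> i))) \<and>
     bd_kernel \<phi> (node \<Omega> i) Infty"

definition cond_C3 :: "interp_data \<Rightarrow> (complex \<Rightarrow> complex) with_inf \<Rightarrow> nat \<Rightarrow> bool" where
  "cond_C3 \<Omega> \<phi> i \<longleftrightarrow> bd_value \<phi> (node \<Omega> i) (Fin (complex_of_real (eta \<Omega> i))) \<and>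
     (\<exists>d. bd_deriv \<phi> (node \<Omega> i) (Fin (complex_of_real d)) \<and> - p_til \<Omega> i / (e_til \<Omega> i)\<^sup>2 < d)"

definition cond_Ct1 :: "interp_data \<Rightarrow> (complex \<Rightarrow> complex) with_inf \<Rightarrow> nat \<Rightarrow> bool" where
  "cond_Ct1 \<Omega> \<phi> i \<longleftrightarrow> \<not> bd_value \<phi> (node \<Omega> i) Infty"

definition cond_Ct2 :: "interp_data \<Rightarrow> (complex \<Rightarrow> complex) with_inf \<Rightarrow> nat \<Rightarrow> bool" where
  "cond_Ct2 \<Omega> \<phi> i \<longleftrightarrow> bd_value \<phi> (node \<Omega> i) Infty \<and> bd_residue \<phi> (node \<Omega> i) (Fin 0)"

definition cond_Ct3 :: "interp_data \<Rightarrow> (complex \<Rightarrow> complex) with_inf \<Rightarrow> nat \<Rightarrow> bool" where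
  "cond_Ct3 \<Omega> \<phi> i \<longleftrightarrow> bd_value \<phi> (node \<Omega> i) Infty \<and>
     (\<exists>t. bd_neg_recip_residue \<phi> (node \<Omega> i) t \<and> - p_til \<Omega> i / (c_til \<Omega> i)\<^sup>2 < t)"

end

theory Submission
  imports Defs "Jordan_Normal_Form.Spectral_Radius"
begin

text \<open>
  Write the parameter in homogeneous coordinates \<open>(a, b)\<close>, put
  \<open>Y\<^sub>j = (e\<^sub>j a - c\<^sub>j b) / (z - x\<^sub>j)\<close> and let \<open>w = Num / Den\<close>. The displacement equation of \<open>P\<close> gives
  \<open>(z - x\<^sub>k) (P Y)\<^sub>k = E\<^sub>k Num - C\<^sub>k Den\<close> and hence the kernel identity
  \<open>Den (z) cnj (Den s) K\<^sub>w (z, s) = Y (s)\<^sup>* P Y (z) + H (z, s)\<close> with \<open>H\<close> the positive kernel of the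
  parameter; so \<open>w\<close> never has more than \<open>\<kappa>\<close> negative squares.

  At a node, the kernel of a Nevanlinna function \<open>g\<close> alone shows that the nontangential limit of \<open>(z - x) g (z)\<close>
  always exists in \<open>(-\<infinity>, 0]\<close>. Applied to \<open>g = 1 / (\<eta> - \<phi>)\<close>, or to \<open>g = \<phi>\<close> when the critical value is \<open>\<infinity>\<close>, this
  gives a limit \<open>D \<in> [0, \<infinity>]\<close> of the (suitably normalized) difference quotient of the parameter. The three
  conditions together say \<open>D > - q\<^sub>k\<^sub>k\<close> for \<open>q = P\<^sup>-\<^sup>1\<close>, and the kernel identity gives
  \<open>w' (x\<^sub>k) = \<gamma>\<^sub>k - 1 / (D + q\<^sub>k\<^sub>k)\<close> at a regular node and
  \<open>- 1 / w\<^sub>-\<^sub>1 (x\<^sub>k) = - 1 / \<xi>\<^sub>k - 1 / (\<xi>\<^sub>k\<^sup>2 (D + q\<^sub>k\<^sub>k))\<close> at a singular one. If all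
  conditions hold, kernel matrices at points approaching the nodes converge, after rescaling, to \<open>P\<close> minus a
  nonnegative diagonal matrix, so \<open>\<kappa>\<close> negative squares are attained.
\<close>


section \<open>Hermitian matrices and negative squares\<close>

text \<open>\<open>sq_neg\<close> counts roots of a characteristic polynomial, whereas kernel
  matrices and \<open>P\<close> have different sizes and are related by linear maps. Unitary
  diagonalization therefore comes first: it turns the count into the dimension of a negative
  subspace, with a uniform margin that survives limits. At a node the defect of the parameter
  competes with the pole of \<open>1 / (z - x\<^sub>k)\<close>, and the resulting limit
  \<open>D\<close> may be infinite. Dividing by a common normalizer \<psi> replaces \<open>D\<close>
  by a pair \<open>(D1, D2)\<close> with \<open>D = D1 / D2\<close>; infinity is
  \<open>(1, 0)\<close>. Every limit at the node is then linear in \<open>D2\<close> and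
  \<open>S = D1 + q\<^sub>k\<^sub>k * D2\<close>, and the conditions say \<open>S > 0\<close>. For a
  given solution \<open>S\<close> might be zero, so the formulas for the boundary data of
  \<open>w\<close> are used multiplied by \<open>S\<close>. The problem prescribes limits of
  \<open>deriv w\<close>, while the kernel identity yields difference quotients. Exchanging the two
  requires \<open>w\<close> to be holomorphic near each node inside the half plane, so its poles
  must not accumulate there. This is why the zeros of \<open>Den\<close> are shown to be finite in
  number.\<close>

lemma mat_adjoint_carrier:
  "A \<in> carrier_mat n m \<Longrightarrow> mat_adjoint A \<in> carrier_mat m n"
  unfolding mat_adjoint_def by (auto simp: mat_of_rows_def)

lemma mat_adjoint_index:
  fixes A :: "complex mat"
  assumes "A \<in> carrier_mat n m" "i < m" "j < n"
  shows "mat_adjoint A $$ (i, j) = cnj (A $$ (j, i))"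
  using assms unfolding mat_adjoint_def by (auto simp: mat_of_rows_def conjugate_vec_def)

lemma mat_adjoint_mult:
  fixes A B :: "complex mat"
  assumes "A \<in> carrier_mat n m" "B \<in> carrier_mat m k"
  shows "mat_adjoint (A * B) = mat_adjoint B * mat_adjoint A"
proof -
  note c = mat_adjoint_carrier[OF assms(1)] mat_adjoint_carrier[OF assms(2)]
    mat_adjoint_carrier[OF mult_carrier_mat[OF assms]]
  show ?thesis
  proof (rule eq_matI)
    fix i j assume ij: "i < dim_row (mat_adjoint B * mat_adjoint A)"
      "j < dim_col (mat_adjoint B * mat_adjoint A)"
    then have i: "i < k" and j: "j < n" using c by auto
    show "mat_adjoint (A * B) $$ (i, j) = (mat_adjoint B * mat_adjoint A) $$ (i, j)"
      using assms i j c
      by (simp add: mat_adjoint_index[OF mult_carrier_mat[OF assms]] scalar_prod_def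
          mat_adjoint_index[OF assms(1)] mat_adjoint_index[OF assms(2)] mult.commute)
  qed (use c in auto)
qed

lemma mat_adjoint_adjoint:
  fixes A :: "complex mat"
  shows "mat_adjoint (mat_adjoint A) = A"
proof -
  have A: "A \<in> carrier_mat (dim_row A) (dim_col A)" by auto
  note c = mat_adjoint_carrier[OF A] mat_adjoint_carrier[OF mat_adjoint_carrier[OF A]]
  show ?thesis
    by (rule eq_matI)
      (use c in \<open>auto simp: mat_adjoint_index[OF A] mat_adjoint_index[OF mat_adjoint_carrier[OF A]]\<close>)
qed

text \<open>Supplies the change of basis for one deflation step of
  \<open>hermitian_diagonalization\<close>: complete \<open>v\<close> to a basis, orthogonalize, and
  divide every column by its length \<open>r j\<close>.\<close>

lemma unitary_extension:
  fixes v :: "complex vec"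
  assumes v: "v \<in> carrier_vec n" "v \<noteq> 0\<^sub>v n"
  shows "\<exists>W \<in> carrier_mat n n. mat_adjoint W * W = 1\<^sub>m n \<and> (\<exists>c. c \<noteq> 0 \<and> col W 0 = c \<cdot>\<^sub>v v)"
proof -
  interpret cof_vec_space n "TYPE(complex)" .
  define b where "b = basis_completion v"
  define ws where "ws = gram_schmidt n b"
  define W0 where "W0 = mat_of_cols n ws"
  have b: "set b \<subseteq> carrier_vec n" "distinct b" "\<not> lin_dep (set b)" "length b = n" "hd b = v"
    using basis_completion[OF v] unfolding b_def by auto
  have n0: "n \<noteq> 0"
    using v by auto
  then have "b = v # tl b"
    using b by (cases b) auto
  then have hd: "hd ws = v"
    unfolding ws_def using gram_schmidt_hd[OF v(1)] by metis
  have ws: "set ws \<subseteq> carrier_vec n" "corthogonal ws" "length ws = n"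
    using gram_schmidt_result[OF b(1-3) ws_def] b(4) by auto
  have orth: "corthogonal_mat W0"
    unfolding W0_def by (rule orthogonal_mat_of_cols[OF ws])
  have W0: "W0 \<in> carrier_mat n n"
    using mat_of_cols_carrier(1)[of n ws] ws unfolding W0_def by auto
  have col0: "col W0 0 = v"
    using hd ws n0 unfolding W0_def by (metis bot_nat_0.not_eq_extremum col_mat_of_cols hd_conv_nth list.size(3) v(1))
  define s where "s = (\<lambda>j. \<Sum>i<n. W0 $$ (i, j) * cnj (W0 $$ (i, j)))"
  have prod: "(\<Sum>k<n. W0 $$ (k, i) * cnj (W0 $$ (k, j))) = 0 \<longleftrightarrow> i \<noteq> j" if "i < n" "j < n" for i j
    using corthogonal_matD[OF orth, of i j] that W0
    by (simp add: scalar_prod_def atLeast0LessThan)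
  have s_real: "s j = of_real (\<Sum>i<n. (cmod (W0 $$ (i, j)))\<^sup>2)" for j
    unfolding s_def by (simp only: complex_norm_square[symmetric] of_real_sum)
  define r where "r = (\<lambda>j. sqrt (\<Sum>i<n. (cmod (W0 $$ (i, j)))\<^sup>2))"
  have rr: "of_real (r j) * of_real (r j) = s j" for j
  proof -
    have "0 \<le> (\<Sum>i<n. (cmod (W0 $$ (i, j)))\<^sup>2)" by (intro sum_nonneg) auto
    then have "r j * r j = (\<Sum>i<n. (cmod (W0 $$ (i, j)))\<^sup>2)"
      unfolding r_def by simp
    then show ?thesis unfolding s_real by (metis of_real_mult)
  qed
  have r0: "r j \<noteq> 0" if "j < n" for j
    using prod[OF that that] rr[of j] unfolding s_def by auto
  define W where "W = Matrix.mat n n (\<lambda>(i, j). W0 $$ (i, j) / of_real (r j))"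
  have W: "W \<in> carrier_mat n n" by (simp add: W_def)
  have "mat_adjoint W * W = 1\<^sub>m n"
  proof (rule eq_matI)
    fix i j assume "i < dim_row (1\<^sub>m n :: complex mat)" "j < dim_col (1\<^sub>m n :: complex mat)"
    then have i: "i < n" and j: "j < n" by auto
    have "(mat_adjoint W * W) $$ (i, j) = (\<Sum>k<n. cnj (W $$ (k, i)) * W $$ (k, j))"
      using W mat_adjoint_carrier[OF W] i j
      by (simp add: scalar_prod_def atLeast0LessThan mat_adjoint_index[OF W])
    also have "\<dots> = (\<Sum>k<n. W0 $$ (k, j) * cnj (W0 $$ (k, i))) / (of_real (r i) * of_real (r j))"
      using i j by (simp add: W_def sum_divide_distrib mult.commute)
    also have "\<dots> = 1\<^sub>m n $$ (i, j)"
    proof (cases "i = j")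
      case True
      then show ?thesis
        using r0[OF i] i rr[of i] unfolding s_def by auto
    next
      case False
      then show ?thesis using prod[OF j i] i j by simp
    qed
    finally show "(mat_adjoint W * W) $$ (i, j) = 1\<^sub>m n $$ (i, j)" .
  qed (use W mat_adjoint_carrier[OF W] in auto)
  moreover have "col W 0 = (1 / of_real (r 0)) \<cdot>\<^sub>v v"
    unfolding col0[symmetric] using W0 n0
    by (intro eq_vecI) (auto simp: W_def)
  moreover have "1 / of_real (r 0) \<noteq> (0::complex)"
    using r0[of 0] n0 by auto
  ultimately show ?thesis using W by blast
qed

text \<open>Deflation: conjugating by a unitary matrix whose first column is an eigenvector clears
  the first column below the diagonal. Hermitian symmetry then clears the first row and makes the
  eigenvalue real, which leaves a Hermitian block of size \<open>n\<close> for the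
  induction.\<close>

lemma hermitian_diagonalization:
  fixes A :: "complex mat"
  assumes "A \<in> carrier_mat n n" "mat_adjoint A = A"
  shows "\<exists>U d. U \<in> carrier_mat n n \<and> mat_adjoint U * U = 1\<^sub>m n \<and>
    mat_adjoint U * A * U = mat_diag n (\<lambda>i. complex_of_real (d i))"
  using assms
proof (induction n arbitrary: A)
  case 0
  then show ?case
    by (intro exI[of _ "1\<^sub>m 0"] exI[of _ "\<lambda>_. 0"] conjI eq_matI)
      (auto simp: mat_adjoint_def mat_diag_def)
next
  case (Suc n)
  note A = Suc.prems(1)
  obtain e where "e \<in> spectrum A"
    using spectrum_non_empty[OF A] by auto
  then obtain v where ev: "eigenvector A v e"
    unfolding spectrum_def eigenvalue_def by auto
  then have v: "v \<in> carrier_vec (Suc n)" "v \<noteq> 0\<^sub>v (Suc n)" "A *\<^sub>v v = e \<cdot>\<^sub>v v"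
    using A unfolding eigenvector_def by auto
  obtain W c where W: "W \<in> carrier_mat (Suc n) (Suc n)" "mat_adjoint W * W = 1\<^sub>m (Suc n)"
    and c: "c \<noteq> 0" "col W 0 = c \<cdot>\<^sub>v v"
    using unitary_extension[OF v(1,2)] by blast
  note Wa = mat_adjoint_carrier[OF W(1)]
  define B where "B = mat_adjoint W * A * W"
  have B: "B \<in> carrier_mat (Suc n) (Suc n)"
    unfolding B_def using A W Wa by auto
  have Bh: "mat_adjoint B = B"
    unfolding B_def using A W Wa
    by (simp add: mat_adjoint_mult[of _ "Suc n" "Suc n" _ "Suc n"] Suc.prems(2) mat_adjoint_adjoint
        assoc_mult_mat[of _ "Suc n" "Suc n" _ "Suc n" _ "Suc n"])
  have cW: "col W 0 \<in> carrier_vec (Suc n)"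
    using W(1) by (metis carrier_matD(1) col_dim)
  have "col B 0 = (mat_adjoint W * A) *\<^sub>v col W 0"
    unfolding B_def by (rule col_mult2[of _ "Suc n" "Suc n" _ "Suc n"]) (use A W(1) Wa in auto)
  also have "\<dots> = mat_adjoint W *\<^sub>v (A *\<^sub>v col W 0)"
    by (rule assoc_mult_mat_vec[OF Wa A cW])
  also have "A *\<^sub>v col W 0 = e \<cdot>\<^sub>v col W 0"
    unfolding c(2) mult_mat_vec[OF A v(1)] v(3) by (simp add: smult_smult_assoc mult.commute)
  also have "mat_adjoint W *\<^sub>v (e \<cdot>\<^sub>v col W 0) = e \<cdot>\<^sub>v (mat_adjoint W *\<^sub>v col W 0)"
    by (rule mult_mat_vec[OF Wa cW])
  also have "mat_adjoint W *\<^sub>v col W 0 = col (mat_adjoint W * W) 0"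
    by (rule col_mult2[symmetric, OF Wa W(1)]) simp
  finally have colB: "col B 0 = e \<cdot>\<^sub>v col (1\<^sub>m (Suc n)) 0"
    unfolding W(2) .
  have B0: "B $$ (i, 0) = (if i = 0 then e else 0)" if "i < Suc n" for i
    using arg_cong[OF colB, of "\<lambda>u. vec_index u i"] that B by (auto split: if_splits)
  have Bsym: "B $$ (i, j) = cnj (B $$ (j, i))" if "i < Suc n" "j < Suc n" for i j
    using mat_adjoint_index[OF B that] Bh by simp
  have e_real: "e = of_real (Re e)"
    using Bsym[of 0 0] B0[of 0] by (simp add: complex_eq_iff)
  have B0': "B $$ (0, i) = (if i = 0 then e else 0)" if "i < Suc n" for i
    using Bsym[of 0 i] B0[of i] B0[of 0] Bsym[of 0 0] that by auto
  define B1 where "B1 = Matrix.mat n n (\<lambda>(i, j). B $$ (Suc i, Suc j))"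
  have B1: "B1 \<in> carrier_mat n n" by (simp add: B1_def)
  have "mat_adjoint B1 = B1"
  proof (rule eq_matI)
    fix i j assume "i < dim_row B1" "j < dim_col B1"
    then have ij: "i < n" "j < n" using B1 by auto
    then show "mat_adjoint B1 $$ (i, j) = B1 $$ (i, j)"
      using Bsym[of "Suc i" "Suc j"] by (simp add: mat_adjoint_index[OF B1]) (simp add: B1_def)
  qed (use mat_adjoint_carrier[OF B1] B1 in auto)
  from Suc.IH[OF B1 this] obtain U1 d where U1: "U1 \<in> carrier_mat n n"
    "mat_adjoint U1 * U1 = 1\<^sub>m n"
    "mat_adjoint U1 * B1 * U1 = mat_diag n (\<lambda>i. complex_of_real (d i))"
    by blast
  note U1a = mat_adjoint_carrier[OF U1(1)]
  define V where "V = four_block_mat (1\<^sub>m 1) (0\<^sub>m 1 n) (0\<^sub>m n 1) U1"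
  define V' where "V' = four_block_mat (1\<^sub>m 1) (0\<^sub>m 1 n) (0\<^sub>m n 1) (mat_adjoint U1)"
  have V: "V \<in> carrier_mat (Suc n) (Suc n)" "V' \<in> carrier_mat (Suc n) (Suc n)"
    unfolding V_def V'_def using U1 U1a by auto
  have V': "mat_adjoint V = V'"
  proof (rule eq_matI)
    fix i j assume "i < dim_row V'" "j < dim_col V'"
    then have ij: "i < Suc n" "j < Suc n" using V by auto
    show "mat_adjoint V $$ (i, j) = V' $$ (i, j)"
      unfolding mat_adjoint_index[OF V(1) ij] unfolding V_def V'_def
      using ij U1(1) U1a by (auto simp: mat_adjoint_index[OF U1(1)])
  qed (use V mat_adjoint_carrier[OF V(1)] in auto)
  have Bblock: "B = four_block_mat (Matrix.mat 1 1 (\<lambda>_. e)) (0\<^sub>m 1 n) (0\<^sub>m n 1) B1"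
    by (rule eq_matI) (use B B0 B0' B1 in \<open>auto simp: B1_def\<close>)
  have "V' * V = four_block_mat (1\<^sub>m 1) (0\<^sub>m 1 n) (0\<^sub>m n 1) (1\<^sub>m n)"
    unfolding V_def V'_def using U1 U1a
    by (subst mult_four_block_mat[of _ 1 1 _ n _ n]) auto
  also have "\<dots> = 1\<^sub>m (Suc n)"
    by (rule eq_matI) auto
  finally have VV: "V' * V = 1\<^sub>m (Suc n)" .
  define d' where "d' = (\<lambda>i. case i of 0 \<Rightarrow> Re e | Suc j \<Rightarrow> d j)"
  have "V' * B * V = four_block_mat (Matrix.mat 1 1 (\<lambda>_. e)) (0\<^sub>m 1 n) (0\<^sub>m n 1)
      (mat_diag n (\<lambda>i. complex_of_real (d i)))"
    unfolding V_def V'_def Bblock U1(3)[symmetric] using U1(1) U1a B1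
    by (subst mult_four_block_mat[of _ 1 1 _ n _ n], (auto)[8])
      (subst mult_four_block_mat[of _ 1 1 _ n _ n], auto)
  also have "\<dots> = mat_diag (Suc n) (\<lambda>i. complex_of_real (d' i))"
    by (rule eq_matI) (auto simp: mat_diag_def d'_def e_real[symmetric] split: nat.split)
  finally have VBV: "V' * B * V = mat_diag (Suc n) (\<lambda>i. complex_of_real (d' i))" .
  let ?s = "Suc n"
  note assoc = assoc_mult_mat[of _ ?s ?s _ ?s _ ?s]
  have "mat_adjoint (W * V) * (W * V) = V' * (mat_adjoint W * W) * V"
    using W(1) Wa V by (simp add: mat_adjoint_mult[OF W(1) V(1)] V' assoc)
  also have "\<dots> = 1\<^sub>m (Suc n)"
    using V VV by (simp add: W)
  finally have 1: "mat_adjoint (W * V) * (W * V) = 1\<^sub>m (Suc n)" .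
  have "mat_adjoint (W * V) * A * (W * V) = V' * B * V"
    unfolding B_def using W Wa V A by (simp add: mat_adjoint_mult[OF W(1) V(1)] V' assoc)
  then show ?case
    using 1 VBV W V by (intro exI[of _ "W * V"] exI[of _ d']) auto
qed

section \<open>Quadratic forms and the count of negative squares\<close>

definition hform :: "complex mat \<Rightarrow> nat \<Rightarrow> (nat \<Rightarrow> complex) \<Rightarrow> complex" where
  "hform A n f = (\<Sum>i<n. \<Sum>j<n. cnj (f i) * A $$ (i, j) * f j)"

text \<open>Fewer equations than unknowns: padding the coefficient matrix with zero rows to size
  \<open>k\<close> makes row \<open>r\<close> vanish, so the determinant is zero and a kernel vector
  exists.\<close>

lemma exists_annihilated_combination:
  fixes a :: "nat \<Rightarrow> nat \<Rightarrow> complex"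
  assumes "r < k"
  shows "\<exists>c. (\<exists>s<k. c s \<noteq> 0) \<and> (\<forall>j<r. (\<Sum>s<k. a j s * c s) = 0)"
proof -
  define A where "A = Matrix.mat k k (\<lambda>(i, j). if i < r then a i j else 0)"
  have A: "A \<in> carrier_mat k k" by (simp add: A_def)
  have "A = mat\<^sub>r k k (\<lambda>i. if i = r then 0\<^sub>v k else row A i)"
    by (rule eq_matI) (auto simp: A_def)
  moreover have "det (mat\<^sub>r k k (\<lambda>i. if i = r then 0\<^sub>v k else row A i)) = 0"
    by (rule det_row_0) (use assms A in auto)
  ultimately have "det A = 0"
    by simp
  then obtain v where v: "v \<in> carrier_vec k" "v \<noteq> 0\<^sub>v k" "A *\<^sub>v v = 0\<^sub>v k"
    using det_0_iff_vec_prod_zero_field[OF A] by blast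
  have "(\<Sum>s<k. a j s * vec_index v s) = 0" if "j < r" for j
    using arg_cong[OF v(3), of "\<lambda>u. vec_index u j"] that assms v(1)
    by (simp add: A_def scalar_prod_def atLeast0LessThan)
  moreover have "\<exists>s<k. vec_index v s \<noteq> 0"
    using v(1,2) by (metis carrier_vecD eq_vecI index_zero_vec)
  ultimately show ?thesis by (intro exI[of _ "\<lambda>s. vec_index v s"]) auto
qed

text \<open>Passes from eigenvalues, through which \<open>sq_neg\<close> is defined, to quadratic
  forms, in which negative squares can be compared. The \<open>d l\<close> are the eigenvalues, and
  similarity to a diagonal matrix gives the count.\<close>

lemma hermitian_spectral:
  fixes A :: "complex mat"
  assumes A: "A \<in> carrier_mat n n"
    and herm: "\<And>i j. i < n \<Longrightarrow> j < n \<Longrightarrow> A $$ (i, j) = cnj (A $$ (j, i))"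
  obtains u :: "nat \<Rightarrow> nat \<Rightarrow> complex" and d :: "nat \<Rightarrow> real"
  where "\<And>f. hform A n f = of_real (\<Sum>l<n. d l * (cmod (\<Sum>i<n. cnj (u i l) * f i))\<^sup>2)"
    and "\<And>l l'. l < n \<Longrightarrow> l' < n \<Longrightarrow> (\<Sum>i<n. cnj (u i l) * u i l') = (if l = l' then 1 else 0)"
    and "sq_neg A = card {l. l < n \<and> d l < 0}"
proof -
  have "mat_adjoint A = A"
  proof (rule eq_matI)
    fix i j assume "i < dim_row A" "j < dim_col A"
    then have "i < n" "j < n" using A by auto
    then show "mat_adjoint A $$ (i, j) = A $$ (i, j)"
      using herm[of i j] by (simp add: mat_adjoint_index[OF A])
  qed (use A mat_adjoint_carrier[OF A] in auto)
  from hermitian_diagonalization[OF A this] obtain U d where U: "U \<in> carrier_mat n n"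
    "mat_adjoint U * U = 1\<^sub>m n" "mat_adjoint U * A * U = mat_diag n (\<lambda>i. complex_of_real (d i))"
    by blast
  note Ua = mat_adjoint_carrier[OF U(1)]
  define D where "D = mat_diag n (\<lambda>i. complex_of_real (d i))"
  have D: "D \<in> carrier_mat n n" by (simp add: D_def)
  have UU: "U * mat_adjoint U = 1\<^sub>m n"
    using mat_mult_left_right_inverse[OF Ua U(1) U(2)] .
  have "A = (U * mat_adjoint U) * A * (U * mat_adjoint U)"
    using A by (simp add: UU)
  also have "\<dots> = U * (mat_adjoint U * A * U) * mat_adjoint U"
    using U(1) Ua A by (simp add: assoc_mult_mat[of _ n n _ n _ n])
  finally have AD: "A = U * D * mat_adjoint U"
    unfolding U(3) D_def .
  have Aij: "A $$ (i, j) = (\<Sum>l<n. U $$ (i, l) * of_real (d l) * cnj (U $$ (j, l)))"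
    if "i < n" "j < n" for i j
  proof -
    have "A $$ (i, j) = (Matrix.mat n n (\<lambda>(i, j). U $$ (i, j) * of_real (d j)) * mat_adjoint U) $$ (i, j)"
      unfolding arg_cong[OF AD, of "\<lambda>M. M $$ (i, j)"] D_def mat_diag_mult_right[OF U(1)] ..
    then show ?thesis
      using that U(1) Ua
      by (simp add: scalar_prod_def atLeast0LessThan mat_adjoint_index[OF U(1)])
  qed
  have "similar_mat A D"
    unfolding similar_mat_def
    by (intro exI, rule similar_mat_witI[OF UU U(2) AD A D U(1) Ua])
  then have "char_poly A = char_poly D"
    by (rule char_poly_similar)
  also have "\<dots> = (\<Prod>a \<leftarrow> diag_mat D. [:- a, 1:])"
    by (rule char_poly_upper_triangular[OF D]) (auto simp: D_def mat_diag_def)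
  also have "diag_mat D = map (\<lambda>i. complex_of_real (d i)) [0..<n]"
    unfolding diag_mat_def using D by (auto simp: D_def mat_diag_def)
  finally have cp: "char_poly A = (\<Prod>i \<leftarrow> [0..<n]. [:- complex_of_real (d i), 1:])"
    by (simp add: o_def)
  have "proots (\<Prod>i \<leftarrow> xs. [:- complex_of_real (d i), 1:]) = mset (map (\<lambda>i. complex_of_real (d i)) xs)"
    for xs
  proof (induction xs)
    case (Cons x xs)
    have "(\<Prod>i \<leftarrow> xs. [:- complex_of_real (d i), 1:]) \<noteq> 0"
      by (auto simp: prod_list_zero_iff)
    then show ?case
      using Cons by (simp add: proots_mult del: mult_pCons_left)
  qed simp
  then have "sq_neg A = size (filter_mset (\<lambda>a. a \<in> \<real> \<and> Re a < 0) (mset (map (\<lambda>i. complex_of_real (d i)) [0..<n])))"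
    unfolding sq_neg_def cp by simp
  also have "\<dots> = length (filter (\<lambda>i. d i < 0) [0..<n])"
    by (simp only: mset_filter[symmetric] size_mset filter_map length_map) (simp add: o_def)
  also have "\<dots> = card {l. l < n \<and> d l < 0}"
    by (subst length_filter_conv_card) (auto intro: arg_cong[of _ _ card])
  finally have 3: "sq_neg A = card {l. l < n \<and> d l < 0}" .
  have 1: "hform A n f = of_real (\<Sum>l<n. d l * (cmod (\<Sum>i<n. cnj (U $$ (i, l)) * f i))\<^sup>2)" for f
  proof -
    have "hform A n f = (\<Sum>i<n. \<Sum>j<n. \<Sum>l<n. of_real (d l) * (cnj (f i) * U $$ (i, l) * (cnj (U $$ (j, l)) * f j)))"
      unfolding hform_def
      by (intro sum.cong refl) (simp add: Aij sum_distrib_left sum_distrib_right mult_ac)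
    also have "\<dots> = (\<Sum>l<n. \<Sum>i<n. \<Sum>j<n. of_real (d l) * (cnj (f i) * U $$ (i, l) * (cnj (U $$ (j, l)) * f j)))"
      by (rule trans[OF sum.cong[OF refl sum.swap] sum.swap[THEN trans]]) (intro sum.cong refl sum.swap)
    also have "\<dots> = (\<Sum>l<n. of_real (d l) * ((\<Sum>i<n. cnj (cnj (U $$ (i, l)) * f i)) * (\<Sum>j<n. cnj (U $$ (j, l)) * f j)))"
      by (simp add: sum_product sum_distrib_left mult_ac)
    also have "\<dots> = of_real (\<Sum>l<n. d l * (cmod (\<Sum>i<n. cnj (U $$ (i, l)) * f i))\<^sup>2)"
      by (simp only: cnj_sum[symmetric] complex_norm_square of_real_sum of_real_mult mult.commute)
    finally show ?thesis .
  qed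
  have 2: "(\<Sum>i<n. cnj (U $$ (i, l)) * U $$ (i, l')) = (if l = l' then 1 else 0)"
    if "l < n" "l' < n" for l l'
    using arg_cong[OF U(2), of "\<lambda>M. M $$ (l, l')"] that U(1) Ua
    by (simp add: scalar_prod_def atLeast0LessThan mat_adjoint_index[OF U(1)])
  show ?thesis using that[OF 1 2 3] by blast
qed

text \<open>The columns of \<open>V\<close> are eigenvectors for the negative eigenvalues, and
  \<delta> is the distance of these eigenvalues from zero. A uniform \<delta>, rather than mere
  negativity, is what survives the perturbation in \<open>sq_neg_limit\<close>.\<close>

lemma negative_subspace:
  fixes A :: "complex mat"
  assumes "A \<in> carrier_mat n n"
    and "\<And>i j. i < n \<Longrightarrow> j < n \<Longrightarrow> A $$ (i, j) = cnj (A $$ (j, i))"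
  obtains V :: "nat \<Rightarrow> nat \<Rightarrow> complex" and \<delta> :: real
  where "\<delta> > 0"
    and "\<And>c. Re (hform A n (\<lambda>i. \<Sum>s<sq_neg A. V i s * c s)) \<le> - \<delta> * (\<Sum>s<sq_neg A. (cmod (c s))\<^sup>2)"
proof -
  obtain u d where hf: "\<And>f. hform A n f = of_real (\<Sum>l<n. d l * (cmod (\<Sum>i<n. cnj (u i l) * f i))\<^sup>2)"
    and orth: "\<And>l l'. l < n \<Longrightarrow> l' < n \<Longrightarrow> (\<Sum>i<n. cnj (u i l) * u i l') = (if l = l' then 1 else 0)"
    and sq: "sq_neg A = card {l. l < n \<and> d l < 0}"
    by (rule hermitian_spectral[OF assms]) (assumption | rule that)+
  define S where "S = {l. l < n \<and> d l < 0}"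
  have finS: "finite S" by (simp add: S_def)
  obtain h where h: "bij_betw h {..<sq_neg A} S"
    using ex_bij_betw_nat_finite[OF finS] sq by (auto simp: S_def atLeast0LessThan)
  \<comment> \<open>If no eigenvalue is negative, the minimum would range over the empty set; the
    sums over \<open>s\<close> are then empty and any positive value serves.\<close>
  define \<delta> where "\<delta> = (if S = {} then 1 else Min ((\<lambda>l. - d l) ` S))"
  have "\<delta> > 0" unfolding \<delta>_def using finS by (auto simp: S_def)
  moreover have \<delta>: "\<delta> \<le> - d l" if "l \<in> S" for l
    using that finS unfolding \<delta>_def by auto
  moreover have "Re (hform A n (\<lambda>i. \<Sum>s<sq_neg A. u i (h s) * c s)) \<le> - \<delta> * (\<Sum>s<sq_neg A. (cmod (c s))\<^sup>2)" for c
  proof -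
    have hS: "h s \<in> S" if "s < sq_neg A" for s
      using h that by (auto simp: bij_betw_def)
    have inner: "(\<Sum>i<n. cnj (u i l) * (\<Sum>s<sq_neg A. u i (h s) * c s)) = (\<Sum>s<sq_neg A. if l = h s then c s else 0)"
      if "l < n" for l
    proof -
      have "(\<Sum>i<n. cnj (u i l) * (\<Sum>s<sq_neg A. u i (h s) * c s)) =
          (\<Sum>s<sq_neg A. (\<Sum>i<n. cnj (u i l) * u i (h s)) * c s)"
        unfolding sum_distrib_left sum_distrib_right by (subst sum.swap) (simp add: mult_ac)
      also have "\<dots> = (\<Sum>s<sq_neg A. if l = h s then c s else 0)"
        using that hS by (intro sum.cong refl) (auto simp: orth S_def)
      finally show ?thesis .
    qed
    have at_h: "(\<Sum>s<sq_neg A. if h t = h s then c s else 0) = c t" if "t < sq_neg A" for t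
    proof -
      have "(\<Sum>s<sq_neg A. if h t = h s then c s else 0) = (\<Sum>s<sq_neg A. if t = s then c s else 0)"
        using h that by (intro sum.cong refl) (auto simp: bij_betw_def inj_on_def)
      then show ?thesis using that by simp
    qed
    have off: "(\<Sum>s<sq_neg A. if l = h s then c s else 0) = 0" if "l \<notin> S" for l
      using hS that by (intro sum.neutral) auto
    have "Re (hform A n (\<lambda>i. \<Sum>s<sq_neg A. u i (h s) * c s)) =
        (\<Sum>l<n. d l * (cmod (\<Sum>s<sq_neg A. if l = h s then c s else 0))\<^sup>2)"
      unfolding hf by (simp add: inner)
    also have "\<dots> = (\<Sum>l\<in>S. d l * (cmod (\<Sum>s<sq_neg A. if l = h s then c s else 0))\<^sup>2)"
      by (rule sum.mono_neutral_right) (auto simp: off, auto simp: S_def)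
    also have "\<dots> = (\<Sum>t<sq_neg A. d (h t) * (cmod (c t))\<^sup>2)"
      by (subst sum.reindex_bij_betw[OF h, symmetric]) (simp add: at_h)
    also have "\<dots> \<le> (\<Sum>t<sq_neg A. - \<delta> * (cmod (c t))\<^sup>2)"
      using \<delta> hS by (intro sum_mono mult_right_mono) fastforce+
    finally show ?thesis by (simp add: sum_distrib_left)
  qed
  ultimately show ?thesis using that[of \<delta> "\<lambda>i s. u i (h s)"] by blast
qed

text \<open>The form is nonnegative on the orthogonal complement of the negative eigenvectors. If
  \<open>k\<close> exceeded their number, some nonzero combination of the \<open>k\<close> columns
  of \<open>V\<close> would lie in that complement.\<close>

lemma sq_neg_ge:
  fixes A :: "complex mat"
  assumes "A \<in> carrier_mat n n"
    and "\<And>i j. i < n \<Longrightarrow> j < n \<Longrightarrow> A $$ (i, j) = cnj (A $$ (j, i))"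
    and neg: "\<And>c. \<exists>s<k. c s \<noteq> 0 \<Longrightarrow> Re (hform A n (\<lambda>i. \<Sum>s<k. V i s * c s)) < 0"
  shows "k \<le> sq_neg A"
proof (rule ccontr)
  assume "\<not> k \<le> sq_neg A"
  obtain u d where hf: "\<And>f. hform A n f = of_real (\<Sum>l<n. d l * (cmod (\<Sum>i<n. cnj (u i l) * f i))\<^sup>2)"
    and "\<And>l l'. l < n \<Longrightarrow> l' < n \<Longrightarrow> (\<Sum>i<n. cnj (u i l) * u i l') = (if l = l' then 1 else 0)"
    and sq: "sq_neg A = card {l. l < n \<and> d l < 0}"
    by (rule hermitian_spectral[OF assms(1,2)]) (assumption | rule that)+
  define S where "S = {l. l < n \<and> d l < 0}"
  have finS: "finite S" by (simp add: S_def)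
  obtain h where h: "bij_betw h {..<sq_neg A} S"
    using ex_bij_betw_nat_finite[OF finS] sq by (auto simp: S_def atLeast0LessThan)
  obtain c where c: "\<exists>s<k. c s \<noteq> 0"
    and ann: "\<And>j. j < sq_neg A \<Longrightarrow> (\<Sum>s<k. (\<Sum>i<n. cnj (u i (h j)) * V i s) * c s) = 0"
    using exists_annihilated_combination[of "sq_neg A" k "\<lambda>j s. \<Sum>i<n. cnj (u i (h j)) * V i s"]
      \<open>\<not> k \<le> sq_neg A\<close> by (meson linorder_not_le)
  have "(\<Sum>i<n. cnj (u i l) * (\<Sum>s<k. V i s * c s)) = 0" if "l \<in> S" for l
  proof -
    have "l \<in> h ` {..<sq_neg A}" using h that by (simp add: bij_betw_def)
    then obtain j where j: "j < sq_neg A" "l = h j" by auto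
    have "(\<Sum>i<n. cnj (u i l) * (\<Sum>s<k. V i s * c s)) = (\<Sum>s<k. (\<Sum>i<n. cnj (u i (h j)) * V i s) * c s)"
      unfolding sum_distrib_left sum_distrib_right j(2) by (subst sum.swap) (simp add: mult_ac)
    then show ?thesis using ann[OF j(1)] by simp
  qed
  then have "0 \<le> d l * (cmod (\<Sum>i<n. cnj (u i l) * (\<Sum>s<k. V i s * c s)))\<^sup>2" if "l < n" for l
    using that by (cases "d l < 0") (auto simp: S_def)
  then have "0 \<le> Re (hform A n (\<lambda>i. \<Sum>s<k. V i s * c s))"
    unfolding hf by (auto intro: sum_nonneg)
  with neg[OF c] show False by simp
qed


section \<open>Nontangential limits\<close>

definition cone :: "real \<Rightarrow> real \<Rightarrow> complex set" where
  "cone M x = {z. 0 < Im z \<and> \<bar>Re z - x\<bar> \<le> M * Im z}"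

abbreviation at_cone :: "real \<Rightarrow> real \<Rightarrow> complex filter" where
  "at_cone M x \<equiv> at (of_real x) within cone M x"

lemma eventually_nontangential:
  "eventually P (nontangential x) \<longleftrightarrow> (\<forall>M>0. eventually P (at_cone M x))"
  unfolding nontangential_def eventually_Sup cone_def by auto

lemma at_within_cone_nontriv:
  assumes "M > 0"
  shows "at_cone M x \<noteq> bot"
proof -
  have "of_real x islimpt cone M x"
    unfolding islimpt_approachable
  proof (intro allI impI)
    fix e :: real assume "e > 0"
    then show "\<exists>x'\<in>cone M x. x' \<noteq> of_real x \<and> dist x' (of_real x) < e"
      using assms
      by (intro bexI[of _ "Complex x (e/2)"]) (auto simp: cone_def complex_eq_iff dist_norm cmod_def)
  qed
  then show ?thesis by (simp add: trivial_limit_within)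
qed

lemma nontangential_nontriv [simp]: "nontangential x \<noteq> bot"
proof
  assume "nontangential x = bot"
  then have "eventually (\<lambda>_. False) (nontangential x)" by simp
  then have "eventually (\<lambda>_. False) (at_cone 1 x)"
    unfolding eventually_nontangential by auto
  then show False using at_within_cone_nontriv[of 1 x] by simp
qed

lemma eventually_nontangential_at:
  assumes "eventually P (at (of_real x) within {z. 0 < Im z})"
  shows "eventually P (nontangential x)"
  unfolding eventually_nontangential
proof (intro allI impI)
  fix M :: real
  show "eventually P (at_cone M x)"
    by (rule filter_leD[OF at_le assms]) (auto simp: cone_def)
qed

lemma eventually_nontangential_Im_pos: "eventually (\<lambda>z. 0 < Im z) (nontangential x)"
  by (rule eventually_nontangential_at) (auto simp: eventually_at_filter)

lemma nontangential_tendsto: "((\<lambda>z. z) \<longlongrightarrow> of_real x) (nontangential x)"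
proof (rule tendstoI)
  fix e :: real assume "e > 0"
  show "eventually (\<lambda>z. dist z (of_real x) < e) (nontangential x)"
    by (rule eventually_nontangential_at)
      (use \<open>e > 0\<close> in \<open>auto simp: eventually_at intro!: exI[of _ e]\<close>)
qed

lemma eventually_nontangential_ne: "eventually (\<lambda>z. z \<noteq> of_real x) (nontangential x)"
  using eventually_nontangential_Im_pos by eventually_elim auto

lemma cone_norm_le:
  assumes "z \<in> cone M x"
  shows "cmod (z - of_real x) \<le> (M + 1) * Im z"
proof -
  have "cmod (z - of_real x) \<le> \<bar>Re z - x\<bar> + \<bar>Im z\<bar>"
    using cmod_le[of "z - of_real x"] by simp
  also have "\<dots> \<le> (M + 1) * Im z"
    using assms by (auto simp: cone_def algebra_simps)
  finally show ?thesis .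
qed

text \<open>The vertical ray lies in every cone and so serves as a test path: it turns nontangential
  limits into one-sided limits of a real variable.\<close>

lemma filterlim_vertical_nontangential:
  "filterlim (\<lambda>t. Complex x t) (nontangential x) (at_right 0)"
  unfolding filterlim_def le_filter_def eventually_filtermap
proof (intro allI impI)
  fix P assume "eventually P (nontangential x)"
  then have "eventually P (at_cone 1 x)"
    unfolding eventually_nontangential by auto
  then obtain e where e: "e > 0"
    "\<And>z. z \<in> cone 1 x \<Longrightarrow> z \<noteq> of_real x \<Longrightarrow> dist z (of_real x) < e \<Longrightarrow> P z"
    unfolding eventually_at by auto
  show "eventually (\<lambda>t. P (Complex x t)) (at_right 0)"
    unfolding eventually_at_right_field
  proof (intro exI conjI allI impI)
    fix t :: real assume "0 < t" "t < e"
    then show "P (Complex x t)"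
      by (intro e) (auto simp: cone_def complex_eq_iff dist_norm cmod_def)
  qed (use e in auto)
qed

section \<open>Difference quotients and derivatives under nontangential approach\<close>

lemma cone_disc:
  assumes "z \<in> cone M x" "M > 0" "cmod (u - z) \<le> Im z / 2"
  shows "u \<in> cone (2 * M + 1) x" "cmod (u - of_real x) \<le> (M + 3/2) * Im z"
    "cmod (u - of_real x) \<le> 3/2 * cmod (z - of_real x)" "0 < Im u"
proof -
  have z: "0 < Im z" "\<bar>Re z - x\<bar> \<le> M * Im z" using assms by (auto simp: cone_def)
  have "\<bar>Im u - Im z\<bar> \<le> Im z / 2" "\<bar>Re u - Re z\<bar> \<le> Im z / 2"
    using abs_Im_le_cmod[of "u - z"] abs_Re_le_cmod[of "u - z"] assms(3) by auto
  then have u: "Im u \<ge> Im z / 2" "\<bar>Re u - x\<bar> \<le> M * Im z + Im z / 2"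
    using z by linarith+
  then show "0 < Im u" using z by simp
  \<comment> \<open>On the disc the imaginary part can drop to half of \<open>Im z\<close>, so the
    aperture has to roughly double; this is the origin of \<open>2 * M + 1\<close>.\<close>
  have "M * Im z + Im z / 2 = (2 * M + 1) * (Im z / 2)" by (simp add: algebra_simps)
  also have "\<dots> \<le> (2 * M + 1) * Im u" using u assms by (intro mult_left_mono) auto
  finally show "u \<in> cone (2 * M + 1) x" using u z by (auto simp: cone_def)
  have tri: "cmod (u - of_real x) \<le> cmod (u - z) + cmod (z - of_real x)"
    by (rule order_trans[OF _ norm_triangle_ineq]) simp
  then show "cmod (u - of_real x) \<le> (M + 3/2) * Im z"
    using cone_norm_le[OF assms(1)] assms(3) by (simp add: algebra_simps)
  have "Im z \<le> cmod (z - of_real x)"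
    using abs_Im_le_cmod[of "z - of_real x"] by simp
  then show "cmod (u - of_real x) \<le> 3/2 * cmod (z - of_real x)"
    using tri assms(3) by simp
qed

text \<open>Cauchy's inequality on the disc of radius \<open>Im z / 2\<close> about
  \<open>z\<close>, applied to the remainder \<open>f u - c - d * (u - x)\<close>. The disc stays in
  a wider cone, so the remainder is a small multiple of \<open>Im z\<close> there, and dividing by
  the radius leaves a small bound.\<close>

lemma nontangential_quotient_imp_deriv:
  assumes hol: "f holomorphic_on {z. 0 < Im z} \<inter> ball (of_real x) r" and "r > 0"
    and q: "((\<lambda>z. (f z - c) / (z - of_real x)) \<longlongrightarrow> d) (nontangential x)"
  shows "(f \<longlongrightarrow> c) (nontangential x)" "(deriv f \<longlongrightarrow> d) (nontangential x)"
proof -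
  have "((\<lambda>z. (f z - c) / (z - of_real x) * (z - of_real x) + c) \<longlongrightarrow> d * 0 + c) (nontangential x)"
    by (intro tendsto_add tendsto_mult q tendsto_const)
      (use tendsto_diff[OF nontangential_tendsto[of x] tendsto_const, of "of_real x"] in simp)
  moreover have "eventually (\<lambda>z. (f z - c) / (z - of_real x) * (z - of_real x) + c = f z) (nontangential x)"
    using eventually_nontangential_ne by eventually_elim simp
  ultimately show "(f \<longlongrightarrow> c) (nontangential x)"
    using tendsto_cong by fastforce
  show "(deriv f \<longlongrightarrow> d) (nontangential x)"
  proof (rule tendstoI, unfold eventually_nontangential, intro allI impI)
    fix \<epsilon> M :: real assume "\<epsilon> > 0" "M > 0"
    \<comment> \<open>Cauchy's inequality multiplies the error by \<open>2 * M + 3\<close>; the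
      slightly larger denominator makes the final bound strict.\<close>
    define \<epsilon>' where "\<epsilon>' = \<epsilon> / (2 * M + 4)"
    have \<epsilon>': "\<epsilon>' > 0" "\<epsilon>' * (2 * M + 3) < \<epsilon>"
      using \<open>\<epsilon> > 0\<close> \<open>M > 0\<close> by (auto simp: \<epsilon>'_def field_simps)
    have "eventually (\<lambda>z. dist ((f z - c) / (z - of_real x)) d < \<epsilon>') (nontangential x)"
      by (rule tendstoD[OF q \<epsilon>'(1)])
    then have "eventually (\<lambda>z. dist ((f z - c) / (z - of_real x)) d < \<epsilon>')
        (at_cone (2 * M + 1) x)"
      unfolding eventually_nontangential using \<open>M > 0\<close> by auto
    then obtain \<rho> where \<rho>: "\<rho> > 0"
      "\<And>z. z \<in> cone (2 * M + 1) x \<Longrightarrow> z \<noteq> of_real x \<Longrightarrow> dist z (of_real x) < \<rho> \<Longrightarrow>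
        dist ((f z - c) / (z - of_real x)) d < \<epsilon>'"
      unfolding eventually_at by auto
    show "eventually (\<lambda>z. dist (deriv f z) d < \<epsilon>) (at_cone M x)"
      unfolding eventually_at
    proof (intro exI conjI ballI impI)
      \<comment> \<open>By \<open>cone_disc\<close> distances to the vertex grow at most by the
        factor 3/2 on the disc, so half the radius keeps the disc within both \<rho> and
        \<open>r\<close>.\<close>
      show "0 < min \<rho> r / 2" using \<rho> \<open>r > 0\<close> by simp
      fix z assume z: "z \<in> cone M x" and "z \<noteq> of_real x \<and> dist z (of_real x) < min \<rho> r / 2"
      then have zd: "cmod (z - of_real x) < min \<rho> r / 2" by (simp add: dist_norm)
      have imz: "Im z > 0" using z by (simp add: cone_def)
      note disc = cone_disc[OF z \<open>M > 0\<close>]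
      have small: "cmod (u - of_real x) < \<rho>" "cmod (u - of_real x) < r"
        if "cmod (u - z) \<le> Im z / 2" for u
        using disc(3)[OF that] zd norm_ge_zero[of "z - of_real x"] by linarith+
      define F where "F = (\<lambda>u. f u - c - d * (u - of_real x))"
      have sub: "cball z (Im z / 2) \<subseteq> {z. 0 < Im z} \<inter> ball (of_real x) r"
        using disc(4) small by (auto simp: dist_norm norm_minus_commute)
      have holF: "F holomorphic_on cball z (Im z / 2)"
        unfolding F_def by (intro holomorphic_intros holomorphic_on_subset[OF hol sub])
      have "norm ((deriv ^^ 1) F z) \<le> fact 1 * (\<epsilon>' * ((M + 3/2) * Im z)) / (Im z / 2) ^ 1"
      proof (rule Cauchy_inequality)
        show "F holomorphic_on ball z (Im z / 2)"
          by (rule holomorphic_on_subset[OF holF]) auto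
        show "continuous_on (cball z (Im z / 2)) F"
          by (rule holomorphic_on_imp_continuous_on[OF holF])
        show "0 < Im z / 2" using imz by simp
        fix u assume "norm (z - u) = Im z / 2"
        then have u: "cmod (u - z) \<le> Im z / 2" by (simp add: norm_minus_commute)
        have ux: "u \<noteq> of_real x" using disc(4)[OF u] by auto
        have "dist ((f u - c) / (u - of_real x)) d < \<epsilon>'"
          using \<rho>(2)[OF disc(1)[OF u] ux] small[OF u] by (simp add: dist_norm)
        then have "cmod ((f u - c) / (u - of_real x) - d) * cmod (u - of_real x) \<le> \<epsilon>' * ((M + 3/2) * Im z)"
          by (intro mult_mono disc(2)[OF u]) (use \<epsilon>' in \<open>auto simp: dist_norm\<close>)
        also have "cmod ((f u - c) / (u - of_real x) - d) * cmod (u - of_real x) = cmod (F u)"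
          unfolding norm_mult[symmetric] F_def by (subst left_diff_distrib) (use ux in simp)
        finally show "norm (F u) \<le> \<epsilon>' * ((M + 3/2) * Im z)" .
      qed
      also have "\<dots> = \<epsilon>' * (2 * M + 3)" using imz by (simp add: field_simps)
      finally have "norm (deriv F z) < \<epsilon>" using \<epsilon>' by simp
      have op: "open ({z. 0 < Im z} \<inter> ball (of_real x) r)"
        by (intro open_Int open_ball open_halfspace_Im_gt)
      have "z \<in> {z. 0 < Im z} \<inter> ball (of_real x) r"
        by (rule subsetD[OF sub]) (use imz in simp)
      then have "f field_differentiable at z"
        using hol op holomorphic_on_imp_differentiable_at by blast
      then have "(F has_field_derivative (deriv f z - d)) (at z)"
        unfolding F_def by (auto intro!: derivative_eq_intros simp: DERIV_deriv_iff_field_differentiable)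
      then have "deriv F z = deriv f z - d" by (rule DERIV_imp_deriv)
      then show "dist (deriv f z) d < \<epsilon>"
        using \<open>norm (deriv F z) < \<epsilon>\<close> by (simp add: dist_norm)
    qed
  qed
qed

lemma convex_cone: "convex (cone M x)"
proof -
  have "cone M x = {z. Im z > 0} \<inter> ({z. Re z - M * Im z \<le> x} \<inter> {z. - Re z - M * Im z \<le> - x})"
    by (auto simp: cone_def)
  moreover have "{z. Re z - M * Im z \<le> x} = {z. Complex 1 (- M) \<bullet> z \<le> x}"
    "{z. - Re z - M * Im z \<le> - x} = {z. Complex (-1) (- M) \<bullet> z \<le> - x}"
    by (auto simp: inner_complex_def)
  ultimately show ?thesis
    by (metis convex_Int convex_halfspace_Im_gt convex_halfspace_le)
qed

text \<open>Mean value estimate for the remainder \<open>F\<close> on the truncated cone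
  \<open>S\<close>: convexity turns the bound on its derivative into a Lipschitz bound between
  points \<open>z\<close> and \<open>u\<close> of \<open>S\<close>. The vertex is not in
  \<open>S\<close>; it is reached by letting \<open>u\<close> tend to it.\<close>

lemma nontangential_deriv_imp_quotient:
  assumes hol: "f holomorphic_on {z. 0 < Im z} \<inter> ball (of_real x) r" and "r > 0"
    and f: "(f \<longlongrightarrow> c) (nontangential x)" and f': "(deriv f \<longlongrightarrow> d) (nontangential x)"
  shows "((\<lambda>z. (f z - c) / (z - of_real x)) \<longlongrightarrow> d) (nontangential x)"
proof (rule tendstoI, unfold eventually_nontangential, intro allI impI)
  fix \<epsilon> M :: real assume "\<epsilon> > 0" "M > 0"
  have "eventually (\<lambda>z. dist (deriv f z) d < \<epsilon> / 2) (nontangential x)"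
    by (rule tendstoD[OF f']) (use \<open>\<epsilon> > 0\<close> in simp)
  then have "eventually (\<lambda>z. dist (deriv f z) d < \<epsilon> / 2) (at_cone M x)"
    unfolding eventually_nontangential using \<open>M > 0\<close> by auto
  then obtain \<rho> where \<rho>: "\<rho> > 0"
    "\<And>z. z \<in> cone M x \<Longrightarrow> z \<noteq> of_real x \<Longrightarrow> dist z (of_real x) < \<rho> \<Longrightarrow> dist (deriv f z) d < \<epsilon> / 2"
    unfolding eventually_at by auto
  define S where "S = cone M x \<inter> ball (of_real x) (min \<rho> r)"
  have "convex S" unfolding S_def by (intro convex_Int convex_cone convex_ball)
  define F where "F = (\<lambda>u. f u - c - d * (u - of_real x))"
  have op: "open ({z. 0 < Im z} \<inter> ball (of_real x) r)"
    by (intro open_Int open_ball open_halfspace_Im_gt)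
  have dF: "(F has_field_derivative (deriv f z - d)) (at z within S)" if "z \<in> S" for z
  proof -
    have "z \<in> {z. 0 < Im z} \<inter> ball (of_real x) r"
      using that by (auto simp: S_def cone_def)
    then have "f field_differentiable at z"
      using hol op holomorphic_on_imp_differentiable_at by blast
    then show ?thesis
      unfolding F_def
      by (intro has_field_derivative_at_within[where s = S])
        (auto intro!: derivative_eq_intros simp: DERIV_deriv_iff_field_differentiable)
  qed
  have bd: "norm (deriv f z - d) \<le> \<epsilon> / 2" if "z \<in> S" for z
  proof -
    have "z \<noteq> of_real x" using that by (auto simp: S_def cone_def)
    then show ?thesis
      using \<rho>(2)[of z] that by (auto simp: S_def dist_norm norm_minus_commute)
  qed
  have main: "norm (F z) \<le> \<epsilon> / 2 * norm (z - of_real x)" if z: "z \<in> S" for z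
  proof (rule tendsto_le)
    show "at_cone M x \<noteq> bot"
      by (rule at_within_cone_nontriv) fact
    have fM: "(f \<longlongrightarrow> c) (at_cone M x)"
      using f \<open>M > 0\<close> unfolding tendsto_def eventually_nontangential by auto
    have "(F \<longlongrightarrow> c - c - d * (of_real x - of_real x)) (at_cone M x)"
      unfolding F_def by (intro tendsto_intros fM)
    then show "((\<lambda>u. norm (F z - F u)) \<longlongrightarrow> norm (F z)) (at_cone M x)"
      using tendsto_norm[OF tendsto_diff[OF tendsto_const[of "F z"]]] by force
    show "((\<lambda>u. \<epsilon> / 2 * norm (z - u)) \<longlongrightarrow> \<epsilon> / 2 * norm (z - of_real x)) (at_cone M x)"
      by (intro tendsto_intros)
    show "eventually (\<lambda>u. norm (F z - F u) \<le> \<epsilon> / 2 * norm (z - u)) (at_cone M x)"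
      unfolding eventually_at
    proof (intro exI conjI ballI impI)
      show "0 < min \<rho> r" using \<rho> \<open>r > 0\<close> by simp
      fix u assume "u \<in> cone M x" "u \<noteq> of_real x \<and> dist u (of_real x) < min \<rho> r"
      then have "u \<in> S" by (auto simp: S_def dist_commute)
      then show "norm (F z - F u) \<le> \<epsilon> / 2 * norm (z - u)"
        by (intro field_differentiable_bound[OF \<open>convex S\<close> dF bd]) (use z in auto)
    qed
  qed
  show "eventually (\<lambda>z. dist ((f z - c) / (z - of_real x)) d < \<epsilon>) (at_cone M x)"
    unfolding eventually_at
  proof (intro exI conjI ballI impI)
    show "0 < min \<rho> r" using \<rho> \<open>r > 0\<close> by simp
    fix z assume z: "z \<in> cone M x" "z \<noteq> of_real x \<and> dist z (of_real x) < min \<rho> r"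
    then have "z \<in> S" by (auto simp: S_def dist_commute)
    have "norm ((f z - c) / (z - of_real x) - d) = norm (F z) / norm (z - of_real x)"
      unfolding F_def norm_divide[symmetric] using z by (simp add: diff_divide_distrib)
    also have "\<dots> \<le> \<epsilon> / 2"
      using main[OF \<open>z \<in> S\<close>] z by (simp add: divide_le_eq)
    finally show "dist ((f z - c) / (z - of_real x)) d < \<epsilon>"
      using \<open>\<epsilon> > 0\<close> by (simp add: dist_norm)
  qed
qed


section \<open>Semidefinite kernels and Nevanlinna functions\<close>

abbreviation kform :: "(complex \<Rightarrow> complex \<Rightarrow> complex) \<Rightarrow> nat \<Rightarrow> (nat \<Rightarrow> complex) \<Rightarrow> (nat \<Rightarrow> complex) \<Rightarrow> complex" where
  "kform K m z c \<equiv> (\<Sum>i<m. \<Sum>j<m. cnj (c i) * K (z j) (z i) * c j)"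

definition psd_on :: "complex set \<Rightarrow> (complex \<Rightarrow> complex \<Rightarrow> complex) \<Rightarrow> bool" where
  "psd_on A K \<longleftrightarrow> (\<forall>(m::nat) z c. (\<forall>i<m. z i \<in> A) \<longrightarrow> 0 \<le> Re (kform K m z c))"

lemma psd_onD:
  fixes m :: nat
  assumes "psd_on A K" "\<And>i. i < m \<Longrightarrow> z i \<in> A"
  shows "0 \<le> Re (kform K m z c)"
  using assms unfolding psd_on_def by blast

lemma psd_on_diag:
  assumes "psd_on A K" "\<zeta> \<in> A"
  shows "0 \<le> Re (K \<zeta> \<zeta>)"
  using psd_onD[OF assms(1), of 1 "\<lambda>_. \<zeta>" "\<lambda>_. 1"] assms(2) by simp

text \<open>Adjoining \<zeta> with a free weight \<open>t\<close> to the points gives a quadratic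
  inequality in \<open>t\<close>, whose discriminant condition is the claim.\<close>

lemma psd_cauchy_schwarz:
  fixes m :: nat
  assumes psd: "psd_on A K" and herm: "\<And>u v. u \<in> A \<Longrightarrow> v \<in> A \<Longrightarrow> K u v = cnj (K v u)"
    and z: "\<And>i. i < m \<Longrightarrow> z i \<in> A" and \<zeta>: "\<zeta> \<in> A"
  shows "(cmod (\<Sum>j<m. K (z j) \<zeta> * c j))\<^sup>2 \<le>
    Re (kform K m z c) * Re (K \<zeta> \<zeta>)"
proof -
  define \<beta> where "\<beta> = (\<Sum>j<m. K (z j) \<zeta> * c j)"
  define Q where "Q = Re (kform K m z c)"
  define k where "k = Re (K \<zeta> \<zeta>)"
  have k: "k \<ge> 0" unfolding k_def by (rule psd_on_diag[OF psd \<zeta>])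
  have Q: "Q \<ge> 0" unfolding Q_def by (rule psd_onD[OF psd z])
  have main: "0 \<le> Q - 2 * s * (cmod \<beta>)\<^sup>2 + s\<^sup>2 * (cmod \<beta>)\<^sup>2 * k" for s :: real
  proof -
    \<comment> \<open>A real multiple of \<beta> makes both cross terms real, which leaves a
      quadratic polynomial in \<open>s\<close>.\<close>
    define t where "t = - of_real s * \<beta>"
    define z' where "z' = (\<lambda>i. if i < m then z i else \<zeta>)"
    define c' where "c' = (\<lambda>i. if i < m then c i else t)"
    have cb: "(\<Sum>i<m. cnj (c i) * K \<zeta> (z i)) = cnj \<beta>"
      unfolding \<beta>_def cnj_sum complex_cnj_mult using z \<zeta>
      by (intro sum.cong refl) (simp add: herm[of \<zeta>] mult.commute)
    have "0 \<le> Re (\<Sum>i<Suc m. \<Sum>j<Suc m. cnj (c' i) * K (z' j) (z' i) * c' j)"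
      by (rule psd_onD[OF psd]) (auto simp: z'_def z \<zeta>)
    also have "(\<Sum>i<Suc m. \<Sum>j<Suc m. cnj (c' i) * K (z' j) (z' i) * c' j) =
        kform K m z c + (\<Sum>i<m. cnj (c i) * K \<zeta> (z i)) * t
        + cnj t * \<beta> + cnj t * K \<zeta> \<zeta> * t"
      by (simp add: c'_def z'_def sum.distrib sum_distrib_left sum_distrib_right \<beta>_def mult.assoc)
    also have "Re \<dots> = Q + Re (cnj \<beta> * t) + Re (cnj t * \<beta>) + Re (cnj t * t * K \<zeta> \<zeta>)"
      unfolding cb Q_def by (simp add: algebra_simps)
    also have "cnj \<beta> * t = of_real (- s * (cmod \<beta>)\<^sup>2)"
      unfolding t_def by (simp add: complex_norm_square mult_ac del: of_real_power)
    also have "cnj t * \<beta> = of_real (- s * (cmod \<beta>)\<^sup>2)"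
      unfolding t_def by (simp add: complex_norm_square mult_ac del: of_real_power)
    also have "cnj t * t = of_real (s\<^sup>2 * (cmod \<beta>)\<^sup>2)"
      unfolding t_def of_real_mult complex_norm_square by (simp add: power2_eq_square mult_ac)
    finally show ?thesis
      by (simp add: k_def)
  qed
  show ?thesis
    unfolding \<beta>_def[symmetric] Q_def[symmetric] k_def[symmetric]
  proof (cases "k = 0")
    case True
    show "(cmod \<beta>)\<^sup>2 \<le> Q * k"
    proof (rule ccontr)
      assume "\<not> (cmod \<beta>)\<^sup>2 \<le> Q * k"
      then have pos: "(cmod \<beta>)\<^sup>2 > 0" using True by simp
      \<comment> \<open>With \<open>k = 0\<close> the inequality is linear in \<open>s\<close>, and
        this choice of \<open>s\<close> turns its right side into \<open>- Q - 2\<close>.\<close>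
      have "0 \<le> Q - 2 * ((Q + 1) / (cmod \<beta>)\<^sup>2) * (cmod \<beta>)\<^sup>2"
        using main[of "(Q + 1) / (cmod \<beta>)\<^sup>2"] True by simp
      also have "\<dots> = Q - 2 * (Q + 1)" using pos by simp
      finally show False using Q by simp
    qed
  next
    case False
    then have "k > 0" using k by simp
    have "0 \<le> (Q - 2 * (1 / k) * (cmod \<beta>)\<^sup>2 + (1 / k)\<^sup>2 * (cmod \<beta>)\<^sup>2 * k) * k"
      using main[of "1 / k"] k by (intro mult_nonneg_nonneg) auto
    also have "\<dots> = Q * k - (cmod \<beta>)\<^sup>2"
      using \<open>k > 0\<close> by (simp add: field_simps power2_eq_square)
    finally show "(cmod \<beta>)\<^sup>2 \<le> Q * k" by simp
  qed
qed

section \<open>Nevanlinna kernels and two-point estimates\<close>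

lemma nev_kernel_hermitian: "nev_kernel f z \<zeta> = cnj (nev_kernel f \<zeta> z)"
proof -
  have "cnj (nev_kernel f \<zeta> z) = - (f z - cnj (f \<zeta>)) / - (z - cnj \<zeta>)"
    unfolding nev_kernel_def by simp
  then show ?thesis unfolding nev_kernel_def by (simp only: minus_divide_divide)
qed

lemma nev_kernel_diag: "Im z \<noteq> 0 \<Longrightarrow> nev_kernel f z z = of_real (Im (f z) / Im z)"
  unfolding nev_kernel_def complex_diff_cnj by (simp add: field_simps)

lemma diff_cnj_nonzero:
  assumes "0 < Im z" "0 < Im \<zeta>"
  shows "z - cnj \<zeta> \<noteq> 0"
  using assms by (auto simp: complex_eq_iff)

lemma psd_kernel_Im_nonneg:
  assumes "psd_on A (nev_kernel f)" "z \<in> A" "0 < Im z"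
  shows "0 \<le> Im (f z)"
  using psd_on_diag[OF assms(1,2)] assms(3) by (simp add: nev_kernel_diag field_simps)

text \<open>The Schwarz-Pick inequality: Cauchy-Schwarz for the kernel at two points, with
  denominators cleared.\<close>

lemma psd_kernel_two_point:
  assumes "psd_on A (nev_kernel f)" "z \<in> A" "\<zeta> \<in> A" "0 < Im z" "0 < Im \<zeta>"
  shows "(cmod (f z - cnj (f \<zeta>)))\<^sup>2 * (Im z * Im \<zeta>) \<le> (cmod (z - cnj \<zeta>))\<^sup>2 * (Im (f z) * Im (f \<zeta>))"
proof -
  have "(cmod (nev_kernel f z \<zeta>))\<^sup>2 \<le> Re (nev_kernel f z z) * Re (nev_kernel f \<zeta> \<zeta>)"
    using psd_cauchy_schwarz[OF assms(1) nev_kernel_hermitian, of 1 "\<lambda>_. z" \<zeta> "\<lambda>_. 1"] assms(2,3)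
    by simp
  then show ?thesis
    using assms(4,5) diff_cnj_nonzero[OF assms(4,5)]
    by (simp add: nev_kernel_diag) (simp add: nev_kernel_def norm_divide power_divide field_simps)
qed

text \<open>A Harnack-type bound. Since \<open>Im (f \<zeta>) \<ge> 0\<close>, the left side
  \<open>T\<close> dominates \<open>Im (f z)\<close>, so one factor \<open>T\<close> cancels in the
  two-point inequality and \<open>f z\<close> is controlled by \<open>f \<zeta>\<close>
  alone.\<close>

lemma psd_kernel_bound:
  assumes "psd_on A (nev_kernel f)" "z \<in> A" "\<zeta> \<in> A" "0 < Im z" "0 < Im \<zeta>"
  shows "cmod (f z - cnj (f \<zeta>)) \<le> (cmod (z - cnj \<zeta>))\<^sup>2 / (Im z * Im \<zeta>) * Im (f \<zeta>)"
proof -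
  define T where "T = cmod (f z - cnj (f \<zeta>))"
  define C where "C = (cmod (z - cnj \<zeta>))\<^sup>2 / (Im z * Im \<zeta>)"
  have B: "0 \<le> Im (f \<zeta>)" by (rule psd_kernel_Im_nonneg[OF assms(1,3,5)])
  have "Im (f z) + Im (f \<zeta>) \<le> T"
    using abs_Im_le_cmod[of "f z - cnj (f \<zeta>)"] by (simp add: T_def)
  then have "Im (f z) \<le> T" using B by simp
  have C: "C \<ge> 0" unfolding C_def using assms by simp
  have "T\<^sup>2 \<le> C * (Im (f z) * Im (f \<zeta>))"
    using psd_kernel_two_point[OF assms] assms unfolding T_def C_def by (simp add: field_simps)
  also have "\<dots> \<le> C * (T * Im (f \<zeta>))"
    by (intro mult_left_mono mult_right_mono) fact+
  finally have "T * T \<le> T * (C * Im (f \<zeta>))"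
    by (simp add: power2_eq_square mult_ac)
  then have "T \<le> C * Im (f \<zeta>)"
    using B C by (cases "T > 0") (auto simp: not_less intro: order_trans)
  then show ?thesis by (simp add: T_def C_def)
qed

text \<open>Records positivity of the kernel only. The boundary residue lemmas rest on it, and it
  passes to \<open>- 1 / (f - \<eta>)\<close> by a mere rescaling.\<close>

definition nevanlinna :: "(complex \<Rightarrow> complex) \<Rightarrow> bool" where
  "nevanlinna f \<longleftrightarrow> psd_on {z. 0 < Im z} (nev_kernel f)"

text \<open>A real value inside the half plane makes the bound of \<open>psd_kernel_bound\<close>
  zero, so the function is constant.\<close>

lemma nevanlinna_real_value:
  assumes "nevanlinna f" "0 < Im \<zeta>" "Im (f \<zeta>) = 0" "0 < Im z"
  shows "f z = f \<zeta>"
proof -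
  have "cmod (f z - cnj (f \<zeta>)) \<le> 0"
    using psd_kernel_bound[OF assms(1)[unfolded nevanlinna_def], of z \<zeta>] assms by simp
  then show ?thesis using assms(3) by (simp add: complex_eq_iff)
qed

text \<open>The kernel of the transform is the kernel of \<open>f\<close> divided by
  \<open>(f u - \<eta>) * cnj (f v - \<eta>)\<close>, and these factors can be absorbed into the
  weights \<open>c\<close>.\<close>

lemma nevanlinna_neg_recip:
  assumes f: "nevanlinna f" and nz: "\<And>z. 0 < Im z \<Longrightarrow> f z \<noteq> of_real \<eta>"
  shows "nevanlinna (\<lambda>z. - 1 / (f z - of_real \<eta>))"
  unfolding nevanlinna_def psd_on_def
proof (intro allI impI)
  fix m :: nat and z c :: "nat \<Rightarrow> complex"
  assume z: "\<forall>i<m. z i \<in> {z. 0 < Im z}"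
  define c' where "c' = (\<lambda>j. c j / (f (z j) - of_real \<eta>))"
  have K: "nev_kernel (\<lambda>z. - 1 / (f z - of_real \<eta>)) u v =
      nev_kernel f u v / ((f u - of_real \<eta>) * cnj (f v - of_real \<eta>))" if "0 < Im u" "0 < Im v" for u v
  proof -
    have "- 1 / (f u - of_real \<eta>) - cnj (- 1 / (f v - of_real \<eta>)) =
        (f u - cnj (f v)) / ((f u - of_real \<eta>) * cnj (f v - of_real \<eta>))"
      using nz[OF that(1)] nz[OF that(2)] by (simp add: field_simps flip: complex_cnj_cancel_iff[of "f v"])
    then show ?thesis unfolding nev_kernel_def by simp
  qed
  have "0 \<le> Re (kform (nev_kernel f) m z c')"
    by (rule psd_onD[OF f[unfolded nevanlinna_def]]) (use z in auto)
  also have "kform (nev_kernel f) m z c' =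
      (\<Sum>i<m. \<Sum>j<m. cnj (c i) * nev_kernel (\<lambda>z. - 1 / (f z - of_real \<eta>)) (z j) (z i) * c j)"
    using z by (intro sum.cong refl, subst K) (auto simp: c'_def mult_ac)
  finally show "0 \<le> Re (\<Sum>i<m. \<Sum>j<m. cnj (c i) * nev_kernel (\<lambda>z. - 1 / (f z - of_real \<eta>)) (z j) (z i) * c j)" .
qed

text \<open>With \<open>A\<close>, \<open>B\<close> the imaginary parts at heights \<open>y\<close>,
  \<open>y'\<close>, the two-point inequality factors as
  \<open>(y * A - y' * B) * (y' * A - y * B) \<le> 0\<close>. If the first factor were positive, so
  would be the second.\<close>

lemma nevanlinna_vertical_mono:
  assumes g: "nevanlinna g" and "0 < y" "y < y'"
  shows "y * Im (g (Complex x y)) \<le> y' * Im (g (Complex x y'))"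
proof (rule ccontr)
  define A where "A = Im (g (Complex x y))"
  define B where "B = Im (g (Complex x y'))"
  assume "\<not> ?thesis"
  then have gt: "y * A > y' * B" by (simp add: A_def B_def)
  note g = g[unfolded nevanlinna_def]
  have A: "A \<ge> 0" and B: "B \<ge> 0"
    unfolding A_def B_def using assms psd_kernel_Im_nonneg[OF g] by auto
  have "(A + B)\<^sup>2 \<le> (cmod (g (Complex x y) - cnj (g (Complex x y'))))\<^sup>2"
    unfolding cmod_power2 by (simp add: A_def B_def)
  then have "(A + B)\<^sup>2 * (y * y') \<le> (cmod (g (Complex x y) - cnj (g (Complex x y'))))\<^sup>2 * (y * y')"
    using assms by (intro mult_right_mono) auto
  also have "\<dots> \<le> (cmod (Complex x y - cnj (Complex x y')))\<^sup>2 * (A * B)"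
    using psd_kernel_two_point[OF g, of "Complex x y" "Complex x y'"] assms by (simp add: A_def B_def)
  also have "(cmod (Complex x y - cnj (Complex x y')))\<^sup>2 = (y + y')\<^sup>2"
    unfolding cmod_power2 by simp
  finally have "(y * A - y' * B) * (y' * A - y * B) \<le> 0"
    by (simp add: power2_eq_square algebra_simps)
  moreover have "y' * A \<ge> y * A" "y * B \<le> y' * B"
    using assms A B by (auto intro: mult_right_mono)
  then have "(y * A - y' * B) * (y' * A - y * B) > 0"
    using gt by (intro mult_pos_pos) auto
  ultimately show False by simp
qed

text \<open>By monotonicity the imaginary part converges to its infimum \<mu>, the mass at
  \<open>x\<close>. For the real part, \<open>x + i y\<close> is compared with a fixed height
  \<delta> at which \<open>a\<close> nearly equals \<mu>; the two-point inequality then leaves the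
  real part almost no room.\<close>

lemma nevanlinna_vertical_residue:
  assumes g: "nevanlinna g"
  obtains \<mu> :: real where "\<mu> \<ge> 0" "((\<lambda>y. of_real y * g (Complex x y)) \<longlongrightarrow> \<i> * of_real \<mu>) (at_right 0)"
proof -
  note g' = g[unfolded nevanlinna_def]
  define a where "a = (\<lambda>y. y * Im (g (Complex x y)))"
  define R where "R = (\<lambda>y. Re (g (Complex x y)))"
  have a_nonneg: "a y \<ge> 0" if "y > 0" for y
    unfolding a_def using that psd_kernel_Im_nonneg[OF g', of "Complex x y"] by simp
  have a_mono: "a y \<le> a y'" if "0 < y" "y < y'" for y y'
    unfolding a_def by (rule nevanlinna_vertical_mono[OF g that])
  define \<mu> where "\<mu> = Inf (a ` {0<..})"
  have bdd: "bdd_below (a ` {0<..})"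
    using a_nonneg by (intro bdd_belowI[of _ 0]) auto
  have \<mu>: "\<mu> \<ge> 0" unfolding \<mu>_def using a_nonneg by (intro cInf_greatest) auto
  have \<mu>_le: "\<mu> \<le> a y" if "y > 0" for y
    unfolding \<mu>_def using that bdd by (intro cInf_lower) auto
  have a_near: "\<exists>\<delta>>0. a \<delta> < \<mu> + e" if "e > 0" for e
  proof -
    have "\<exists>v\<in>a ` {0<..}. v < \<mu> + e"
      using cInf_lessD[of "a ` {0<..}" "\<mu> + e"] that unfolding \<mu>_def by auto
    then show ?thesis by auto
  qed
  have a_lim: "(a \<longlongrightarrow> \<mu>) (at_right 0)"
  proof (rule tendstoI)
    fix e :: real assume "e > 0"
    then obtain \<delta> where \<delta>: "\<delta> > 0" "a \<delta> < \<mu> + e" using a_near by blast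
    show "eventually (\<lambda>y. dist (a y) \<mu> < e) (at_right 0)"
      unfolding eventually_at_right_field
      by (intro exI[of _ \<delta>]) (use \<delta> \<mu>_le a_mono in \<open>fastforce simp: dist_real_def\<close>)
  qed
  have R_lim: "((\<lambda>y. y * R y) \<longlongrightarrow> 0) (at_right 0)"
  proof (rule tendstoI)
    fix e :: real assume "e > 0"
    define \<epsilon> where "\<epsilon> = e / 2"
    have "\<epsilon> > 0" using \<open>e > 0\<close> by (simp add: \<epsilon>_def)
    \<comment> \<open>The limit of \<open>r\<close> below is
      \<open>\<mu> * (a \<delta> - \<mu>)\<close>, which has to stay under
      \<open>\<epsilon>\<^sup>2\<close>; the denominator \<open>\<mu> + 1\<close> also covers
      \<open>\<mu> = 0\<close>.\<close>
    obtain \<delta> where \<delta>: "\<delta> > 0" "a \<delta> < \<mu> + \<epsilon>\<^sup>2 / (\<mu> + 1)"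
      using a_near[of "\<epsilon>\<^sup>2 / (\<mu> + 1)"] \<open>\<epsilon> > 0\<close> \<mu> by auto
    have "\<mu> * (a \<delta> - \<mu>) \<le> \<mu> * (\<epsilon>\<^sup>2 / (\<mu> + 1))"
      using \<delta> \<mu> by (intro mult_left_mono) auto
    also have "\<dots> < \<epsilon>\<^sup>2" using \<mu> \<open>\<epsilon> > 0\<close> by (simp add: field_simps)
    finally have small: "\<mu> * (a \<delta> - \<mu>) < \<epsilon>\<^sup>2" .
    define B where "B = Im (g (Complex x \<delta>))"
    \<comment> \<open>The two-point inequality multiplied by \<open>y / \<delta>\<close> and solved
      for the square of the real part.\<close>
    define r where "r = (\<lambda>y. (y + \<delta>)\<^sup>2 / \<delta> * a y * B - (a y + y * B)\<^sup>2)"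
    have bound: "(y * R y - y * R \<delta>)\<^sup>2 \<le> r y" if "y > 0" for y
    proof -
      have "(cmod (g (Complex x y) - cnj (g (Complex x \<delta>))))\<^sup>2 = (R y - R \<delta>)\<^sup>2 + (Im (g (Complex x y)) + B)\<^sup>2"
        unfolding cmod_power2 by (simp add: R_def B_def)
      moreover have "(cmod (Complex x y - cnj (Complex x \<delta>)))\<^sup>2 = (y + \<delta>)\<^sup>2"
        unfolding cmod_power2 by simp
      ultimately have "((R y - R \<delta>)\<^sup>2 + (Im (g (Complex x y)) + B)\<^sup>2) * (y * \<delta>) \<le> (y + \<delta>)\<^sup>2 * (Im (g (Complex x y)) * B)"
        using psd_kernel_two_point[OF g', of "Complex x y" "Complex x \<delta>"] that \<delta> by (simp add: B_def)
      then have "((R y - R \<delta>)\<^sup>2 + (Im (g (Complex x y)) + B)\<^sup>2) * (y * \<delta>) * (y / \<delta>)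
          \<le> (y + \<delta>)\<^sup>2 * (Im (g (Complex x y)) * B) * (y / \<delta>)"
        using that \<delta> by (intro mult_right_mono) auto
      moreover have "((R y - R \<delta>)\<^sup>2 + (Im (g (Complex x y)) + B)\<^sup>2) * (y * \<delta>) * (y / \<delta>) =
          (y * R y - y * R \<delta>)\<^sup>2 + (a y + y * B)\<^sup>2"
        using \<delta> by (simp add: a_def) (simp add: power2_eq_square algebra_simps)
      moreover have "(y + \<delta>)\<^sup>2 * (Im (g (Complex x y)) * B) * (y / \<delta>) = (y + \<delta>)\<^sup>2 / \<delta> * a y * B"
        by (simp add: a_def)
      ultimately show ?thesis unfolding r_def by linarith
    qed
    have "(r \<longlongrightarrow> (0 + \<delta>)\<^sup>2 / \<delta> * \<mu> * B - (\<mu> + 0 * B)\<^sup>2) (at_right 0)"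
      unfolding r_def using \<delta> by (intro tendsto_intros a_lim) auto
    also have "(0 + \<delta>)\<^sup>2 / \<delta> * \<mu> * B - (\<mu> + 0 * B)\<^sup>2 = \<mu> * (a \<delta> - \<mu>)"
      using \<delta> by (simp add: a_def B_def power2_eq_square algebra_simps)
    finally have 1: "eventually (\<lambda>y. r y < \<epsilon>\<^sup>2) (at_right 0)"
      using small by (rule order_tendstoD)
    have "((\<lambda>y. y * R \<delta>) \<longlongrightarrow> 0 * R \<delta>) (at_right 0)"
      by (intro tendsto_intros)
    then have 2: "eventually (\<lambda>y. dist (y * R \<delta>) 0 < \<epsilon>) (at_right 0)"
      using tendstoD \<open>\<epsilon> > 0\<close> by fastforce
    have 3: "eventually (\<lambda>y::real. y > 0) (at_right 0)"
      by (simp add: eventually_at_right_less)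
    from 1 2 3 show "eventually (\<lambda>y. dist (y * R y) 0 < e) (at_right 0)"
    proof eventually_elim
      case (elim y)
      have "(y * R y - y * R \<delta>)\<^sup>2 < \<epsilon>\<^sup>2" using bound[OF elim(3)] elim(1) by simp
      then have "\<bar>y * R y - y * R \<delta>\<bar> < \<epsilon>"
        using \<open>\<epsilon> > 0\<close> by (metis abs_le_square_iff abs_of_pos linorder_not_le)
      then show ?case using elim(2) by (simp add: \<epsilon>_def dist_real_def abs_if split: if_splits)
    qed
  qed
  have "((\<lambda>y. Complex (y * R y) (a y)) \<longlongrightarrow> Complex 0 \<mu>) (at_right 0)"
    by (intro tendsto_Complex R_lim a_lim)
  moreover have "(\<lambda>y. Complex (y * R y) (a y)) = (\<lambda>y. of_real y * g (Complex x y))"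
    by (auto simp: R_def a_def complex_eq_iff)
  moreover have "Complex 0 \<mu> = \<i> * of_real \<mu>" by (simp add: complex_eq_iff)
  ultimately show ?thesis using that[OF \<mu>] by simp
qed

text \<open>
  Subtracting the point mass \<open>\<mu>\<close> at \<open>x\<close> keeps the kernel semidefinite: this is Cauchy--Schwarz
  against the kernel function at \<open>x + i y\<close>, rescaled by \<open>y \<rightarrow> 0\<close>.
\<close>

lemma nevanlinna_remove_mass:
  assumes g: "nevanlinna g" and \<mu>: "\<mu> \<ge> 0"
    and lim: "((\<lambda>y. of_real y * g (Complex x y)) \<longlongrightarrow> \<i> * of_real \<mu>) (at_right 0)"
  shows "nevanlinna (\<lambda>z. g z + of_real \<mu> / (z - of_real x))"
  unfolding nevanlinna_def psd_on_def
proof (intro allI impI)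
  fix m :: nat and z c :: "nat \<Rightarrow> complex"
  assume z: "\<forall>i<m. z i \<in> {z. 0 < Im z}"
  let ?g1 = "\<lambda>z. g z + of_real \<mu> / (z - of_real x)"
  define v where "v = (\<Sum>j<m. c j / (z j - of_real x))"
  define Q where "Q = Re (kform (nev_kernel g) m z c)"
  note g' = g[unfolded nevanlinna_def]
  have zx: "z i \<noteq> of_real x" if "i < m" for i using z that by auto
  have Q0: "Q \<ge> 0" unfolding Q_def by (rule psd_onD[OF g']) (use z in auto)
  \<comment> \<open>The function \<open>- \<mu> / (z - x)\<close> has the rank-one kernel
    \<open>\<mu> / ((u - x) * cnj (w - x))\<close>; removing it lowers the form by
    \<open>\<mu> * (cmod v)\<^sup>2\<close>.\<close>
  have K: "nev_kernel ?g1 u w = nev_kernel g u w - of_real \<mu> / ((u - of_real x) * cnj (w - of_real x))"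
    if "0 < Im u" "0 < Im w" for u w
  proof -
    have ne: "u - of_real x \<noteq> 0" "cnj w - of_real x \<noteq> 0" using that by (auto simp: complex_eq_iff)
    have frac: "t / a - t / b = - (t / (a * b)) * (a - b)" if "a \<noteq> 0" "b \<noteq> 0" for t a b :: complex
      using that by (simp add: field_simps)
    have "of_real \<mu> / (u - of_real x) - of_real \<mu> / (cnj w - of_real x) =
        - (of_real \<mu> / ((u - of_real x) * (cnj w - of_real x))) * (u - cnj w)"
      using frac[OF ne, of "of_real \<mu>"] by simp
    then have "(of_real \<mu> / (u - of_real x) - of_real \<mu> / (cnj w - of_real x)) / (u - cnj w) =
        - (of_real \<mu> / ((u - of_real x) * (cnj w - of_real x)))"
      using diff_cnj_nonzero[OF that] by simp
    moreover have "nev_kernel ?g1 u w = nev_kernel g u w +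
        (of_real \<mu> / (u - of_real x) - of_real \<mu> / (cnj w - of_real x)) / (u - cnj w)"
      unfolding nev_kernel_def by (simp add: diff_divide_distrib add_divide_distrib)
    ultimately show ?thesis by simp
  qed
  have "kform (nev_kernel ?g1) m z c =
      kform (nev_kernel g) m z c -
      (\<Sum>i<m. \<Sum>j<m. of_real \<mu> * (cnj (c i / (z i - of_real x)) * (c j / (z j - of_real x))))"
    unfolding sum_subtractf[symmetric] using z
    by (intro sum.cong refl) (simp add: K algebra_simps)
  also have "(\<Sum>i<m. \<Sum>j<m. of_real \<mu> * (cnj (c i / (z i - of_real x)) * (c j / (z j - of_real x)))) =
      of_real \<mu> * (cnj v * v)"
    by (simp only: v_def cnj_sum sum_product) (simp only: sum_distrib_left)
  also have "of_real \<mu> * (cnj v * v) = of_real (\<mu> * (cmod v)\<^sup>2)"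
    by (simp only: of_real_mult complex_norm_square mult_ac)
  finally have "Re (kform (nev_kernel ?g1) m z c) = Q - \<mu> * (cmod v)\<^sup>2"
    by (simp add: Q_def)
  moreover have "\<mu> * (cmod v)\<^sup>2 \<le> Q"
  proof (cases "\<mu> = 0")
    case False
    let ?F = "\<lambda>y. of_real y * (\<Sum>j<m. nev_kernel g (z j) (Complex x y) * c j)"
    have "((\<lambda>y. \<Sum>j<m. (of_real y * g (z j) - cnj (of_real y * g (Complex x y))) / (z j - cnj (Complex x y)) * c j)
        \<longlongrightarrow> (\<Sum>j<m. (of_real 0 * g (z j) - cnj (\<i> * of_real \<mu>)) / (z j - cnj (Complex x 0)) * c j)) (at_right 0)"
      by (intro tendsto_intros lim tendsto_sum tendsto_Complex)
        (use zx in \<open>auto simp: complex_eq_iff\<close>)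
    also have "(\<lambda>y. \<Sum>j<m. (of_real y * g (z j) - cnj (of_real y * g (Complex x y))) / (z j - cnj (Complex x y)) * c j) = ?F"
      unfolding sum_distrib_left nev_kernel_def by (intro ext sum.cong refl) (simp add: algebra_simps)
    also have "(\<Sum>j<m. (of_real 0 * g (z j) - cnj (\<i> * of_real \<mu>)) / (z j - cnj (Complex x 0)) * c j) = \<i> * of_real \<mu> * v"
      unfolding v_def sum_distrib_left by (intro sum.cong refl) (simp add: complex_of_real_def[symmetric])
    finally have F: "(?F \<longlongrightarrow> \<i> * of_real \<mu> * v) (at_right 0)" .
    have a_lim: "((\<lambda>y. Im (of_real y * g (Complex x y))) \<longlongrightarrow> \<mu>) (at_right 0)"
      using tendsto_Im[OF lim] by simp
    have "(cmod (\<i> * of_real \<mu> * v))\<^sup>2 \<le> Q * \<mu>"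
    proof (rule tendsto_le)
      show "((\<lambda>y. (cmod (?F y))\<^sup>2) \<longlongrightarrow> (cmod (\<i> * of_real \<mu> * v))\<^sup>2) (at_right 0)"
        by (intro tendsto_intros F)
      show "((\<lambda>y. Q * Im (of_real y * g (Complex x y))) \<longlongrightarrow> Q * \<mu>) (at_right 0)"
        by (intro tendsto_intros a_lim)
      show "eventually (\<lambda>y. (cmod (?F y))\<^sup>2 \<le> Q * Im (of_real y * g (Complex x y))) (at_right 0)"
        using eventually_at_right_less[of 0]
      proof eventually_elim
        case (elim y)
        have "(cmod (\<Sum>j<m. nev_kernel g (z j) (Complex x y) * c j))\<^sup>2 \<le> Q * Re (nev_kernel g (Complex x y) (Complex x y))"
          unfolding Q_def
          by (rule psd_cauchy_schwarz[OF g' nev_kernel_hermitian]) (use z elim in auto)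
        then have "y\<^sup>2 * (cmod (\<Sum>j<m. nev_kernel g (z j) (Complex x y) * c j))\<^sup>2 \<le>
            y\<^sup>2 * (Q * (Im (g (Complex x y)) / y))"
          using elim by (intro mult_left_mono) (auto simp: nev_kernel_diag)
        then show ?case
          using elim by (simp add: norm_mult power_mult_distrib power2_eq_square mult_ac)
      qed
    qed simp
    then have "(\<mu> * (cmod v)\<^sup>2) * \<mu> \<le> Q * \<mu>"
      using \<mu> by (simp add: norm_mult power2_eq_square mult_ac)
    then show ?thesis using \<mu> False by (simp add: mult_ac)
  qed (use Q0 in simp)
  ultimately show "0 \<le> Re (kform (nev_kernel ?g1) m z c)"
    by simp
qed

text \<open>\<open>psd_kernel_bound\<close> compares \<open>z\<close> with the point of the same
  height above \<open>x\<close>, but only up to a constant depending on the aperture. This carries a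
  limit zero, and no other, from the vertical ray to the cone; hence the mass \<mu> is removed
  beforehand.\<close>

lemma nevanlinna_nontangential_residue:
  assumes g: "nevanlinna g"
  obtains \<mu> :: real where "\<mu> \<ge> 0"
    "((\<lambda>z. (z - of_real x) * g z) \<longlongrightarrow> - of_real \<mu>) (nontangential x)"
proof -
  obtain \<mu> where \<mu>: "\<mu> \<ge> 0"
    and lim: "((\<lambda>y. of_real y * g (Complex x y)) \<longlongrightarrow> \<i> * of_real \<mu>) (at_right 0)"
    using nevanlinna_vertical_residue[OF g] by blast
  define g1 where "g1 = (\<lambda>z. g z + of_real \<mu> / (z - of_real x))"
  have g1: "psd_on {z. 0 < Im z} (nev_kernel g1)"
    using nevanlinna_remove_mass[OF g \<mu> lim] unfolding nevanlinna_def g1_def .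
  have "((\<lambda>y. of_real y * g (Complex x y) + of_real \<mu> / \<i>) \<longlongrightarrow> \<i> * of_real \<mu> + of_real \<mu> / \<i>) (at_right 0)"
    by (intro tendsto_intros lim) auto
  moreover have "eventually (\<lambda>y. of_real y * g (Complex x y) + of_real \<mu> / \<i> = of_real y * g1 (Complex x y)) (at_right 0)"
    using eventually_at_right_less[of 0]
  proof eventually_elim
    case (elim y)
    have "Complex x y - of_real x = \<i> * of_real y" by (simp add: complex_eq_iff)
    then show ?case using elim by (simp add: g1_def algebra_simps)
  qed
  ultimately have lim1: "((\<lambda>y. of_real y * g1 (Complex x y)) \<longlongrightarrow> 0) (at_right 0)"
    by (simp add: tendsto_cong divide_i)
  have "((\<lambda>z. (z - of_real x) * g1 z) \<longlongrightarrow> 0) (nontangential x)"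
  proof (rule tendstoI, unfold eventually_nontangential, intro allI impI)
    fix \<epsilon> M :: real assume "\<epsilon> > 0" "M > 0"
    \<comment> \<open>\<open>M\<^sup>2 + 4\<close> bounds
      \<open>(cmod (z - cnj \<zeta>))\<^sup>2 / y\<^sup>2\<close> for the point \<zeta> above
      \<open>x\<close> at the height \<open>y\<close> of \<open>z\<close>; the factor
      \<open>M + 1\<close> comes from \<open>cone_norm_le\<close>.\<close>
    define C where "C = (M + 1) * (1 + (M\<^sup>2 + 4))"
    have "C > 0" using \<open>M > 0\<close> by (auto simp: C_def intro!: mult_pos_pos add_pos_nonneg)
    have "eventually (\<lambda>y. dist (of_real y * g1 (Complex x y)) 0 < \<epsilon> / C) (at_right 0)"
      by (rule tendstoD[OF lim1]) (use \<open>\<epsilon> > 0\<close> \<open>C > 0\<close> in simp)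
    then obtain \<rho> where \<rho>: "\<rho> > 0"
      "\<And>y. 0 < y \<Longrightarrow> y < \<rho> \<Longrightarrow> cmod (of_real y * g1 (Complex x y)) < \<epsilon> / C"
      unfolding eventually_at_right_field by auto
    show "eventually (\<lambda>z. dist ((z - of_real x) * g1 z) 0 < \<epsilon>) (at_cone M x)"
      unfolding eventually_at
    proof (intro exI conjI ballI impI)
      show "0 < \<rho>" by fact
      fix z assume z: "z \<in> cone M x" and "z \<noteq> of_real x \<and> dist z (of_real x) < \<rho>"
      then have zd: "cmod (z - of_real x) < \<rho>" by (simp add: dist_norm)
      define y where "y = Im z"
      have y: "0 < y" "\<bar>Re z - x\<bar> \<le> M * y" using z by (auto simp: cone_def y_def)
      have "y < \<rho>" using abs_Im_le_cmod[of "z - of_real x"] zd by (simp add: y_def)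
      let ?\<zeta> = "Complex x y"
      have "(cmod (z - cnj ?\<zeta>))\<^sup>2 = (Re z - x)\<^sup>2 + (2 * y)\<^sup>2"
        unfolding cmod_power2 by (simp add: y_def)
      also have "\<dots> \<le> (M * y)\<^sup>2 + (2 * y)\<^sup>2"
        using y \<open>M > 0\<close> by (intro add_right_mono) (metis abs_ge_zero power2_abs power_mono)
      also have "\<dots> = (M\<^sup>2 + 4) * y\<^sup>2" by (simp add: algebra_simps power2_eq_square)
      finally have "(cmod (z - cnj ?\<zeta>))\<^sup>2 / (y * y) \<le> M\<^sup>2 + 4"
        using y by (simp add: divide_le_eq power2_eq_square)
      then have "(cmod (z - cnj ?\<zeta>))\<^sup>2 / (y * y) * Im (g1 ?\<zeta>) \<le> (M\<^sup>2 + 4) * cmod (g1 ?\<zeta>)"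
        using psd_kernel_Im_nonneg[OF g1, of ?\<zeta>] y abs_Im_le_cmod[of "g1 ?\<zeta>"] by (intro mult_mono) auto
      moreover have "cmod (g1 z - cnj (g1 ?\<zeta>)) \<le> (cmod (z - cnj ?\<zeta>))\<^sup>2 / (y * y) * Im (g1 ?\<zeta>)"
        using psd_kernel_bound[OF g1, of z ?\<zeta>] y by (simp add: y_def)
      moreover have "cmod (g1 z) \<le> cmod (g1 z - cnj (g1 ?\<zeta>)) + cmod (g1 ?\<zeta>)"
        using norm_triangle_ineq[of "g1 z - cnj (g1 ?\<zeta>)" "cnj (g1 ?\<zeta>)"] by simp
      ultimately have "cmod (g1 z) \<le> (1 + (M\<^sup>2 + 4)) * cmod (g1 ?\<zeta>)"
        by (simp add: algebra_simps)
      then have "cmod (z - of_real x) * cmod (g1 z) \<le> ((M + 1) * y) * ((1 + (M\<^sup>2 + 4)) * cmod (g1 ?\<zeta>))"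
        using cone_norm_le[OF z] y \<open>M > 0\<close> by (intro mult_mono) (auto simp: y_def)
      also have "\<dots> = C * cmod (of_real y * g1 ?\<zeta>)"
        using y by (simp add: C_def norm_mult mult_ac)
      also have "\<dots> < \<epsilon>"
        using \<rho>(2)[OF y(1) \<open>y < \<rho>\<close>] \<open>C > 0\<close> by (simp add: field_simps)
      finally show "dist ((z - of_real x) * g1 z) 0 < \<epsilon>" by (simp add: norm_mult)
    qed
  qed
  then have "((\<lambda>z. (z - of_real x) * g1 z - of_real \<mu>) \<longlongrightarrow> 0 - of_real \<mu>) (nontangential x)"
    by (intro tendsto_intros)
  moreover have "eventually (\<lambda>z. (z - of_real x) * g1 z - of_real \<mu> = (z - of_real x) * g z) (nontangential x)"
    using eventually_nontangential_ne by eventually_elim (simp add: g1_def distrib_left)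
  ultimately have "((\<lambda>z. (z - of_real x) * g z) \<longlongrightarrow> - of_real \<mu>) (nontangential x)"
    by (simp add: tendsto_cong)
  then show ?thesis using that[OF \<mu>] by blast
qed

text \<open>The contrapositive of the Julia--Caratheodory theorem.\<close>

lemma nevanlinna_kernel_at_infinity:
  assumes f: "nevanlinna f" and \<eta>: "(f \<longlongrightarrow> of_real \<eta>) (nontangential x)"
    and ne: "\<And>z. 0 < Im z \<Longrightarrow> f z \<noteq> of_real \<eta>"
    and inf: "((\<lambda>z. (z - of_real x) / (f z - of_real \<eta>)) \<longlongrightarrow> 0) (nontangential x)"
  shows "filterlim (\<lambda>z. nev_kernel f z z) at_infinity (nontangential x)"
  unfolding filterlim_at_infinity[OF order.refl]
proof (intro allI impI, unfold eventually_nontangential, intro allI impI)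
  fix B M :: real assume "B > 0" "M > 0"
  note f' = f[unfolded nevanlinna_def]
  let ?F = "at_cone M x"
  show "eventually (\<lambda>z. B \<le> cmod (nev_kernel f z z)) ?F"
  proof (rule ccontr)
    assume "\<not> eventually (\<lambda>z. B \<le> cmod (nev_kernel f z z)) ?F"
    \<comment> \<open>If the kernel is not eventually large in the cone, it is frequently below
      \<open>B\<close>. The filter \<open>G\<close> plays the part of a sequence of such points
      tending to \<open>x\<close>.\<close>
    define G where "G = inf ?F (principal {z. cmod (nev_kernel f z z) < B})"
    have G: "G \<noteq> bot"
      using \<open>\<not> eventually _ ?F\<close> unfolding G_def trivial_limit_def eventually_inf_principal
      by (simp add: not_less)
    have GF: "G \<le> nontangential x"
      unfolding le_filter_def eventually_nontangential G_def eventually_inf_principal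
      using \<open>M > 0\<close> by (auto elim: eventually_mono)
    have evG: "eventually (\<lambda>z. cmod (nev_kernel f z z) < B) G"
      unfolding G_def eventually_inf_principal by simp
    \<comment> \<open>Julia's inequality, valid at every \<open>z\<close> of the half plane: let
      \<zeta> tend to \<open>x\<close> along \<open>G\<close> in the two-point inequality, using
      \<open>Im (f \<zeta>) \<le> B * Im \<zeta>\<close>, and cancel one factor
      \<open>cmod (f z - \<eta>)\<close>.\<close>
    have key: "cmod (f z - of_real \<eta>) \<le> B * ((cmod (z - of_real x))\<^sup>2 / Im z)" if z: "0 < Im z" for z
    proof -
      have "(cmod (f z - cnj (of_real \<eta>)))\<^sup>2 * Im z \<le> (cmod (z - cnj (of_real x)))\<^sup>2 * (Im (f z) * B)"
      proof (rule tendsto_le[OF G])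
        have 1: "((\<lambda>z. z) \<longlongrightarrow> of_real x) G" "(f \<longlongrightarrow> of_real \<eta>) G"
          using tendsto_mono[OF GF] nontangential_tendsto \<eta> by auto
        show "((\<lambda>\<zeta>. (cmod (f z - cnj (f \<zeta>)))\<^sup>2 * Im z) \<longlongrightarrow> (cmod (f z - cnj (of_real \<eta>)))\<^sup>2 * Im z) G"
          by (intro tendsto_intros 1)
        show "((\<lambda>\<zeta>. (cmod (z - cnj \<zeta>))\<^sup>2 * (Im (f z) * B)) \<longlongrightarrow> (cmod (z - cnj (of_real x)))\<^sup>2 * (Im (f z) * B)) G"
          by (intro tendsto_intros 1)
        have "eventually (\<lambda>z. 0 < Im z) G"
          by (rule filter_leD[OF GF eventually_nontangential_Im_pos])
        then show "eventually (\<lambda>\<zeta>. (cmod (f z - cnj (f \<zeta>)))\<^sup>2 * Im z \<le> (cmod (z - cnj \<zeta>))\<^sup>2 * (Im (f z) * B)) G"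
          using evG
        proof eventually_elim
          case (elim \<zeta>)
          have "0 \<le> Im (f \<zeta>)" "0 \<le> Im (f z)"
            using psd_kernel_Im_nonneg[OF f'] elim z by auto
          then have "Im (f \<zeta>) \<le> B * Im \<zeta>"
            using elim by (simp add: nev_kernel_diag divide_less_eq norm_divide)
          then have "(cmod (z - cnj \<zeta>))\<^sup>2 * (Im (f z) * Im (f \<zeta>)) \<le> (cmod (z - cnj \<zeta>))\<^sup>2 * (Im (f z) * (B * Im \<zeta>))"
            using \<open>0 \<le> Im (f z)\<close> by (intro mult_left_mono) auto
          moreover have "(cmod (f z - cnj (f \<zeta>)))\<^sup>2 * (Im z * Im \<zeta>) \<le> (cmod (z - cnj \<zeta>))\<^sup>2 * (Im (f z) * Im (f \<zeta>))"
            by (rule psd_kernel_two_point[OF f']) (use z elim in auto)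
          ultimately have "((cmod (f z - cnj (f \<zeta>)))\<^sup>2 * Im z) * Im \<zeta> \<le> ((cmod (z - cnj \<zeta>))\<^sup>2 * (Im (f z) * B)) * Im \<zeta>"
            unfolding mult.assoc by (rule order_trans[rotated])
          then show ?case using elim by (simp only: mult_le_cancel_right_pos)
        qed
      qed
      then have a: "(cmod (f z - of_real \<eta>))\<^sup>2 * Im z \<le> (cmod (z - of_real x))\<^sup>2 * (Im (f z) * B)"
        by simp
      have "Im (f z) \<le> cmod (f z - of_real \<eta>)"
        using abs_Im_le_cmod[of "f z - of_real \<eta>"] by simp
      then have "(cmod (z - of_real x))\<^sup>2 * (Im (f z) * B) \<le> (cmod (z - of_real x))\<^sup>2 * (cmod (f z - of_real \<eta>) * B)"
        using \<open>B > 0\<close> by (intro mult_left_mono mult_right_mono) auto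
      with a have "cmod (f z - of_real \<eta>) * (cmod (f z - of_real \<eta>) * Im z) \<le>
          cmod (f z - of_real \<eta>) * ((cmod (z - of_real x))\<^sup>2 * B)"
        by (simp add: power2_eq_square mult_ac)
      then have "cmod (f z - of_real \<eta>) * Im z \<le> (cmod (z - of_real x))\<^sup>2 * B"
        using ne[OF z] by simp
      then show ?thesis using z by (simp add: field_simps)
    qed
    \<comment> \<open>Chosen so that Julia's inequality and the assumption \<open>inf\<close>
      collide in \<open>cmod (z - x) < cmod (z - x)\<close> on the cone of aperture
      \<open>M\<close>.\<close>
    define c where "c = 1 / (B * (M + 1))"
    have "c > 0" using \<open>B > 0\<close> \<open>M > 0\<close> by (simp add: c_def)
    have "eventually (\<lambda>z. dist ((z - of_real x) / (f z - of_real \<eta>)) 0 < c) (nontangential x)"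
      by (rule tendstoD[OF inf \<open>c > 0\<close>])
    then have "eventually (\<lambda>z. dist ((z - of_real x) / (f z - of_real \<eta>)) 0 < c) ?F"
      unfolding eventually_nontangential using \<open>M > 0\<close> by auto
    moreover have "eventually (\<lambda>z. z \<in> cone M x) ?F"
      by (auto simp: eventually_at_filter)
    ultimately have "eventually (\<lambda>_. False) ?F"
    proof eventually_elim
      case (elim z)
      have z: "0 < Im z" using elim by (simp add: cone_def)
      have zx: "cmod (z - of_real x) > 0" using z by auto
      have fz: "cmod (f z - of_real \<eta>) > 0" using ne[OF z] by simp
      have "cmod (z - of_real x) < c * cmod (f z - of_real \<eta>)"
        using elim(1) fz by (simp add: norm_divide divide_less_eq)
      also have "\<dots> \<le> c * (B * ((cmod (z - of_real x))\<^sup>2 / Im z))"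
        using key[OF z] \<open>c > 0\<close> by (intro mult_left_mono) auto
      also have "\<dots> = cmod (z - of_real x) * (cmod (z - of_real x) / ((M + 1) * Im z))"
        using \<open>B > 0\<close> by (simp add: c_def power2_eq_square)
      also have "\<dots> \<le> cmod (z - of_real x) * 1"
        using cone_norm_le[OF elim(2)] z \<open>M > 0\<close> by (intro mult_left_mono) (auto simp: divide_le_eq)
      finally show False by simp
    qed
    then show False using at_within_cone_nontriv[OF \<open>M > 0\<close>, of x] by (simp add: eventually_False)
  qed
qed


section \<open>Pick data and the kernel identity\<close>

lemma sum_unit:
  fixes f :: "nat \<Rightarrow> 'a :: semiring_1"
  assumes "k < n"
  shows "(\<Sum>l<n. (if k = l then 1 else 0) * f l) = f k" "(\<Sum>l<n. f l * (if l = k then 1 else 0)) = f k"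
proof -
  have "(\<Sum>l<n. (if k = l then 1 else 0) * f l) = (\<Sum>l<n. if k = l then f l else 0)"
    by (rule sum.cong) auto
  also have "\<dots> = f k" using assms by simp
  finally show "(\<Sum>l<n. (if k = l then 1 else 0) * f l) = f k" .
  have "(\<Sum>l<n. f l * (if l = k then 1 else 0)) = (\<Sum>l<n. if l = k then f l else 0)"
    by (rule sum.cong) auto
  also have "\<dots> = f k" using assms by simp
  finally show "(\<Sum>l<n. f l * (if l = k then 1 else 0)) = f k" .
qed

text \<open>Clearing denominators yields a polynomial that vanishes on the infinite set
  \<open>S\<close>, hence identically; at \<open>z i\<close> only the term with \<open>d i\<close>
  remains.\<close>

lemma cauchy_fractions_independent:
  fixes z d :: "nat \<Rightarrow> complex"
  assumes inj: "inj_on z {..<m}" and "infinite S"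
    and S: "\<And>s i. s \<in> S \<Longrightarrow> i < m \<Longrightarrow> s \<noteq> z i"
    and zero: "\<And>s. s \<in> S \<Longrightarrow> (\<Sum>i<m. d i / (z i - s)) = 0"
    and i: "i < m"
  shows "d i = 0"
proof -
  define p where "p = (\<Sum>i<m. Polynomial.smult (d i) (\<Prod>j\<in>{..<m} - {i}. [:z j, - 1:]))"
  have p: "poly p s = (\<Sum>i<m. d i * (\<Prod>j\<in>{..<m} - {i}. (z j - s)))" for s
    unfolding p_def poly_sum by (simp add: poly_prod)
  have "poly p s = 0" if s: "s \<in> S" for s
  proof -
    have "poly p s = (\<Sum>i<m. (\<Prod>j<m. (z j - s)) * (d i / (z i - s)))"
      unfolding p using S[OF s]
      by (intro sum.cong refl) (auto simp: prod.remove[of "{..<m}"])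
    also have "\<dots> = (\<Prod>j<m. (z j - s)) * (\<Sum>i<m. d i / (z i - s))"
      by (rule sum_distrib_left[symmetric])
    finally show ?thesis by (simp only: zero[OF s] mult_zero_right)
  qed
  then have "S \<subseteq> {s. poly p s = 0}" by auto
  then have "p = 0"
    using \<open>infinite S\<close> poly_roots_finite finite_subset by blast
  have "(\<Sum>k<m. d k * (\<Prod>j\<in>{..<m} - {k}. (z j - z i))) = d i * (\<Prod>j\<in>{..<m} - {i}. (z j - z i))"
    using i by (subst sum.remove[of _ i]) (auto intro!: sum.neutral)
  then have "d i * (\<Prod>j\<in>{..<m} - {i}. (z j - z i)) = 0"
    using p[of "z i"] \<open>p = 0\<close> by simp
  moreover have "(\<Prod>j\<in>{..<m} - {i}. (z j - z i)) \<noteq> 0"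
    using inj i by (auto simp: inj_on_def)
  ultimately show ?thesis by simp
qed

text \<open>The algebra starts from these identities only, so regular and singular nodes are treated
  alike. The type of node \<open>j\<close> enters later, through \<open>(C j, E j)\<close> being
  \<open>(w\<^sub>j, 1)\<close> or \<open>(\<xi>\<^sub>j, 0)\<close>.\<close>

locale pick_data =
  fixes n :: nat and x :: "nat \<Rightarrow> real" and p q :: "nat \<Rightarrow> nat \<Rightarrow> real"
    and C E c e :: "nat \<Rightarrow> real"
  assumes inj: "inj_on x {..<n}"
    and p_sym: "\<And>i j. i < n \<Longrightarrow> j < n \<Longrightarrow> p i j = p j i"
    and p_displacement: "\<And>i j. i < n \<Longrightarrow> j < n \<Longrightarrow> p i j * (x j - x i) = E i * C j - C i * E j"
    and pq: "\<And>i j. i < n \<Longrightarrow> j < n \<Longrightarrow> (\<Sum>k<n. p i k * q k j) = (if i = j then 1 else 0)"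
    and qp: "\<And>i j. i < n \<Longrightarrow> j < n \<Longrightarrow> (\<Sum>k<n. q i k * p k j) = (if i = j then 1 else 0)"
    and c_eq: "\<And>i. i < n \<Longrightarrow> c i = (\<Sum>k<n. C k * q k i)"
    and e_eq: "\<And>i. i < n \<Longrightarrow> e i = (\<Sum>k<n. E k * q k i)"
begin

lemma q_sym:
  assumes i: "i < n" and j: "j < n"
  shows "q i j = q j i"
proof -
  have "q i j = (\<Sum>l<n. (if i = l then 1 else 0) * q l j)"
    by (rule sum_unit(1)[OF i, symmetric])
  also have "\<dots> = (\<Sum>l<n. (\<Sum>k<n. p l k * q k i) * q l j)"
    using i by (intro sum.cong refl) (auto simp: pq)
  also have "\<dots> = (\<Sum>k<n. q k i * (\<Sum>l<n. p k l * q l j))"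
    unfolding sum_distrib_left sum_distrib_right
    by (subst sum.swap) (intro sum.cong refl, simp add: p_sym mult_ac)
  also have "\<dots> = (\<Sum>k<n. q k i * (if k = j then 1 else 0))"
    using j by (intro sum.cong refl) (simp add: pq)
  also have "\<dots> = q j i" by (rule sum_unit(2)[OF j])
  finally show ?thesis .
qed

text \<open>The displacement equation of \<open>p\<close>, multiplied by \<open>q\<close> from both
  sides.\<close>

lemma q_displacement:
  assumes j: "j < n" and k: "k < n"
  shows "q j k * (x j - x k) = e j * c k - c j * e k"
proof -
  have "(\<Sum>i<n. \<Sum>l<n. q j i * (p i l * (x l - x i)) * q l k) =
      (\<Sum>i<n. \<Sum>l<n. (q j i * p i l) * (x l * q l k)) - (\<Sum>i<n. \<Sum>l<n. (q j i * x i) * (p i l * q l k))"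
    unfolding sum_subtractf[symmetric] by (intro sum.cong refl) (simp add: algebra_simps)
  also have "(\<Sum>i<n. \<Sum>l<n. (q j i * p i l) * (x l * q l k)) = (\<Sum>l<n. (\<Sum>i<n. q j i * p i l) * (x l * q l k))"
    unfolding sum_distrib_right by (rule sum.swap)
  also have "\<dots> = (\<Sum>l<n. (if j = l then 1 else 0) * (x l * q l k))"
    using j by (intro sum.cong refl) (simp add: qp)
  also have "\<dots> = x j * q j k" by (rule sum_unit(1)[OF j])
  also have "(\<Sum>i<n. \<Sum>l<n. (q j i * x i) * (p i l * q l k)) = (\<Sum>i<n. (q j i * x i) * (if i = k then 1 else 0))"
    using k by (simp only: sum_distrib_left[symmetric]) (intro sum.cong refl, simp add: pq)
  also have "\<dots> = q j k * x k" by (rule sum_unit(2)[OF k])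
  finally have "q j k * (x j - x k) = (\<Sum>i<n. \<Sum>l<n. q j i * (p i l * (x l - x i)) * q l k)"
    by (simp add: algebra_simps)
  also have "\<dots> = (\<Sum>i<n. \<Sum>l<n. (E i * q i j) * (C l * q l k)) - (\<Sum>i<n. \<Sum>l<n. (C i * q i j) * (E l * q l k))"
    unfolding sum_subtractf[symmetric] using j
    by (intro sum.cong refl, subst p_displacement) (auto simp: q_sym[of j] algebra_simps)
  also have "\<dots> = e j * c k - c j * e k"
    unfolding sum_product[symmetric] using j k by (simp add: c_eq e_eq)
  finally show ?thesis .
qed

lemma p_row_sums:
  assumes k: "k < n"
  shows "(\<Sum>j<n. p k j * e j) = E k" "(\<Sum>j<n. p k j * c j) = C k"
proof -
  have "(\<Sum>j<n. p k j * (\<Sum>i<n. G i * q i j)) = G k" for G :: "nat \<Rightarrow> real"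
  proof -
    have "(\<Sum>j<n. p k j * (\<Sum>i<n. G i * q i j)) = (\<Sum>i<n. G i * (\<Sum>j<n. q i j * p j k))"
      unfolding sum_distrib_left using k
      by (subst sum.swap) (intro sum.cong refl, simp add: p_sym[of k] mult_ac)
    also have "\<dots> = (\<Sum>i<n. G i * (if i = k then 1 else 0))"
      using k by (intro sum.cong refl) (simp add: qp)
    also have "\<dots> = G k" by (rule sum_unit(2)[OF k])
    finally show ?thesis .
  qed
  then show "(\<Sum>j<n. p k j * e j) = E k" "(\<Sum>j<n. p k j * c j) = C k"
    by (simp_all add: e_eq c_eq)
qed

end

text \<open>
  The parameter enters through homogeneous coordinates \<open>(a, b)\<close>: \<open>(\<phi>, 1)\<close> for a function \<open>\<phi>\<close> and
  \<open>(1, 0)\<close> for the parameter \<open>\<infinity>\<close>. Then \<open>Num\<close> and \<open>Den\<close> are the coordinates of \<open>\<Theta> (a, b)\<close>.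
\<close>

locale pick_param = pick_data +
  fixes a b :: "complex \<Rightarrow> complex"
begin

text \<open>Vanishes exactly when \<open>(a z, b z)\<close> is proportional to
  \<open>(c j, e j)\<close>, that is, when the parameter takes the critical value of node
  \<open>j\<close>: \<open>c j / e j\<close>, or infinity if \<open>e j = 0\<close>.\<close>

definition lin :: "nat \<Rightarrow> complex \<Rightarrow> complex" where
  "lin j z = of_real (e j) * a z - of_real (c j) * b z"

definition Y :: "nat \<Rightarrow> complex \<Rightarrow> complex" where
  "Y j z = lin j z / (z - of_real (x j))"

definition Num :: "complex \<Rightarrow> complex" where
  "Num z = a z + (\<Sum>j<n. of_real (C j) * Y j z)"

definition Den :: "complex \<Rightarrow> complex" where
  "Den z = b z + (\<Sum>j<n. of_real (E j) * Y j z)"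

definition PY :: "nat \<Rightarrow> complex \<Rightarrow> complex" where
  "PY k z = (\<Sum>j<n. of_real (p k j) * Y j z)"

text \<open>For \<open>(\<phi>, 1)\<close> this is \<open>nev_kernel \<phi>\<close>; for
  \<open>(1, 0)\<close> it is zero.\<close>

definition H :: "complex \<Rightarrow> complex \<Rightarrow> complex" where
  "H z s = (a z * cnj (b s) - b z * cnj (a s)) / (z - cnj s)"

lemma ne_node: "0 < Im z \<Longrightarrow> z - of_real (x j) \<noteq> 0"
  by auto

lemma p_lin:
  assumes k: "k < n"
  shows "(\<Sum>j<n. of_real (p k j) * lin j z) = of_real (E k) * a z - of_real (C k) * b z"
proof -
  have "(\<Sum>j<n. of_real (p k j) * lin j z) =
      of_real (\<Sum>j<n. p k j * e j) * a z - of_real (\<Sum>j<n. p k j * c j) * b z"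
    unfolding lin_def of_real_sum of_real_mult sum_distrib_right sum_subtractf[symmetric]
    by (intro sum.cong refl) (simp add: algebra_simps)
  then show ?thesis by (simp add: p_row_sums k)
qed

lemma PY_eq:
  assumes k: "k < n" and z: "0 < Im z"
  shows "(z - of_real (x k)) * PY k z = of_real (E k) * Num z - of_real (C k) * Den z"
proof -
  have "(z - of_real (x k)) * PY k z =
      (\<Sum>j<n. of_real (p k j) * lin j z) + (\<Sum>j<n. of_real (p k j * (x j - x k)) * Y j z)"
    unfolding PY_def sum_distrib_left sum.distrib[symmetric]
  proof (intro sum.cong refl)
    fix j
    have lin: "lin j z = (z - of_real (x j)) * Y j z"
      unfolding Y_def using ne_node[OF z] by simp
    show "(z - of_real (x k)) * (of_real (p k j) * Y j z) =
        of_real (p k j) * lin j z + of_real (p k j * (x j - x k)) * Y j z"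
      unfolding lin by (simp add: algebra_simps)
  qed
  also have "(\<Sum>j<n. of_real (p k j * (x j - x k)) * Y j z) =
      of_real (E k) * (\<Sum>j<n. of_real (C j) * Y j z) - of_real (C k) * (\<Sum>j<n. of_real (E j) * Y j z)"
    unfolding sum_distrib_left sum_subtractf[symmetric] using k
    by (intro sum.cong refl, subst p_displacement) (auto simp: algebra_simps)
  finally show ?thesis
    unfolding p_lin[OF k] Num_def Den_def by (simp add: algebra_simps)
qed

text \<open>Split \<open>z - cnj s\<close> as \<open>(z - x\<^sub>k) - (cnj s - x\<^sub>k)\<close>.
  The first part is handled by \<open>PY_eq\<close>; the second cancels the denominator of
  \<open>Y k s\<close>, after which symmetry of \<open>p\<close> lets \<open>p_lin\<close>
  act.\<close>

lemma kernel_identity: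
  assumes z: "0 < Im z" and s: "0 < Im s"
  shows "(Num z * cnj (Den s) - Den z * cnj (Num s)) / (z - cnj s) =
    (\<Sum>k<n. cnj (Y k s) * PY k z) + H z s"
proof -
  have "(\<Sum>k<n. cnj (Y k s) * PY k z) * (z - cnj s) =
      (\<Sum>k<n. cnj (Y k s) * ((z - of_real (x k)) * PY k z)) - (\<Sum>k<n. cnj (lin k s) * PY k z)"
    unfolding sum_distrib_right sum_subtractf[symmetric]
  proof (intro sum.cong refl)
    fix k
    have lin: "cnj (lin k s) = cnj ((s - of_real (x k)) * Y k s)"
      unfolding Y_def using ne_node[OF s] by simp
    show "cnj (Y k s) * PY k z * (z - cnj s) =
        cnj (Y k s) * ((z - of_real (x k)) * PY k z) - cnj (lin k s) * PY k z"
      unfolding lin by (simp add: algebra_simps)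
  qed
  also have "(\<Sum>k<n. cnj (Y k s) * ((z - of_real (x k)) * PY k z)) =
      (\<Sum>k<n. cnj (of_real (E k) * Y k s) * Num z) - (\<Sum>k<n. cnj (of_real (C k) * Y k s) * Den z)"
    unfolding sum_subtractf[symmetric]
    by (intro sum.cong refl, subst PY_eq[OF _ z]) (auto simp: algebra_simps)
  also have "(\<Sum>k<n. cnj (of_real (E k) * Y k s) * Num z) = (cnj (Den s) - cnj (b s)) * Num z"
    unfolding Den_def by (simp add: sum_distrib_right)
  also have "(\<Sum>k<n. cnj (of_real (C k) * Y k s) * Den z) = (cnj (Num s) - cnj (a s)) * Den z"
    unfolding Num_def by (simp add: sum_distrib_right)
  also have "(\<Sum>k<n. cnj (lin k s) * PY k z) = (\<Sum>j<n. cnj (\<Sum>k<n. of_real (p j k) * lin k s) * Y j z)"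
    unfolding PY_def sum_distrib_left sum_distrib_right cnj_sum
    by (subst sum.swap) (intro sum.cong refl, simp add: p_sym mult_ac)
  also have "\<dots> = (\<Sum>j<n. cnj (a s) * (of_real (E j) * Y j z)) - (\<Sum>j<n. cnj (b s) * (of_real (C j) * Y j z))"
    unfolding sum_subtractf[symmetric]
    by (intro sum.cong refl) (simp add: p_lin algebra_simps)
  also have "\<dots> = cnj (a s) * (Den z - b z) - cnj (b s) * (Num z - a z)"
    unfolding Den_def Num_def by (simp add: sum_distrib_left)
  finally have "(\<Sum>k<n. cnj (Y k s) * PY k z) * (z - cnj s) + (a z * cnj (b s) - b z * cnj (a s)) =
      Num z * cnj (Den s) - Den z * cnj (Num s)"
    by (simp add: algebra_simps)
  then show ?thesis
    unfolding H_def using diff_cnj_nonzero[OF z s] by (simp add: field_simps)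
qed

text \<open>The parameter is resolved along the critical direction \<open>(c k, e k)\<close>, with
  coefficient \<open>M\<close>, and a defect \<open>lin k\<close>. Only \<open>Y k\<close> can be
  singular: by \<open>q_displacement\<close> every other \<open>Y j / \<psi>\<close> tends to
  \<open>- q j k * D2\<close>. Writing the limit of \<open>Y k / \<psi>\<close> as
  \<open>S - q k k * D2\<close> completes the column sums of \<open>q\<close>; these cancel the
  limits \<open>c k * D2\<close> and \<open>e k * D2\<close> of \<open>a / \<psi>\<close> and
  \<open>b / \<psi>\<close>, so only \<open>S\<close> is left in \<open>Num\<close> and
  \<open>Den\<close>.\<close>

lemma boundary_limits:
  assumes k: "k < n"
    and a: "\<And>z. 0 < Im z \<Longrightarrow> a z = of_real aL * lin k z + of_real (c k) * M z"
    and b: "\<And>z. 0 < Im z \<Longrightarrow> b z = of_real bL * lin k z + of_real (e k) * M z"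
    and D1: "((\<lambda>z. lin k z / ((z - of_real (x k)) * \<psi> z)) \<longlongrightarrow> of_real D1) (nontangential (x k))"
    and D2: "((\<lambda>z. M z / \<psi> z) \<longlongrightarrow> of_real D2) (nontangential (x k))"
  defines "S \<equiv> D1 + q k k * D2"
  shows "((\<lambda>z. Num z / \<psi> z) \<longlongrightarrow> of_real (C k * S)) (nontangential (x k))"
    and "((\<lambda>z. Den z / \<psi> z) \<longlongrightarrow> of_real (E k * S)) (nontangential (x k))"
    and "((\<lambda>z. PY k z / \<psi> z) \<longlongrightarrow> of_real (p k k * S - D2)) (nontangential (x k))"
proof -
  let ?F = "nontangential (x k)"
  have ident: "((\<lambda>z. z - of_real (x k)) \<longlongrightarrow> 0) ?F"
    using tendsto_diff[OF nontangential_tendsto[of "x k"] tendsto_const, of "of_real (x k)"] by simp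
  have "((\<lambda>z. (z - of_real (x k)) * (lin k z / ((z - of_real (x k)) * \<psi> z))) \<longlongrightarrow> 0 * of_real D1) ?F"
    by (intro tendsto_mult ident D1)
  moreover have "eventually (\<lambda>z. (z - of_real (x k)) * (lin k z / ((z - of_real (x k)) * \<psi> z)) = lin k z / \<psi> z) ?F"
    using eventually_nontangential_ne by eventually_elim simp
  ultimately have L0: "((\<lambda>z. lin k z / \<psi> z) \<longlongrightarrow> 0) ?F"
    by (simp add: tendsto_cong)
  have "((\<lambda>z. of_real aL * (lin k z / \<psi> z) + of_real (c k) * (M z / \<psi> z)) \<longlongrightarrow>
      of_real aL * 0 + of_real (c k) * of_real D2) ?F"
    by (intro tendsto_intros L0 D2)
  moreover have "eventually (\<lambda>z. of_real aL * (lin k z / \<psi> z) + of_real (c k) * (M z / \<psi> z) = a z / \<psi> z) ?F"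
    using eventually_nontangential_Im_pos by eventually_elim (simp add: a add_divide_distrib)
  ultimately have a_lim: "((\<lambda>z. a z / \<psi> z) \<longlongrightarrow> of_real (c k * D2)) ?F"
    by (simp add: tendsto_cong)
  have "((\<lambda>z. of_real bL * (lin k z / \<psi> z) + of_real (e k) * (M z / \<psi> z)) \<longlongrightarrow>
      of_real bL * 0 + of_real (e k) * of_real D2) ?F"
    by (intro tendsto_intros L0 D2)
  moreover have "eventually (\<lambda>z. of_real bL * (lin k z / \<psi> z) + of_real (e k) * (M z / \<psi> z) = b z / \<psi> z) ?F"
    using eventually_nontangential_Im_pos by eventually_elim (simp add: b add_divide_distrib)
  ultimately have b_lim: "((\<lambda>z. b z / \<psi> z) \<longlongrightarrow> of_real (e k * D2)) ?F"
    by (simp add: tendsto_cong)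
  have Y_lim: "((\<lambda>z. Y j z / \<psi> z) \<longlongrightarrow> of_real ((if j = k then S else 0) - q j k * D2)) ?F" if j: "j < n" for j
  proof (cases "j = k")
    case True
    then show ?thesis using D1 by (simp add: Y_def S_def)
  next
    case False
    then have ne: "x k - x j \<noteq> 0" using inj j k by (auto simp: inj_on_def)
    then have ne': "complex_of_real (x k) - of_real (x j) \<noteq> 0"
      by (metis of_real_diff of_real_eq_0_iff)
    have "((\<lambda>z. (of_real (e j) * (a z / \<psi> z) - of_real (c j) * (b z / \<psi> z)) / (z - of_real (x j))) \<longlongrightarrow>
        (of_real (e j) * of_real (c k * D2) - of_real (c j) * of_real (e k * D2)) / (of_real (x k) - of_real (x j))) ?F"
      by (intro tendsto_intros a_lim b_lim nontangential_tendsto ne')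
    also have "(of_real (e j) * of_real (c k * D2) - of_real (c j) * of_real (e k * D2)) / (of_real (x k) - of_real (x j)) =
        complex_of_real ((e j * c k - c j * e k) * D2 / (x k - x j))"
      by (simp add: algebra_simps)
    also have "(e j * c k - c j * e k) * D2 / (x k - x j) = - q j k * D2"
      unfolding q_displacement[OF j k, symmetric] using ne by (simp add: field_simps)
    also have "(\<lambda>z. (of_real (e j) * (a z / \<psi> z) - of_real (c j) * (b z / \<psi> z)) / (z - of_real (x j))) = (\<lambda>z. Y j z / \<psi> z)"
      by (simp add: Y_def lin_def diff_divide_distrib mult_ac)
    finally show ?thesis using False by simp
  qed
  have sum_lim: "((\<lambda>z. (\<Sum>j<n. of_real (G j) * Y j z) / \<psi> z) \<longlongrightarrow>
      of_real (G k * S - (\<Sum>j<n. G j * q j k) * D2)) ?F" for G :: "nat \<Rightarrow> real"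
  proof -
    have "((\<lambda>z. \<Sum>j<n. of_real (G j) * (Y j z / \<psi> z)) \<longlongrightarrow>
        (\<Sum>j<n. of_real (G j) * of_real ((if j = k then S else 0) - q j k * D2))) ?F"
      by (intro tendsto_sum tendsto_intros Y_lim) auto
    also have "(\<Sum>j<n. of_real (G j) * of_real ((if j = k then S else 0) - q j k * D2)) =
        complex_of_real (\<Sum>j<n. (if j = k then G j * S else 0) - G j * q j k * D2)"
      unfolding of_real_sum by (intro sum.cong refl) (simp add: algebra_simps)
    also have "(\<Sum>j<n. (if j = k then G j * S else 0) - G j * q j k * D2) = G k * S - (\<Sum>j<n. G j * q j k) * D2"
      using k by (simp add: sum_subtractf sum_distrib_right)
    also have "(\<lambda>z. \<Sum>j<n. of_real (G j) * (Y j z / \<psi> z)) = (\<lambda>z. (\<Sum>j<n. of_real (G j) * Y j z) / \<psi> z)"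
      by (simp add: sum_divide_distrib)
    finally show ?thesis .
  qed
  show "((\<lambda>z. Num z / \<psi> z) \<longlongrightarrow> of_real (C k * S)) ?F"
    using tendsto_add[OF a_lim sum_lim[of C]] k
    by (simp add: Num_def add_divide_distrib c_eq)
  show "((\<lambda>z. Den z / \<psi> z) \<longlongrightarrow> of_real (E k * S)) ?F"
    using tendsto_add[OF b_lim sum_lim[of E]] k
    by (simp add: Den_def add_divide_distrib e_eq)
  show "((\<lambda>z. PY k z / \<psi> z) \<longlongrightarrow> of_real (p k k * S - D2)) ?F"
    using sum_lim[of "p k"] k by (simp add: PY_def pq)
qed

end

section \<open>Zeros of the denominator\<close>

locale nev_param = pick_param +
  assumes holo: "a holomorphic_on {z. 0 < Im z}" "b holomorphic_on {z. 0 < Im z}"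
    and nonzero: "\<And>z. 0 < Im z \<Longrightarrow> a z \<noteq> 0 \<or> b z \<noteq> 0"
    and psd: "psd_on {z. 0 < Im z} H"
    and Den_nonzero: "\<exists>z. 0 < Im z \<and> Den z \<noteq> 0"
begin

lemma holomorphic_Num_Den:
  "Num holomorphic_on {z. 0 < Im z}" "Den holomorphic_on {z. 0 < Im z}"
  unfolding Num_def Den_def Y_def lin_def
  by (intro holomorphic_intros holo; force)+

text \<open>Injectivity of \<open>\<Theta> (z)\<close>: if both coordinates vanish, so does
  \<open>PY\<close>, hence \<open>Y\<close> because \<open>p\<close> is invertible, and then
  \<open>a z = b z = 0\<close>.\<close>

lemma Num_or_Den_nonzero:
  assumes z: "0 < Im z"
  shows "Num z \<noteq> 0 \<or> Den z \<noteq> 0"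
proof (rule ccontr)
  assume "\<not> (Num z \<noteq> 0 \<or> Den z \<noteq> 0)"
  then have 0: "Num z = 0" "Den z = 0" by auto
  have PY0: "PY k z = 0" if "k < n" for k
    using PY_eq[OF that z] ne_node[OF z] 0 by simp
  have Y0: "Y i z = 0" if i: "i < n" for i
  proof -
    have "(\<Sum>k<n. of_real (q i k) * PY k z) = (\<Sum>j<n. of_real (\<Sum>k<n. q i k * p k j) * Y j z)"
      unfolding PY_def sum_distrib_left of_real_sum sum_distrib_right
      by (subst sum.swap) (simp add: mult_ac)
    also have "\<dots> = (\<Sum>j<n. (if i = j then 1 else 0) * Y j z)"
      using i by (intro sum.cong refl) (simp add: qp)
    also have "\<dots> = Y i z" by (rule sum_unit(1)[OF i])
    finally show ?thesis using PY0 by simp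
  qed
  then have "a z = 0" "b z = 0" using 0 by (auto simp: Num_def Den_def)
  with nonzero[OF z] show False by simp
qed

lemma H_hermitian: "H z s = cnj (H s z)"
proof -
  have "cnj (H s z) = - (a z * cnj (b s) - b z * cnj (a s)) / - (z - cnj s)"
    unfolding H_def by (simp add: mult.commute)
  then show ?thesis unfolding H_def by (simp only: minus_divide_divide)
qed

text \<open>
  Among more than \<open>n\<close> zeros of \<open>Den\<close> some combination of the vectors \<open>Y\<close> vanishes. By the kernel
  identity it is a null vector of \<open>H\<close>, and pairing it with all other points produces a
  vanishing combination of Cauchy fractions.
\<close>

lemma finite_Den_zeros: "finite {z. 0 < Im z \<and> Den z = 0}"
proof (rule ccontr)
  assume inf: "infinite {z. 0 < Im z \<and> Den z = 0}"
  define m where "m = Suc n"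
  obtain T where T: "T \<subseteq> {z. 0 < Im z \<and> Den z = 0}" "card T = m" "finite T"
    using infinite_arbitrarily_large[OF inf, of m] by blast
  obtain z where z: "bij_betw z {..<m} T"
    using ex_bij_betw_nat_finite[OF T(3)] T(2) by (auto simp: atLeast0LessThan)
  have zT: "0 < Im (z i)" "Den (z i) = 0" if "i < m" for i
    using z T(1) that by (auto simp: bij_betw_def)
  obtain c0 where c0: "\<exists>s<m. c0 s \<noteq> 0" and Y0: "\<And>j. j < n \<Longrightarrow> (\<Sum>s<m. Y j (z s) * c0 s) = 0"
    using exists_annihilated_combination[of n m "\<lambda>j s. Y j (z s)"] unfolding m_def by auto
  have V0: "(\<Sum>s<m. PY k (z s) * c0 s) = 0" for k
  proof -
    have "(\<Sum>s<m. PY k (z s) * c0 s) = (\<Sum>j<n. of_real (p k j) * (\<Sum>s<m. Y j (z s) * c0 s))"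
      unfolding PY_def sum_distrib_left sum_distrib_right by (subst sum.swap) (simp add: mult_ac)
    then show ?thesis using Y0 by simp
  qed
  have pair: "(\<Sum>s<m. H (z s) t * c0 s) = cnj (Den t) * (\<Sum>s<m. c0 s * Num (z s) / (z s - cnj t))"
    if t: "0 < Im t" for t
  proof -
    have "(\<Sum>s<m. cnj (Den t) * (c0 s * Num (z s) / (z s - cnj t))) =
        (\<Sum>s<m. (\<Sum>k<n. cnj (Y k t) * PY k (z s)) * c0 s + H (z s) t * c0 s)"
    proof (intro sum.cong refl)
      fix s assume "s \<in> {..<m}"
      then have "Num (z s) * cnj (Den t) / (z s - cnj t) = (\<Sum>k<n. cnj (Y k t) * PY k (z s)) + H (z s) t"
        using kernel_identity[of "z s" t] zT[of s] t by simp
      then have "Num (z s) * cnj (Den t) / (z s - cnj t) * c0 s =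
          (\<Sum>k<n. cnj (Y k t) * PY k (z s)) * c0 s + H (z s) t * c0 s"
        by (simp only: distrib_right)
      then show "cnj (Den t) * (c0 s * Num (z s) / (z s - cnj t)) =
          (\<Sum>k<n. cnj (Y k t) * PY k (z s)) * c0 s + H (z s) t * c0 s"
        by (simp add: mult_ac)
    qed
    also have "\<dots> = (\<Sum>k<n. cnj (Y k t) * (\<Sum>s<m. PY k (z s) * c0 s)) + (\<Sum>s<m. H (z s) t * c0 s)"
      unfolding sum.distrib sum_distrib_left sum_distrib_right
      by (subst sum.swap) (simp add: mult_ac)
    finally show ?thesis by (simp add: V0 sum_distrib_left)
  qed
  have "kform H m z c0 = (\<Sum>i<m. cnj (c0 i) * (\<Sum>j<m. H (z j) (z i) * c0 j))"
    by (simp add: sum_distrib_left mult_ac)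
  \<comment> \<open>At \<open>t = z i\<close> the right side of \<open>pair\<close> carries the
    factor \<open>cnj (Den (z i)) = 0\<close>.\<close>
  also have "\<dots> = 0"
    using zT by (intro sum.neutral) (simp add: pair)
  finally have Q0: "kform H m z c0 = 0" .
  have null: "(\<Sum>s<m. H (z s) t * c0 s) = 0" if "0 < Im t" for t
    using psd_cauchy_schwarz[OF psd H_hermitian, of m z t c0] zT that Q0 by simp
  \<comment> \<open>For these \<open>t\<close> the factor \<open>cnj (Den t)\<close> in
    \<open>pair\<close> can be cancelled; the points \<open>cnj t\<close> lie in the lower half
    plane, away from the poles \<open>z i\<close> of the fractions.\<close>
  define S where "S = cnj ` {t. 0 < Im t \<and> Den t \<noteq> 0}"
  have "open ({t. 0 < Im t} \<inter> Den -` (- {0}))"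
    by (rule continuous_open_preimage)
      (auto intro!: holomorphic_on_imp_continuous_on holomorphic_Num_Den open_halfspace_Im_gt)
  also have "{t. 0 < Im t} \<inter> Den -` (- {0}) = {t. 0 < Im t \<and> Den t \<noteq> 0}" by auto
  finally have op: "open {t. 0 < Im t \<and> Den t \<noteq> 0}" .
  have "infinite {t. 0 < Im t \<and> Den t \<noteq> 0}"
  proof
    assume "finite {t. 0 < Im t \<and> Den t \<noteq> 0}"
    from finite_imp_not_open[OF this] op have "{t. 0 < Im t \<and> Den t \<noteq> 0} = {}" by blast
    with Den_nonzero show False by blast
  qed
  then have "infinite S"
    unfolding S_def by (subst finite_image_iff) (auto simp: inj_on_def)
  have "c0 s * Num (z s) = 0" if "s < m" for s
  proof (rule cauchy_fractions_independent[OF _ \<open>infinite S\<close> _ _ that, of z])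
    show "inj_on z {..<m}" using z by (simp add: bij_betw_def)
    show "u \<noteq> z i" if "u \<in> S" "i < m" for u i
      using that zT(1)[of i] by (auto simp: S_def complex_eq_iff)
    show "(\<Sum>i<m. c0 i * Num (z i) / (z i - u)) = 0" if "u \<in> S" for u
      using that null pair by (auto simp: S_def)
  qed
  then have "c0 s = 0" if "s < m" for s
    using Num_or_Den_nonzero[OF zT(1)] zT(2) that by fastforce
  with c0 show False by blast
qed

end


section \<open>The linear fractional transformation\<close>

lemma analyticity_domain_Im: "z \<in> analyticity_domain w \<Longrightarrow> 0 < Im z"
  by (simp add: analyticity_domain_def upper_half_plane_def)

lemma kernel_mat_carrier [simp]: "kernel_mat w m z \<in> carrier_mat m m"
  by (simp add: kernel_mat_def)

lemma kernel_mat_index: "i < m \<Longrightarrow> j < m \<Longrightarrow> kernel_mat w m z $$ (i, j) = nev_kernel w (z j) (z i)"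
  by (simp add: kernel_mat_def)

lemma kernel_mat_hermitian:
  "i < m \<Longrightarrow> j < m \<Longrightarrow> kernel_mat w m z $$ (i, j) = cnj (kernel_mat w m z $$ (j, i))"
  by (simp add: kernel_mat_index) (rule nev_kernel_hermitian)

text \<open>A negative value of the form spans a one-dimensional negative subspace of a kernel
  matrix, against \<open>sq_neg \<le> 0\<close>.\<close>

lemma nev_class_0_psd:
  assumes f: "f \<in> nev_class 0"
  shows "psd_on (analyticity_domain f) (nev_kernel f)"
  unfolding psd_on_def
proof (intro allI impI)
  fix m :: nat and z c :: "nat \<Rightarrow> complex"
  assume z: "\<forall>i<m. z i \<in> analyticity_domain f"
  show "0 \<le> Re (kform (nev_kernel f) m z c)"
  proof (rule ccontr)
    assume neg: "\<not> ?thesis"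
    then have "m \<ge> 1" by (cases m) auto
    have form: "hform (kernel_mat f m z) m (\<lambda>i. \<Sum>s<Suc 0. c i * d s) =
        of_real ((cmod (d 0))\<^sup>2) * (kform (nev_kernel f) m z c)" for d :: "nat \<Rightarrow> complex"
      unfolding hform_def sum_distrib_left complex_norm_square
      by (intro sum.cong refl) (simp add: kernel_mat_index mult_ac)
    have "Suc 0 \<le> sq_neg (kernel_mat f m z)"
    proof (rule sq_neg_ge[OF kernel_mat_carrier kernel_mat_hermitian])
      fix d :: "nat \<Rightarrow> complex" assume "\<exists>s<Suc 0. d s \<noteq> 0"
      then have "(cmod (d 0))\<^sup>2 > 0" by auto
      then show "Re (hform (kernel_mat f m z) m (\<lambda>i. \<Sum>s<Suc 0. c i * d s)) < 0"
        unfolding form using neg by (simp add: mult_less_0_iff del: of_real_power)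
    qed
    moreover have "sq_neg (kernel_mat f m z) \<le> 0"
      using f z \<open>m \<ge> 1\<close> unfolding nev_class_def by blast
    ultimately show False by simp
  qed
qed

text \<open>Near a supposed pole, \<open>psd_kernel_bound\<close> with a fixed regular point \<zeta>
  close by keeps \<open>f\<close> bounded.\<close>

lemma nev_class_0_analytic:
  assumes f: "f \<in> nev_class 0"
  shows "analyticity_domain f = {z. 0 < Im z}"
proof -
  have nm: "f nicely_meromorphic_on upper_half_plane"
    using f by (simp add: nev_class_def)
  note psd = nev_class_0_psd[OF f]
  have "z0 \<in> analyticity_domain f" if z0: "0 < Im z0" for z0
  proof (rule ccontr)
    have z0U: "z0 \<in> upper_half_plane" using z0 by (simp add: upper_half_plane_def)
    assume "z0 \<notin> analyticity_domain f"
    then have pole: "is_pole f z0"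
      using nicely_meromorphic_on_imp_analytic_at[OF nm z0U] z0U by (auto simp: analyticity_domain_def)
    have "isolated_singularity_at f z0"
      using nm z0U meromorphic_on_subset[of f upper_half_plane "{z0}"]
      by (auto simp: nicely_meromorphic_on_def meromorphic_at_iff)
    then obtain r where r: "r > 0" "f analytic_on ball z0 r - {z0}"
      unfolding isolated_singularity_at_def by auto
    \<comment> \<open>The second bound keeps the disc in \<open>Im z > Im z0 / 2\<close>, so that
      the denominator in \<open>B\<close> stays away from zero.\<close>
    define r' where "r' = min r (Im z0 / 2)"
    have "r' > 0" using r z0 by (simp add: r'_def)
    have dom: "z \<in> analyticity_domain f" "Im z0 / 2 < Im z" if "z \<noteq> z0" "cmod (z - z0) < r'" for z
    proof -
      have "\<bar>Im z - Im z0\<bar> < Im z0 / 2"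
        using abs_Im_le_cmod[of "z - z0"] that by (simp add: r'_def)
      then show "Im z0 / 2 < Im z" by linarith
      then have "0 < Im z" using z0 by linarith
      moreover have "z \<in> ball z0 r - {z0}"
        using that by (auto simp: r'_def dist_norm norm_minus_commute)
      ultimately show "z \<in> analyticity_domain f"
        using r(2) analytic_on_subset[of f "ball z0 r - {z0}" "{z}"]
        by (simp add: analyticity_domain_def upper_half_plane_def)
    qed
    define \<zeta> where "\<zeta> = z0 + of_real (r' / 2)"
    have \<zeta>: "\<zeta> \<in> analyticity_domain f" "0 < Im \<zeta>"
      using dom[of \<zeta>] \<open>r' > 0\<close> z0 by (auto simp: \<zeta>_def norm_mult)
    define B where "B = cmod (f \<zeta>) + (cmod z0 + r' + cmod \<zeta>)\<^sup>2 / (Im z0 / 2 * Im \<zeta>) * Im (f \<zeta>)"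
    have bound: "cmod (f z) \<le> B" if z: "z \<noteq> z0" "cmod (z - z0) < r'" for z
    proof -
      have "cmod (z - cnj \<zeta>) \<le> cmod z + cmod \<zeta>"
        using norm_triangle_ineq4[of z "cnj \<zeta>"] by simp
      also have "\<dots> \<le> cmod z0 + r' + cmod \<zeta>"
        using norm_triangle_ineq[of "z - z0" z0] z by simp
      finally have "cmod (z - cnj \<zeta>) \<le> cmod z0 + r' + cmod \<zeta>" .
      then have "(cmod (z - cnj \<zeta>))\<^sup>2 / (Im z * Im \<zeta>) \<le> (cmod z0 + r' + cmod \<zeta>)\<^sup>2 / (Im z0 / 2 * Im \<zeta>)"
        using dom(2)[OF z] \<zeta>(2) z0
        by (intro frac_le power_mono mult_right_mono mult_pos_pos) auto
      moreover have "0 \<le> Im (f \<zeta>)" by (rule psd_kernel_Im_nonneg[OF psd \<zeta>])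
      ultimately have "(cmod (z - cnj \<zeta>))\<^sup>2 / (Im z * Im \<zeta>) * Im (f \<zeta>) \<le>
          (cmod z0 + r' + cmod \<zeta>)\<^sup>2 / (Im z0 / 2 * Im \<zeta>) * Im (f \<zeta>)"
        by (intro mult_right_mono)
      moreover have "cmod (f z - cnj (f \<zeta>)) \<le> (cmod (z - cnj \<zeta>))\<^sup>2 / (Im z * Im \<zeta>) * Im (f \<zeta>)"
        using dom(2)[OF z] z0 by (intro psd_kernel_bound[OF psd dom(1)[OF z]] \<zeta>) linarith
      moreover have "cmod (f z) \<le> cmod (f z - cnj (f \<zeta>)) + cmod (f \<zeta>)"
        using norm_triangle_ineq[of "f z - cnj (f \<zeta>)" "cnj (f \<zeta>)"] by simp
      ultimately show ?thesis by (simp add: B_def)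
    qed
    have "B \<ge> 0" using bound[of \<zeta>] \<open>r' > 0\<close> order_trans[OF norm_ge_zero] by (auto simp: \<zeta>_def norm_mult)
    have "filterlim f at_infinity (at z0)"
      using pole by (simp add: is_pole_def)
    then have "eventually (\<lambda>z. B + 1 \<le> cmod (f z)) (at z0)"
      using \<open>B \<ge> 0\<close> unfolding filterlim_at_infinity[OF order.refl] by simp
    moreover have "eventually (\<lambda>z. z \<noteq> z0 \<and> cmod (z - z0) < r') (at z0)"
      using \<open>r' > 0\<close> unfolding eventually_at by (auto simp: dist_norm)
    ultimately have "eventually (\<lambda>_. False) (at z0)"
    proof eventually_elim
      case (elim z)
      then show False using bound[of z] by simp
    qed
    then show False by simp
  qed
  then show ?thesis using analyticity_domain_Im by blast
qed

lemma nev_class_0D: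
  assumes f: "f \<in> nev_class 0"
  shows "f holomorphic_on {z. 0 < Im z}" "nevanlinna f"
proof -
  have "\<forall>z\<in>{z. 0 < Im z}. f analytic_on {z}"
    unfolding nev_class_0_analytic[OF f, symmetric] by (simp add: analyticity_domain_def)
  then have "f analytic_on {z. 0 < Im z}"
    by (subst analytic_on_analytic_at) blast
  then show "f holomorphic_on {z. 0 < Im z}" by (rule analytic_imp_holomorphic)
  show "nevanlinna f"
    using nev_class_0_psd[OF f] by (simp add: nevanlinna_def nev_class_0_analytic[OF f])
qed

section \<open>Matrices of the interpolation data and the entries of \<Theta>\<close>

lemma mat_inverse_eqI:
  fixes M :: "'a :: field mat"
  assumes M: "M \<in> carrier_mat n n" and R: "R \<in> carrier_mat n n" and MR: "M * R = 1\<^sub>m n"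
  shows "mat_inverse M = Some R"
proof (cases "mat_inverse M")
  case None
  have "R * M = 1\<^sub>m n" by (rule mat_mult_left_right_inverse[OF M R MR])
  then have "M \<in> Units (ring_mat TYPE('a) n ())"
    using M R MR by (auto simp: Units_def ring_mat_simps)
  with mat_inverse(1)[OF M None, where b = "()"] show ?thesis by simp
next
  case (Some B)
  from mat_inverse(2)[OF M Some] have B: "B * M = 1\<^sub>m n" "B \<in> carrier_mat n n" by auto
  have "B = B * (M * R)" using B MR by simp
  also have "\<dots> = (B * M) * R" by (rule assoc_mult_mat[OF B(2) M R, symmetric])
  also have "\<dots> = R" using B R by simp
  finally show ?thesis using Some by simp
qed

abbreviation pick_p :: "interp_data \<Rightarrow> nat \<Rightarrow> nat \<Rightarrow> real" where
  "pick_p \<Omega> i j \<equiv> pick_mat \<Omega> $$ (i, j)"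

abbreviation pick_q :: "interp_data \<Rightarrow> nat \<Rightarrow> nat \<Rightarrow> real" where
  "pick_q \<Omega> i j \<equiv> pick_inv \<Omega> $$ (i, j)"

abbreviation C_val :: "interp_data \<Rightarrow> nat \<Rightarrow> real" where
  "C_val \<Omega> j \<equiv> C_row \<Omega> $$ (0, j)"

abbreviation E_val :: "interp_data \<Rightarrow> nat \<Rightarrow> real" where
  "E_val \<Omega> j \<equiv> E_row \<Omega> $$ (0, j)"

lemma C_row_index: "j < num_nodes \<Omega> \<Longrightarrow> C_val \<Omega> j = (if j < num_reg \<Omega> then wval \<Omega> j else xi \<Omega> j)"
  by (simp add: C_row_def)

lemma E_row_index: "j < num_nodes \<Omega> \<Longrightarrow> E_val \<Omega> j = (if j < num_reg \<Omega> then 1 else 0)"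
  by (simp add: E_row_def)

lemma pick_mat_carrier: "pick_mat \<Omega> \<in> carrier_mat (num_nodes \<Omega>) (num_nodes \<Omega>)"
  by (simp add: pick_mat_def)

lemma pick_inv:
  assumes "invertible_mat (pick_mat \<Omega>)"
  shows "pick_inv \<Omega> \<in> carrier_mat (num_nodes \<Omega>) (num_nodes \<Omega>)"
    "pick_mat \<Omega> * pick_inv \<Omega> = 1\<^sub>m (num_nodes \<Omega>)" "pick_inv \<Omega> * pick_mat \<Omega> = 1\<^sub>m (num_nodes \<Omega>)"
proof -
  let ?n = "num_nodes \<Omega>" and ?P = "pick_mat \<Omega>"
  note P = pick_mat_carrier[of \<Omega>]
  obtain B where B: "?P * B = 1\<^sub>m ?n" "B * ?P = 1\<^sub>m (dim_row B)"
    using assms P unfolding invertible_mat_def inverts_mat_def by auto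
  have "dim_row B = ?n" "dim_col B = ?n"
    using arg_cong[OF B(1), of dim_col] arg_cong[OF B(2), of dim_col] P by auto
  then have Bc: "B \<in> carrier_mat ?n ?n" by auto
  have "mat_inverse ?P = Some B" by (rule mat_inverse_eqI[OF P Bc B(1)])
  then show "pick_inv \<Omega> \<in> carrier_mat ?n ?n" "?P * pick_inv \<Omega> = 1\<^sub>m ?n" "pick_inv \<Omega> * ?P = 1\<^sub>m ?n"
    using B Bc \<open>dim_row B = ?n\<close> by (simp_all add: pick_inv_def)
qed

lemma mult_index_sum:
  "A \<in> carrier_mat r n \<Longrightarrow> B \<in> carrier_mat n k \<Longrightarrow> i < r \<Longrightarrow> j < k \<Longrightarrow>
    (A * B) $$ (i, j) = (\<Sum>l<n. A $$ (i, l) * B $$ (l, j))"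
  by (simp add: scalar_prod_def atLeast0LessThan)

lemma pick_data_interp:
  assumes \<Omega>: "interp_data_set \<Omega>" and inv: "invertible_mat (pick_mat \<Omega>)"
  shows "pick_data (num_nodes \<Omega>) (node \<Omega>) (pick_p \<Omega>) (pick_q \<Omega>) (C_val \<Omega>) (E_val \<Omega>) (c_til \<Omega>) (e_til \<Omega>)"
proof
  let ?n = "num_nodes \<Omega>"
  note P = pick_mat_carrier[of \<Omega>] and Q = pick_inv[OF inv]
  show inj: "inj_on (node \<Omega>) {..<?n}" using \<Omega> by (simp add: interp_data_set_def)
  fix i j assume i: "i < ?n"
  have C: "C_row \<Omega> \<in> carrier_mat 1 ?n" and E: "E_row \<Omega> \<in> carrier_mat 1 ?n"
    by (simp_all add: C_row_def E_row_def)
  show "c_til \<Omega> i = (\<Sum>k<?n. C_val \<Omega> k * pick_q \<Omega> k i)"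
    unfolding c_til_def using mult_index_sum[OF C Q(1), of 0 i] i by simp
  show "e_til \<Omega> i = (\<Sum>k<?n. E_val \<Omega> k * pick_q \<Omega> k i)"
    unfolding e_til_def using mult_index_sum[OF E Q(1), of 0 i] i by simp
  assume j: "j < ?n"
  show "(\<Sum>k<?n. pick_p \<Omega> i k * pick_q \<Omega> k j) = (if i = j then 1 else 0)"
    using mult_index_sum[OF P Q(1) i j] Q(2) i j by simp
  show "(\<Sum>k<?n. pick_q \<Omega> i k * pick_p \<Omega> k j) = (if i = j then 1 else 0)"
    using mult_index_sum[OF Q(1) P i j] Q(3) i j by simp
  have x: "node \<Omega> i = node \<Omega> j \<longleftrightarrow> i = j"
    using inj i j by (auto simp: inj_on_def)
  have swap: "(wval \<Omega> j - wval \<Omega> i) / (node \<Omega> j - node \<Omega> i) = (wval \<Omega> i - wval \<Omega> j) / (node \<Omega> i - node \<Omega> j)"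
    using minus_divide_divide[of "wval \<Omega> i - wval \<Omega> j" "node \<Omega> i - node \<Omega> j"] by simp
  show "pick_p \<Omega> i j = pick_p \<Omega> j i"
    using i j swap by (auto simp: pick_mat_def)
  show "pick_p \<Omega> i j * (node \<Omega> j - node \<Omega> i) = E_val \<Omega> i * C_val \<Omega> j - C_val \<Omega> i * E_val \<Omega> j"
    using i j x \<Omega>
    by (auto simp: pick_mat_def C_row_def E_row_def field_simps interp_data_set_def)
qed

lemma CE_mat_carrier: "CE_mat \<Omega> \<in> carrier_mat 2 (num_nodes \<Omega>)"
  using carrier_append_rows[of "C_row \<Omega>" 1 "num_nodes \<Omega>" "E_row \<Omega>" 1]
  by (simp add: CE_mat_def C_row_def E_row_def numeral_2_eq_2)

lemma CE_mat_index:
  assumes "j < num_nodes \<Omega>"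
  shows "CE_mat \<Omega> $$ (0, j) = of_real (C_val \<Omega> j)" "CE_mat \<Omega> $$ (Suc 0, j) = of_real (E_val \<Omega> j)"
  using assms by (simp_all add: CE_mat_def append_rows_def C_row_def E_row_def)

lemma J_mat_index: "J_mat $$ (0, 0) = 0" "J_mat $$ (0, Suc 0) = - \<i>" "J_mat $$ (Suc 0, 0) = \<i>" "J_mat $$ (Suc 0, Suc 0) = 0"
  by (simp_all add: J_mat_def mat_of_rows_list_def)

lemma J_mat_carrier: "J_mat \<in> carrier_mat 2 2"
  by (simp add: J_mat_def mat_of_rows_list_def numeral_2_eq_2)

text \<open>Right multiplication by \<open>J_mat\<close> exchanges the columns belonging to
  \<open>C\<close> and \<open>E\<close>, and its imaginary entries combine with the factor
  \<open>- \<i>\<close> to real signs: hence \<open>e_til\<close> in the first column and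
  \<open>- c_til\<close> in the second.\<close>

lemma Theta_index:
  fixes \<Omega> :: interp_data and z :: complex
  assumes \<Omega>: "interp_data_set \<Omega>" and inv: "invertible_mat (pick_mat \<Omega>)" and z: "0 < Im z"
  defines "S \<equiv> \<lambda>f g. (\<Sum>j<num_nodes \<Omega>. complex_of_real (f j) * (of_real (g j) / (z - of_real (node \<Omega> j))))"
  shows "Theta \<Omega> z $$ (0, 0) = 1 + S (C_val \<Omega>) (e_til \<Omega>)"
    and "Theta \<Omega> z $$ (0, 1) = - S (C_val \<Omega>) (c_til \<Omega>)"
    and "Theta \<Omega> z $$ (1, 0) = S (E_val \<Omega>) (e_til \<Omega>)"
    and "Theta \<Omega> z $$ (1, 1) = 1 - S (E_val \<Omega>) (c_til \<Omega>)"
proof -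
  interpret pick_data "num_nodes \<Omega>" "node \<Omega>" "pick_p \<Omega>" "pick_q \<Omega>" "C_val \<Omega>" "E_val \<Omega>" "c_til \<Omega>" "e_til \<Omega>"
    by (rule pick_data_interp[OF \<Omega> inv])
  let ?n = "num_nodes \<Omega>"
  define M where "M = z \<cdot>\<^sub>m 1\<^sub>m ?n - map_mat complex_of_real (X_mat \<Omega>)"
  define R where "R = mat_diag ?n (\<lambda>j. 1 / (z - of_real (node \<Omega> j)))"
  have M: "M = mat_diag ?n (\<lambda>j. z - of_real (node \<Omega> j))"
    by (rule eq_matI) (auto simp: M_def X_mat_def mat_diag_def)
  have zx: "z - of_real (node \<Omega> j) \<noteq> 0" for j using z by auto
  have "mat_inverse M = Some R"
    unfolding M R_def by (rule mat_inverse_eqI[of _ ?n]) (use zx in auto)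
  then have R: "the (mat_inverse M) = R" by simp
  define QC where "QC = map_mat complex_of_real (pick_inv \<Omega>)"
  have QC: "QC \<in> carrier_mat ?n ?n" using pick_inv(1)[OF inv] by (simp add: QC_def)
  have QC_index: "QC $$ (j, k) = of_real (pick_q \<Omega> j k)" if "j < ?n" "k < ?n" for j k
    using that pick_inv(1)[OF inv] by (simp add: QC_def)
  note CE = CE_mat_carrier[of \<Omega>] and CEa = mat_adjoint_carrier[OF CE_mat_carrier[of \<Omega>]]
  define CR where "CR = CE_mat \<Omega> * R"
  have CR: "CR \<in> carrier_mat 2 ?n" using CE by (simp add: CR_def R_def)
  have CR_index: "CR $$ (i, j) = CE_mat \<Omega> $$ (i, j) / (z - of_real (node \<Omega> j))" if "i < 2" "j < ?n" for i j
    unfolding CR_def R_def mat_diag_mult_right[OF CE] using that by simp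
  define G where "G = CR * (QC * mat_adjoint (CE_mat \<Omega>))"
  have QA: "QC * mat_adjoint (CE_mat \<Omega>) \<in> carrier_mat ?n 2" using QC CEa by auto
  have G: "G \<in> carrier_mat 2 2" unfolding G_def using CR QA by auto
  have QA_index: "(QC * mat_adjoint (CE_mat \<Omega>)) $$ (j, 0) = of_real (c_til \<Omega> j)"
    "(QC * mat_adjoint (CE_mat \<Omega>)) $$ (j, Suc 0) = of_real (e_til \<Omega> j)" if j: "j < ?n" for j
  proof -
    have "(QC * mat_adjoint (CE_mat \<Omega>)) $$ (j, l) = (\<Sum>k<?n. of_real (pick_q \<Omega> k j) * cnj (CE_mat \<Omega> $$ (l, k)))"
      if "l < 2" for l
      unfolding mult_index_sum[OF QC CEa j that] using j that
      by (intro sum.cong refl) (auto simp: QC_index mat_adjoint_index[OF CE] q_sym[OF j])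
    from this[of 0] this[of "Suc 0"]
    show "(QC * mat_adjoint (CE_mat \<Omega>)) $$ (j, 0) = of_real (c_til \<Omega> j)"
      "(QC * mat_adjoint (CE_mat \<Omega>)) $$ (j, Suc 0) = of_real (e_til \<Omega> j)"
      using j by (simp_all add: CE_mat_index c_eq e_eq mult.commute)
  qed
  have G_index: "G $$ (0, 0) = S (C_val \<Omega>) (c_til \<Omega>)" "G $$ (0, Suc 0) = S (C_val \<Omega>) (e_til \<Omega>)"
    "G $$ (Suc 0, 0) = S (E_val \<Omega>) (c_til \<Omega>)" "G $$ (Suc 0, Suc 0) = S (E_val \<Omega>) (e_til \<Omega>)"
    unfolding G_def S_def
    by (subst mult_index_sum[OF CR QA]; simp add: CR_index QA_index CE_mat_index)+
  have "CE_mat \<Omega> * R * QC * mat_adjoint (CE_mat \<Omega>) = G"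
    unfolding G_def CR_def[symmetric] by (rule assoc_mult_mat[OF CR QC CEa])
  then have Th: "Theta \<Omega> z = 1\<^sub>m 2 - \<i> \<cdot>\<^sub>m (G * J_mat)"
    unfolding Theta_def M_def[symmetric] R QC_def[symmetric] by simp
  have GJ: "(G * J_mat) $$ (i, j) = G $$ (i, 0) * J_mat $$ (0, j) + G $$ (i, Suc 0) * J_mat $$ (Suc 0, j)"
    if "i < 2" "j < 2" for i j
    unfolding mult_index_sum[OF G J_mat_carrier that] by (simp add: numeral_2_eq_2)
  have ii: "\<i> * (s * \<i>) = - s" for s by (simp add: complex_eq_iff)
  show "Theta \<Omega> z $$ (0, 0) = 1 + S (C_val \<Omega>) (e_til \<Omega>)"
    "Theta \<Omega> z $$ (0, 1) = - S (C_val \<Omega>) (c_til \<Omega>)"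
    "Theta \<Omega> z $$ (1, 0) = S (E_val \<Omega>) (e_til \<Omega>)"
    "Theta \<Omega> z $$ (1, 1) = 1 - S (E_val \<Omega>) (c_til \<Omega>)"
    unfolding Th using G J_mat_carrier GJ[of 0 0] GJ[of 0 1] GJ[of 1 0] GJ[of 1 1]
    by (simp_all add: J_mat_index G_index ii)
qed

section \<open>The transform \<open>w\<close> as a quotient of \<open>Num\<close> and
  \<open>Den\<close>\<close>

fun par_num :: "(complex \<Rightarrow> complex) with_inf \<Rightarrow> complex \<Rightarrow> complex" where
  "par_num (Fin \<phi>) = \<phi>"
| "par_num Infty = (\<lambda>_. 1)"

fun par_den :: "(complex \<Rightarrow> complex) with_inf \<Rightarrow> complex \<Rightarrow> complex" where
  "par_den (Fin \<phi>) = (\<lambda>_. 1)"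
| "par_den Infty = (\<lambda>_. 0)"

locale bip =
  fixes \<Omega> :: interp_data and w :: "complex \<Rightarrow> complex" and \<phi> :: "(complex \<Rightarrow> complex) with_inf"
  assumes \<Omega>: "interp_data_set \<Omega>"
    and inv: "invertible_mat (pick_mat \<Omega>)"
    and w_mero: "w nicely_meromorphic_on upper_half_plane"
    and \<phi>: "\<phi> \<in> nev0_ext"
    and lft: "is_lft (Theta \<Omega>) \<phi> w"
begin

abbreviation "n \<equiv> num_nodes \<Omega>"
abbreviation "x \<equiv> node \<Omega>"
abbreviation "p \<equiv> pick_p \<Omega>"
abbreviation "q \<equiv> pick_q \<Omega>"
abbreviation "C \<equiv> C_val \<Omega>"
abbreviation "E \<equiv> E_val \<Omega>"
abbreviation "c \<equiv> c_til \<Omega>"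
abbreviation "e \<equiv> e_til \<Omega>"
abbreviation "\<gamma> \<equiv> gam \<Omega>"
abbreviation "\<xi> \<equiv> xi \<Omega>"
abbreviation "nt k \<equiv> nontangential (x k)"
abbreviation "quot k z \<equiv> (w z - of_real (wval \<Omega> k)) / (z - of_real (x k))"

sublocale pick_param n x p q C E c e "par_num \<phi>" "par_den \<phi>"
  unfolding pick_param_def by (rule pick_data_interp[OF \<Omega> inv])

lemma lft_eq:
  assumes z: "0 < Im z"
  shows "lft_num (Theta \<Omega>) \<phi> z = Num z" "lft_den (Theta \<Omega>) \<phi> z = Den z"
proof -
  note Th = Theta_index[OF \<Omega> inv z]
  have Y: "Y j z = of_real (e j) / (z - of_real (x j)) * par_num \<phi> z -
      of_real (c j) / (z - of_real (x j)) * par_den \<phi> z" for j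
    by (simp add: Y_def lin_def diff_divide_distrib)
  have sum: "(\<Sum>j<n. of_real (f j) * Y j z) =
      (\<Sum>j<n. of_real (f j) * (of_real (e j) / (z - of_real (x j)))) * par_num \<phi> z -
      (\<Sum>j<n. of_real (f j) * (of_real (c j) / (z - of_real (x j)))) * par_den \<phi> z" for f
    unfolding sum_distrib_right sum_subtractf[symmetric] Y by (intro sum.cong refl) (simp only: right_diff_distrib mult.assoc)
  have "lft_num (Theta \<Omega>) \<phi> z = Theta \<Omega> z $$ (0, 0) * par_num \<phi> z + Theta \<Omega> z $$ (0, 1) * par_den \<phi> z"
    "lft_den (Theta \<Omega>) \<phi> z = Theta \<Omega> z $$ (1, 0) * par_num \<phi> z + Theta \<Omega> z $$ (1, 1) * par_den \<phi> z"
    by (cases \<phi>; simp)+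
  then show "lft_num (Theta \<Omega>) \<phi> z = Num z" "lft_den (Theta \<Omega>) \<phi> z = Den z"
    unfolding Num_def Den_def sum Th by (simp_all only: distrib_right left_diff_distrib mult_1 mult_minus_left) simp_all
qed

lemma cosparse_w: "\<forall>\<^sub>\<approx>z\<in>{z. 0 < Im z}. Den z \<noteq> 0 \<and> w z = Num z / Den z"
proof -
  have "\<forall>\<^sub>\<approx>z\<in>{z. 0 < Im z}. z \<in> {z. 0 < Im z}"
    by (rule eventually_in_cosparse) (auto simp: open_halfspace_Im_gt)
  with lft[unfolded is_lft_def upper_half_plane_def] show ?thesis
    by eventually_elim (simp add: lft_eq)
qed

sublocale nev_param n x p q C E c e "par_num \<phi>" "par_den \<phi>"
proof
  show "par_num \<phi> holomorphic_on {z. 0 < Im z}" "par_den \<phi> holomorphic_on {z. 0 < Im z}"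
    using \<phi> nev_class_0D(1) by (cases \<phi>; auto simp: nev0_ext_def)+
  show "par_num \<phi> z \<noteq> 0 \<or> par_den \<phi> z \<noteq> 0" for z
    by (cases \<phi>) auto
  show "psd_on {z. 0 < Im z} H"
  proof (cases \<phi>)
    case (Fin f)
    then have "H = nev_kernel f" unfolding fun_eq_iff H_def by (simp add: nev_kernel_def)
    then show ?thesis using Fin \<phi> nev_class_0D(2)[of f] by (auto simp: nev0_ext_def nevanlinna_def)
  next
    case Infty
    then have "H = (\<lambda>_ _. 0)" unfolding fun_eq_iff H_def by simp
    then show ?thesis by (simp add: psd_on_def)
  qed
  have "eventually (\<lambda>z. Den z \<noteq> 0 \<and> w z = Num z / Den z) (at \<i>)"
    by (rule eventually_cosparse_imp_eventually_at[OF cosparse_w]) simp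
  moreover have "eventually (\<lambda>z. 0 < Im z) (at \<i>)"
    by (rule eventually_at_in_open'[of "{z. 0 < Im z}", simplified]) (simp_all add: open_halfspace_Im_gt)
  ultimately have "eventually (\<lambda>z. 0 < Im z \<and> Den z \<noteq> 0) (at \<i>)"
    by eventually_elim simp
  then show "\<exists>z. 0 < Im z \<and> Den z \<noteq> 0"
    by (rule eventually_happens'[rotated]) simp
qed

text \<open>\<open>is_lft\<close> speaks about points off a discrete set. Where \<open>Den\<close>
  is nonzero the quotient is continuous, so \<open>w\<close> has a finite limit and no pole, and for
  a nicely meromorphic function the value is then that limit.\<close>

lemma w_analytic:
  assumes z: "0 < Im z" and D: "Den z \<noteq> 0"
  shows "w analytic_on {z}" "w z = Num z / Den z"
proof -
  have zU: "z \<in> upper_half_plane" using z by (simp add: upper_half_plane_def)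
  have opU: "open {z. 0 < Im z}" by (rule open_halfspace_Im_gt)
  have cont: "isCont Num z" "isCont Den z"
    using holomorphic_Num_Den opU z
    by (metis continuous_on_eq_continuous_at holomorphic_on_imp_continuous_on mem_Collect_eq)+
  have "((\<lambda>u. Num u / Den u) \<longlongrightarrow> Num z / Den z) (at z)"
    using cont D unfolding isCont_def by (intro tendsto_divide)
  moreover have "eventually (\<lambda>u. Den u \<noteq> 0 \<and> w u = Num u / Den u) (at z)"
    by (rule eventually_cosparse_imp_eventually_at[OF cosparse_w]) (use z in simp)
  then have "eventually (\<lambda>u. Num u / Den u = w u) (at z)"
    by eventually_elim simp
  ultimately have lim: "(w \<longlongrightarrow> Num z / Den z) (at z)"
    by (rule Lim_transform_eventually)
  then have np: "\<not> is_pole w z"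
    unfolding is_pole_def using not_tendsto_and_filterlim_at_infinity[of "at z" w] by auto
  then show "w analytic_on {z}"
    by (rule nicely_meromorphic_on_imp_analytic_at[OF w_mero zU])
  have "(w \<longlongrightarrow> w z) (at z)"
    using w_mero zU np by (auto simp: nicely_meromorphic_on_def)
  then show "w z = Num z / Den z"
    using lim by (rule tendsto_unique[rotated]) simp
qed

text \<open>At a zero of \<open>Den\<close>, continuity of \<open>w\<close> in
  \<open>w * Den = Num\<close> would make \<open>Num\<close> vanish too, against
  \<open>Num_or_Den_nonzero\<close>.\<close>

lemma analyticity_domain_w: "analyticity_domain w = {z. 0 < Im z \<and> Den z \<noteq> 0}"
proof -
  have "Den z \<noteq> 0" if z: "z \<in> analyticity_domain w" for z
  proof
    assume 0: "Den z = 0"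
    have Imz: "0 < Im z" using analyticity_domain_Im[OF z] .
    have "isCont w z"
      using z analytic_at_imp_isCont by (auto simp: analyticity_domain_def)
    moreover have "isCont Num z" "isCont Den z"
      using holomorphic_Num_Den open_halfspace_Im_gt[of 0] Imz
      by (metis continuous_on_eq_continuous_at holomorphic_on_imp_continuous_on mem_Collect_eq)+
    ultimately have "((\<lambda>u. w u * Den u - Num u) \<longlongrightarrow> w z * Den z - Num z) (at z)"
      unfolding isCont_def by (intro tendsto_intros)
    moreover have "eventually (\<lambda>u. Den u \<noteq> 0 \<and> w u = Num u / Den u) (at z)"
      by (rule eventually_cosparse_imp_eventually_at[OF cosparse_w]) (use Imz in simp)
    then have "eventually (\<lambda>u. w u * Den u - Num u = 0) (at z)"
      by eventually_elim simp
    ultimately have "((\<lambda>u. 0) \<longlongrightarrow> w z * Den z - Num z) (at z)"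
      by (rule Lim_transform_eventually)
    then have "Num z = 0"
      using 0 tendsto_unique[OF _ tendsto_const, of "at z" 0 "w z * Den z - Num z"] by simp
    with 0 Num_or_Den_nonzero[OF Imz] show False by simp
  qed
  then show ?thesis
  proof (intro equalityI subsetI)
    fix z assume "z \<in> {z. 0 < Im z \<and> Den z \<noteq> 0}"
    then show "z \<in> analyticity_domain w"
      using w_analytic(1)[of z] by (simp add: analyticity_domain_def upper_half_plane_def)
  qed (use analyticity_domain_Im in blast)
qed

lemma eventually_Den_nonzero: "eventually (\<lambda>z. 0 < Im z \<and> Den z \<noteq> 0) (nontangential t)"
proof -
  have "closed {z. 0 < Im z \<and> Den z = 0}"
    by (rule finite_imp_closed[OF finite_Den_zeros])
  then have "eventually (\<lambda>z. z \<in> - {z. 0 < Im z \<and> Den z = 0}) (nhds (complex_of_real t))"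
    by (intro eventually_nhds_in_open) auto
  then have "eventually (\<lambda>z. z \<in> - {z. 0 < Im z \<and> Den z = 0}) (nontangential t)"
    using nontangential_tendsto[of t] unfolding filterlim_def le_filter_def eventually_filtermap by auto
  with eventually_nontangential_Im_pos show ?thesis
    by eventually_elim auto
qed

text \<open>Finitely many zeros of \<open>Den\<close> cannot accumulate at \<open>t\<close>. This
  provides the holomorphy under which limits of \<open>deriv w\<close> and of difference quotients
  are exchanged.\<close>

lemma w_holomorphic_near:
  obtains r where "r > 0" "w holomorphic_on {z. 0 < Im z} \<inter> ball (complex_of_real t) r"
proof -
  have "closed {z. 0 < Im z \<and> Den z = 0}"
    by (rule finite_imp_closed[OF finite_Den_zeros])
  then have "open (- {z. 0 < Im z \<and> Den z = 0})" by auto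
  then obtain r where r: "r > 0" "ball (complex_of_real t) r \<subseteq> - {z. 0 < Im z \<and> Den z = 0}"
    using openE[of "- {z. 0 < Im z \<and> Den z = 0}" "complex_of_real t"] by auto
  have "w analytic_on {z. 0 < Im z} \<inter> ball (complex_of_real t) r"
  proof (subst analytic_on_analytic_at, intro ballI)
    fix z assume "z \<in> {z. 0 < Im z} \<inter> ball (complex_of_real t) r"
    then show "w analytic_on {z}"
      using r(2) by (intro w_analytic(1)) auto
  qed
  then show ?thesis using that r(1) analytic_imp_holomorphic by blast
qed

end


section \<open>Boundary behaviour at the nodes\<close>

lemma tendsto_eventually_eq:
  assumes "(f \<longlongrightarrow> l) F" "eventually (\<lambda>z. f z = g z) F"
  shows "(g \<longlongrightarrow> l) F"
  using assms tendsto_cong by fastforce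

lemma nontangential_sub_tendsto: "((\<lambda>z. z - complex_of_real x) \<longlongrightarrow> 0) (nontangential x)"
  using tendsto_diff[OF nontangential_tendsto[of x] tendsto_const, of "complex_of_real x"] by simp

lemma tendsto_recip_imp_at_infinity:
  fixes f :: "'a \<Rightarrow> complex"
  assumes "((\<lambda>z. 1 / f z) \<longlongrightarrow> 0) F" "eventually (\<lambda>z. f z \<noteq> 0) F"
  shows "filterlim f at_infinity F"
proof -
  have "filterlim (\<lambda>z. 1 / f z) (at 0) F"
    unfolding filterlim_at using assms by auto
  then have "filterlim (\<lambda>z. inverse (1 / f z)) at_infinity F"
    by (rule filterlim_compose[OF filterlim_inverse_at_infinity])
  then show ?thesis by simp
qed

text \<open>As \<eta> is real, the diagonal kernel on the vertical ray is the real part of the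
  difference quotient, and so has a finite limit.\<close>

lemma nontangential_quotient_not_kernel_infinity:
  assumes q: "((\<lambda>z. (f z - of_real \<eta>) / (z - complex_of_real x)) \<longlongrightarrow> d) (nontangential x)"
  shows "\<not> filterlim (\<lambda>z. nev_kernel f z z) at_infinity (nontangential x)"
proof
  assume "filterlim (\<lambda>z. nev_kernel f z z) at_infinity (nontangential x)"
  then have "filterlim (\<lambda>t. nev_kernel f (Complex x t) (Complex x t)) at_infinity (at_right 0)"
    by (rule filterlim_compose[OF _ filterlim_vertical_nontangential])
  moreover have "((\<lambda>t. (f (Complex x t) - of_real \<eta>) / (Complex x t - complex_of_real x)) \<longlongrightarrow> d) (at_right 0)"
    by (rule filterlim_compose[OF q filterlim_vertical_nontangential])
  then have "((\<lambda>t. complex_of_real (Re ((f (Complex x t) - of_real \<eta>) / (Complex x t - complex_of_real x)))) \<longlongrightarrow>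
      complex_of_real (Re d)) (at_right 0)"
    by (intro tendsto_intros)
  then have "((\<lambda>t. nev_kernel f (Complex x t) (Complex x t)) \<longlongrightarrow> of_real (Re d)) (at_right 0)"
  proof (rule tendsto_eventually_eq)
    show "eventually (\<lambda>t. complex_of_real (Re ((f (Complex x t) - of_real \<eta>) / (Complex x t - complex_of_real x))) =
        nev_kernel f (Complex x t) (Complex x t)) (at_right 0)"
      using eventually_at_right_less[of 0]
      by eventually_elim (simp add: nev_kernel_diag Re_divide power2_eq_square)
  qed
  ultimately show False
    using not_tendsto_and_filterlim_at_infinity[of "at_right (0::real)"] by auto
qed

section \<open>The conditions on the parameter as limits of its difference quotient\<close>

definition node_cond :: "interp_data \<Rightarrow> (complex \<Rightarrow> complex) with_inf \<Rightarrow> nat \<Rightarrow> bool" where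
  "node_cond \<Omega> \<phi> i \<longleftrightarrow>
    (e_til \<Omega> i \<noteq> 0 \<longrightarrow> cond_C1 \<Omega> \<phi> i \<or> cond_C2 \<Omega> \<phi> i \<or> cond_C3 \<Omega> \<phi> i) \<and>
    (e_til \<Omega> i = 0 \<longrightarrow> cond_Ct1 \<Omega> \<phi> i \<or> cond_Ct2 \<Omega> \<phi> i \<or> cond_Ct3 \<Omega> \<phi> i)"

context bip
begin

text \<open>Otherwise \<open>q_displacement\<close> makes column \<open>k\<close> of
  \<open>q\<close> vanish off the diagonal, so \<open>c k\<close> and \<open>e k\<close> are
  \<open>q k k\<close> times \<open>C k\<close> and \<open>E k\<close>. The latter are not both
  zero, hence \<open>q k k = 0\<close> and the invertible \<open>q\<close> has a zero
  column.\<close>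

lemma c_e_not_both_zero:
  assumes k: "k < n" and "e k = 0"
  shows "c k \<noteq> 0"
proof
  assume c0: "c k = 0"
  have q0: "q j k = 0" if j: "j < n" "j \<noteq> k" for j
    using q_displacement[OF j(1) k] c0 assms(2) inj j k by (auto simp: inj_on_def)
  have one: "(\<Sum>j<n. G j * q j k) = G k * q k k" for G
    using k q0 by (subst sum.remove[of _ k]) (auto intro!: sum.neutral)
  have "C k * q k k = 0" "E k * q k k = 0"
    using c_eq[OF k] e_eq[OF k] c0 assms(2) by (simp_all add: one)
  moreover have "C k \<noteq> 0 \<or> E k \<noteq> 0"
    using k \<Omega> by (auto simp: C_row_index E_row_index interp_data_set_def)
  ultimately have "q k k = 0" by auto
  then show False using pq[OF k k] by (simp add: one)
qed

text \<open>A finite limit of the quotient excludes \<open>cond_C1\<close> and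
  \<open>cond_C2\<close>; what remains is \<open>cond_C3\<close>, multiplied by
  \<open>(e k)\<^sup>2\<close>.\<close>

lemma node_cond_iff_regular_coordinate:
  assumes f: "\<phi> = Fin f" and e: "e k \<noteq> 0"
    and q: "((\<lambda>z. (f z - of_real (eta \<Omega> k)) / (z - of_real (x k))) \<longlongrightarrow> of_real d) (nt k)"
  shows "node_cond \<Omega> \<phi> k \<longleftrightarrow> (e k)\<^sup>2 * d + q k k > 0"
proof -
  have hol: "f holomorphic_on {z. 0 < Im z} \<inter> ball (complex_of_real (x k)) 1"
    using holo(1) f by (auto intro: holomorphic_on_subset)
  note lims = nontangential_quotient_imp_deriv[OF hol _ q]
  have val: "bd_value \<phi> (x k) (Fin (of_real (eta \<Omega> k)))"
    using lims(1) by (simp add: f)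
  have der: "bd_deriv \<phi> (x k) (Fin (of_real d')) \<longleftrightarrow> d' = d" for d'
    using lims(2) tendsto_unique[OF nontangential_nontriv _ lims(2), of "of_real d'"]
    by (auto simp: f)
  have "\<not> cond_C1 \<Omega> \<phi> k" using val by (simp add: cond_C1_def)
  moreover have "\<not> cond_C2 \<Omega> \<phi> k"
    using nontangential_quotient_not_kernel_infinity[OF q] by (simp add: cond_C2_def f)
  moreover have "cond_C3 \<Omega> \<phi> k \<longleftrightarrow> - p_til \<Omega> k / (e k)\<^sup>2 < d"
    unfolding cond_C3_def der using val by auto
  moreover have "- p_til \<Omega> k / (e k)\<^sup>2 < d \<longleftrightarrow> (e k)\<^sup>2 * d + q k k > 0"
    unfolding p_til_def using pos_divide_less_eq[of "(e k)\<^sup>2" "- q k k" d] e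
    by (auto simp: mult.commute)
  ultimately show ?thesis using e by (simp add: node_cond_def)
qed

text \<open>With a nonzero residue \<open>- \<mu>\<close> the parameter tends to infinity and
  \<open>- 1 / \<phi>\<^sub>-\<^sub>1\<close> is \<open>1 / \<mu>\<close>. Only
  \<open>cond_Ct3\<close> can hold; it is multiplied by \<open>(c k)\<^sup>2\<close>.\<close>

lemma node_cond_iff_singular_coordinate:
  assumes f: "\<phi> = Fin f" and k: "k < n" and e: "e k = 0"
    and q: "((\<lambda>z. (z - of_real (x k)) * f z) \<longlongrightarrow> - of_real \<mu>) (nt k)"
    and \<mu>: "\<mu> > 0"
  shows "node_cond \<Omega> \<phi> k \<longleftrightarrow> (c k)\<^sup>2 / \<mu> + q k k > 0"
proof -
  let ?x = "complex_of_real (x k)" and ?F = "nt k"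
  have c: "c k \<noteq> 0" by (rule c_e_not_both_zero[OF k e])
  have ev: "eventually (\<lambda>z. (z - ?x) * f z \<noteq> 0) ?F"
    by (rule tendsto_imp_eventually_ne[OF q]) (use \<mu> in simp)
  have "((\<lambda>z. (z - ?x) / ((z - ?x) * f z)) \<longlongrightarrow> 0 / (- of_real \<mu>)) ?F"
    by (intro tendsto_divide nontangential_sub_tendsto q) (use \<mu> in simp)
  moreover have "eventually (\<lambda>z. (z - ?x) / ((z - ?x) * f z) = 1 / f z) ?F"
    using eventually_nontangential_ne by eventually_elim simp
  ultimately have "((\<lambda>z. 1 / f z) \<longlongrightarrow> 0 / (- of_real \<mu>)) ?F"
    by (rule tendsto_eventually_eq)
  then have "((\<lambda>z. 1 / f z) \<longlongrightarrow> 0) ?F" by simp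
  then have "filterlim f at_infinity ?F"
    by (rule tendsto_recip_imp_at_infinity) (use ev in eventually_elim, auto)
  then have val: "bd_value \<phi> (x k) Infty" by (simp add: f)
  have res: "bd_residue \<phi> (x k) L \<longleftrightarrow> L = Fin (- of_real \<mu>)" for L
  proof (cases L)
    case (Fin l)
    then show ?thesis
      using q tendsto_unique[OF nontangential_nontriv _ q, of l] by (auto simp: f)
  next
    case Infty
    then show ?thesis
      using q not_tendsto_and_filterlim_at_infinity[OF nontangential_nontriv q] by (auto simp: f)
  qed
  have neg: "bd_neg_recip_residue \<phi> (x k) t \<longleftrightarrow> t = 1 / \<mu>" for t
  proof -
    have "bd_neg_recip_residue \<phi> (x k) t \<longleftrightarrow> complex_of_real t = of_real (1 / \<mu>)"
      unfolding bd_neg_recip_residue_def res using \<mu> by auto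
    then show ?thesis by (simp only: of_real_eq_iff)
  qed
  have "\<not> cond_Ct1 \<Omega> \<phi> k" using val by (simp add: cond_Ct1_def)
  moreover have "\<not> cond_Ct2 \<Omega> \<phi> k" unfolding cond_Ct2_def res using \<mu> by simp
  moreover have "cond_Ct3 \<Omega> \<phi> k \<longleftrightarrow> - p_til \<Omega> k / (c k)\<^sup>2 < 1 / \<mu>"
    unfolding cond_Ct3_def neg using val by auto
  moreover have "- p_til \<Omega> k / (c k)\<^sup>2 < 1 / \<mu> \<longleftrightarrow> (c k)\<^sup>2 / \<mu> + q k k > 0"
    unfolding p_til_def using pos_divide_less_eq[of "(c k)\<^sup>2" "- q k k" "1 / \<mu>"] c
    by auto
  ultimately show ?thesis using e by (simp add: node_cond_def)
qed

text \<open>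
  With \<open>D1 = lim lin k z / ((z - x\<^sub>k) \<psi> z)\<close> and \<open>D2\<close> as in \<open>boundary_limits\<close>, the number \<open>S\<close>
  below is \<open>D1 + q\<^sub>k\<^sub>k D2\<close>.
\<close>

lemma node_alternative:
  assumes k: "k < n"
  obtains \<psi> :: "complex \<Rightarrow> complex" and S D2 :: real where
    "eventually (\<lambda>z. \<psi> z \<noteq> 0) (nt k)"
    "((\<lambda>z. Num z / \<psi> z) \<longlongrightarrow> of_real (C k * S)) (nt k)"
    "((\<lambda>z. Den z / \<psi> z) \<longlongrightarrow> of_real (E k * S)) (nt k)"
    "((\<lambda>z. PY k z / \<psi> z) \<longlongrightarrow> of_real (p k k * S - D2)) (nt k)"
    "D2 \<ge> 0" "S \<le> 0 \<Longrightarrow> D2 = 1" "node_cond \<Omega> \<phi> k \<longleftrightarrow> S > 0"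
proof -
  let ?x = "complex_of_real (x k)" and ?F = "nt k"
  let ?e = "complex_of_real (e k)" and ?c = "complex_of_real (c k)"
  note result = that
  show ?thesis
  proof (cases "e k = 0")
    case False
    define M where "M = (\<lambda>z. par_den \<phi> z / ?e)"
    have a: "par_num \<phi> z = of_real (1 / e k) * lin k z + of_real (c k) * M z" for z
      using False by (simp add: M_def lin_def field_simps)
    have b: "par_den \<phi> z = of_real 0 * lin k z + of_real (e k) * M z" for z
      using False by (simp add: M_def)
    note bl = boundary_limits[OF k a b]
    show ?thesis
    proof (cases \<phi>)
      case Infty
      have lin: "lin k z = ?e" for z unfolding lin_def by (simp add: Infty)
      have M: "M z = 0" for z by (simp add: M_def Infty)
      \<comment> \<open>The parameter infinity is not the critical value here. Normalizing by
        \<open>Y k\<close> itself gives \<open>D1 = 1\<close>, \<open>D2 = 0\<close>, as for an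
        infinite quotient.\<close>
      define \<psi> where "\<psi> = (\<lambda>z. ?e / (z - ?x))"
      have ev: "eventually (\<lambda>z. \<psi> z \<noteq> 0) ?F"
        using eventually_nontangential_ne by eventually_elim (use False in \<open>simp add: \<psi>_def\<close>)
      have 1: "((\<lambda>z. lin k z / ((z - ?x) * \<psi> z)) \<longlongrightarrow> of_real 1) ?F"
        by (rule tendsto_eventually_eq[OF tendsto_const])
          (use eventually_nontangential_ne in \<open>eventually_elim, use False in \<open>simp add: \<psi>_def lin\<close>\<close>)
      have 2: "((\<lambda>z. M z / \<psi> z) \<longlongrightarrow> of_real 0) ?F" by (simp add: M)
      have "node_cond \<Omega> \<phi> k"
        using False by (simp add: node_cond_def cond_C1_def Infty)
      then show ?thesis
        using result[OF ev, of "1 + q k k * 0" 0] bl[OF 1 2] by simp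
    next
      case (Fin f)
      define \<eta> where "\<eta> = eta \<Omega> k"
      have lin: "lin k z = ?e * (f z - of_real \<eta>)" for z
        unfolding lin_def using False by (simp add: Fin \<eta>_def eta_def field_simps)
      have M: "M z = 1 / ?e" for z by (simp add: M_def Fin)
      have f: "nevanlinna f" using \<phi> nev_class_0D(2)[of f] by (auto simp: Fin nev0_ext_def)
      \<comment> \<open>Normalizing by \<open>M\<close> gives \<open>D2 = 1\<close>, and
        \<open>S\<close> becomes the quantity whose sign \<open>cond_C3\<close> tests.\<close>
      have finite_case: ?thesis if "d \<ge> 0"
        and q: "((\<lambda>z. (f z - of_real \<eta>) / (z - ?x)) \<longlongrightarrow> of_real d) ?F" for d
      proof -
        have ev: "eventually (\<lambda>z. M z \<noteq> 0) ?F" using False by (simp add: M)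
        have 1: "((\<lambda>z. lin k z / ((z - ?x) * M z)) \<longlongrightarrow> of_real ((e k)\<^sup>2 * d)) ?F"
          using tendsto_mult[OF tendsto_const[of "?e\<^sup>2"] q] False
          by (simp add: lin M power2_eq_square mult_ac)
        have 2: "((\<lambda>z. M z / M z) \<longlongrightarrow> of_real 1) ?F" using False by (simp add: M)
        have "node_cond \<Omega> \<phi> k \<longleftrightarrow> (e k)\<^sup>2 * d + q k k > 0"
          by (rule node_cond_iff_regular_coordinate[OF Fin False]) (use q in \<open>simp add: \<eta>_def\<close>)
        then show ?thesis
          using result[OF ev, of "(e k)\<^sup>2 * d + q k k * 1" 1] bl[OF 1 2] by simp
      qed
      show ?thesis
      \<comment> \<open>If \<open>f\<close> takes the real value \<eta> inside the half plane, it is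
        constant and the quotient is zero. Otherwise \<open>- 1 / (f - \<eta>)\<close> is
        Nevanlinna, and its residue at the node gives the limit of the reciprocal quotient.\<close>
      proof (cases "\<exists>\<zeta>. 0 < Im \<zeta> \<and> f \<zeta> = of_real \<eta>")
        case True
        then obtain \<zeta> where \<zeta>: "0 < Im \<zeta>" "f \<zeta> = of_real \<eta>" by auto
        have const: "f z = of_real \<eta>" if "0 < Im z" for z
          using nevanlinna_real_value[OF f \<zeta>(1) _ that] \<zeta>(2) by simp
        have "((\<lambda>z. (f z - of_real \<eta>) / (z - ?x)) \<longlongrightarrow> of_real 0) ?F"
          by (rule tendsto_eventually_eq[OF tendsto_const])
            (use eventually_nontangential_Im_pos in \<open>eventually_elim, simp add: const\<close>)
        then show ?thesis by (intro finite_case[of 0]) auto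
      next
        case nowhere: False
        define g where "g = (\<lambda>z. - 1 / (f z - of_real \<eta>))"
        have g: "nevanlinna g"
          unfolding g_def by (rule nevanlinna_neg_recip[OF f]) (use nowhere in auto)
        obtain \<mu> where \<mu>: "\<mu> \<ge> 0" and lim: "((\<lambda>z. (z - ?x) * g z) \<longlongrightarrow> - of_real \<mu>) ?F"
          using nevanlinna_nontangential_residue[OF g] by blast
        show ?thesis
        proof (cases "\<mu> = 0")
          case True
          define \<psi> where "\<psi> = (\<lambda>z. lin k z / (z - ?x))"
          have ev: "eventually (\<lambda>z. \<psi> z \<noteq> 0) ?F"
            using eventually_nontangential_ne eventually_nontangential_Im_pos
            by eventually_elim (use False nowhere in \<open>auto simp: \<psi>_def lin\<close>)
          have 1: "((\<lambda>z. lin k z / ((z - ?x) * \<psi> z)) \<longlongrightarrow> of_real 1) ?F"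
            by (rule tendsto_eventually_eq[OF tendsto_const])
              (use ev in \<open>eventually_elim, auto simp: \<psi>_def\<close>)
          have "((\<lambda>z. - (1 / ?e\<^sup>2) * ((z - ?x) * g z)) \<longlongrightarrow> - (1 / ?e\<^sup>2) * 0) ?F"
            using lim True by (intro tendsto_intros) simp
          then have 2: "((\<lambda>z. M z / \<psi> z) \<longlongrightarrow> of_real 0) ?F"
            by (simp add: \<psi>_def M lin g_def power2_eq_square mult.assoc)
          have inf: "((\<lambda>z. (z - ?x) / (f z - of_real \<eta>)) \<longlongrightarrow> 0) ?F"
            using tendsto_minus[OF lim] True by (simp add: g_def)
          \<comment> \<open>If \<eta> is the boundary value at all, the zero residue of
            \<open>g\<close> forces the diagonal kernel to infinity.\<close>
          have "cond_C1 \<Omega> \<phi> k \<or> cond_C2 \<Omega> \<phi> k"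
            using nevanlinna_kernel_at_infinity[OF f, of \<eta> "x k"] inf nowhere
            by (auto simp: cond_C1_def cond_C2_def Fin \<eta>_def)
          then have "node_cond \<Omega> \<phi> k" using False by (auto simp: node_cond_def)
          then show ?thesis
            using result[OF ev, of "1 + q k k * 0" 0] bl[OF 1 2] by simp
        next
          case \<mu>0: False
          have "((\<lambda>z. - 1 / ((z - ?x) * g z)) \<longlongrightarrow> - 1 / (- of_real \<mu>)) ?F"
            by (intro tendsto_intros lim) (use \<mu>0 in simp)
          moreover have "- 1 / ((z - ?x) * g z) = (f z - of_real \<eta>) / (z - ?x)" for z
            unfolding g_def by (simp, metis minus_diff_eq minus_divide_left)
          ultimately have "((\<lambda>z. (f z - of_real \<eta>) / (z - ?x)) \<longlongrightarrow> of_real (1 / \<mu>)) ?F"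
            by simp
          then show ?thesis using \<mu> by (intro finite_case[of "1 / \<mu>"]) auto
        qed
      qed
    qed
  next
    case True
    have c: "c k \<noteq> 0" by (rule c_e_not_both_zero[OF k True])
    have lin: "lin k z = - ?c * par_den \<phi> z" for z by (simp add: lin_def True)
    define M where "M = (\<lambda>z. par_num \<phi> z / ?c)"
    have a: "par_num \<phi> z = of_real 0 * lin k z + of_real (c k) * M z" for z
      using c by (simp add: M_def)
    have b: "par_den \<phi> z = of_real (- 1 / c k) * lin k z + of_real (e k) * M z" for z
      using c by (simp add: lin True)
    note bl = boundary_limits[OF k a b]
    show ?thesis
    proof (cases \<phi>)
      case Infty
      \<comment> \<open>Here infinity is the critical value itself and the defect is zero:
        \<open>D1 = 0\<close>, so the sign of \<open>q k k\<close> alone decides.\<close>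
      have ev: "eventually (\<lambda>z. M z \<noteq> 0) ?F" using c by (simp add: M_def Infty)
      have 1: "((\<lambda>z. lin k z / ((z - ?x) * M z)) \<longlongrightarrow> of_real 0) ?F" unfolding lin by (simp add: Infty)
      have 2: "((\<lambda>z. M z / M z) \<longlongrightarrow> of_real 1) ?F" using c by (simp add: M_def Infty)
      have "bd_neg_recip_residue Infty (x k) t \<longleftrightarrow> t = 0" for t
        by (auto simp: bd_neg_recip_residue_def)
      then have "node_cond \<Omega> \<phi> k \<longleftrightarrow> q k k > 0"
        using c by (simp add: node_cond_def cond_Ct1_def cond_Ct2_def cond_Ct3_def Infty True p_til_def zero_less_divide_iff)
      then show ?thesis
        using result[OF ev, of "0 + q k k * 1" 1] bl[OF 1 2] by simp
    next
      case (Fin f)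
      have f: "nevanlinna f" using \<phi> nev_class_0D(2)[of f] by (auto simp: Fin nev0_ext_def)
      have lin': "lin k z = - ?c" for z unfolding lin by (simp add: Fin)
      have M: "M z = f z / ?c" for z by (simp add: M_def Fin)
      obtain \<mu> where \<mu>: "\<mu> \<ge> 0" and lim: "((\<lambda>z. (z - ?x) * f z) \<longlongrightarrow> - of_real \<mu>) ?F"
        using nevanlinna_nontangential_residue[OF f] by blast
      show ?thesis
      proof (cases "\<mu> = 0")
        case \<mu>0: True
        define \<psi> where "\<psi> = (\<lambda>z. lin k z / (z - ?x))"
        have ev: "eventually (\<lambda>z. \<psi> z \<noteq> 0) ?F"
          using eventually_nontangential_ne
          by eventually_elim (use c in \<open>auto simp: \<psi>_def lin'\<close>)
        have 1: "((\<lambda>z. lin k z / ((z - ?x) * \<psi> z)) \<longlongrightarrow> of_real 1) ?F"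
          by (rule tendsto_eventually_eq[OF tendsto_const])
            (use ev in \<open>eventually_elim, auto simp: \<psi>_def\<close>)
        have "((\<lambda>z. - (1 / ?c\<^sup>2) * ((z - ?x) * f z)) \<longlongrightarrow> - (1 / ?c\<^sup>2) * 0) ?F"
          using lim \<mu>0 by (intro tendsto_intros) simp
        then have 2: "((\<lambda>z. M z / \<psi> z) \<longlongrightarrow> of_real 0) ?F"
          by (simp add: \<psi>_def M lin' power2_eq_square mult_ac)
        \<comment> \<open>Depending on whether \<open>f\<close> tends to infinity, this is
          \<open>cond_Ct2\<close> or \<open>cond_Ct1\<close>.\<close>
        have "node_cond \<Omega> \<phi> k"
          using lim True by (auto simp: node_cond_def cond_Ct1_def cond_Ct2_def Fin \<mu>0)
        then show ?thesis
          using result[OF ev, of "1 + q k k * 0" 0] bl[OF 1 2] by simp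
      next
        case \<mu>0: False
        then have \<mu>_pos: "\<mu> > 0" using \<mu> by simp
        have "eventually (\<lambda>z. (z - ?x) * f z \<noteq> 0) ?F"
          by (rule tendsto_imp_eventually_ne[OF lim]) (use \<mu>0 in simp)
        then have ev: "eventually (\<lambda>z. M z \<noteq> 0) ?F"
          by eventually_elim (use c in \<open>simp add: M\<close>)
        have "((\<lambda>z. - ?c\<^sup>2 / ((z - ?x) * f z)) \<longlongrightarrow> - ?c\<^sup>2 / (- of_real \<mu>)) ?F"
          by (intro tendsto_intros lim) (use \<mu>0 in simp)
        then have 1: "((\<lambda>z. lin k z / ((z - ?x) * M z)) \<longlongrightarrow> of_real ((c k)\<^sup>2 / \<mu>)) ?F"
          by (simp add: lin' M power2_eq_square)
        have 2: "((\<lambda>z. M z / M z) \<longlongrightarrow> of_real 1) ?F"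
          by (rule tendsto_eventually_eq[OF tendsto_const]) (use ev in \<open>eventually_elim, simp\<close>)
        have "node_cond \<Omega> \<phi> k \<longleftrightarrow> (c k)\<^sup>2 / \<mu> + q k k > 0"
          by (rule node_cond_iff_singular_coordinate[OF Fin k True lim \<mu>_pos])
        then show ?thesis
          using result[OF ev, of "(c k)\<^sup>2 / \<mu> + q k k * 1" 1] bl[OF 1 2] by simp
      qed
    qed
  qed
qed

section \<open>Boundary data of \<open>w\<close> at the nodes\<close>

lemma PY_regular:
  assumes "k < num_reg \<Omega>" "0 < Im z" "Den z \<noteq> 0"
  shows "quot k z = PY k z / Den z"
proof -
  have k: "k < n" using assms(1) \<Omega> by (simp add: interp_data_set_def)
  have "(z - of_real (x k)) * PY k z = Num z - of_real (wval \<Omega> k) * Den z"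
    using PY_eq[OF k assms(2)] k assms(1) by (simp add: C_row_index E_row_index)
  then have "w z - of_real (wval \<Omega> k) = (z - of_real (x k)) * PY k z / Den z"
    using w_analytic(2)[OF assms(2,3)] assms(3) by (simp add: diff_divide_distrib)
  then show ?thesis using ne_node[OF assms(2), of k] by simp
qed

lemma PY_singular:
  assumes "num_reg \<Omega> \<le> k" "k < n" "0 < Im z"
  shows "(z - of_real (x k)) * PY k z = - of_real (\<xi> k) * Den z"
  using PY_eq[OF assms(2,3)] assms by (simp add: C_row_index E_row_index)

text \<open>The difference quotient is \<open>PY k / Den\<close>. After division by \<psi> both
  parts have limits, and as \<open>S > 0\<close> the quotient tends to
  \<open>\<gamma> k - D2 / S\<close>.\<close>

lemma regular_node_limit:
  assumes k: "k < num_reg \<Omega>" and cond: "node_cond \<Omega> \<phi> k"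
  obtains d where "d \<le> \<gamma> k"
    "((\<lambda>z. quot k z) \<longlongrightarrow> of_real d) (nt k)"
proof -
  let ?F = "nt k"
  have k': "k < n" using k \<Omega> by (simp add: interp_data_set_def)
  obtain \<psi> S D2 where ev: "eventually (\<lambda>z. \<psi> z \<noteq> 0) ?F"
    and Den: "((\<lambda>z. Den z / \<psi> z) \<longlongrightarrow> of_real (E k * S)) ?F"
    and PY: "((\<lambda>z. PY k z / \<psi> z) \<longlongrightarrow> of_real (p k k * S - D2)) ?F"
    and D2: "D2 \<ge> 0" and S: "node_cond \<Omega> \<phi> k \<longleftrightarrow> S > 0"
    by (rule node_alternative[OF k']) (rule that; assumption)
  have E: "E k = 1" and p: "p k k = \<gamma> k"
    using k k' by (simp_all add: E_row_index pick_mat_def)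
  have S0: "S > 0" using S cond by simp
  have "((\<lambda>z. (PY k z / \<psi> z) / (Den z / \<psi> z)) \<longlongrightarrow> of_real (\<gamma> k * S - D2) / of_real S) ?F"
    using tendsto_divide[OF PY Den] S0 by (simp add: E p)
  moreover have "eventually (\<lambda>z. (PY k z / \<psi> z) / (Den z / \<psi> z) =
      quot k z) ?F"
    using ev eventually_Den_nonzero by eventually_elim (simp add: PY_regular[OF k])
  ultimately have lim: "((\<lambda>z. quot k z) \<longlongrightarrow>
      of_real ((\<gamma> k * S - D2) / S)) ?F"
    by (simp add: tendsto_eventually_eq)
  have "(\<gamma> k * S - D2) / S \<le> \<gamma> k"
    using S0 D2 by (simp add: divide_le_eq)
  then show ?thesis using that lim by blast
qed

text \<open>Here \<open>Den / \<psi>\<close> tends to zero, but \<open>PY_singular\<close> turns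
  \<open>- 1 / ((z - x\<^sub>k) * w)\<close> into \<open>PY k / (\<xi> k * Num)\<close>, and
  \<open>Num / \<psi>\<close> has a nonzero limit. The result is
  \<open>- 1 / \<xi>\<^sub>k - D2 / (\<xi>\<^sub>k\<^sup>2 * S)\<close>.\<close>

lemma singular_node_limit:
  assumes k: "num_reg \<Omega> \<le> k" "k < n" and cond: "node_cond \<Omega> \<phi> k"
  obtains t where "t \<le> - 1 / \<xi> k"
    "((\<lambda>z. - 1 / ((z - of_real (x k)) * w z)) \<longlongrightarrow> of_real t) (nt k)"
    "eventually (\<lambda>z. w z \<noteq> 0) (nt k)"
proof -
  let ?F = "nt k" and ?\<xi> = "\<xi> k"
  obtain \<psi> S D2 where ev: "eventually (\<lambda>z. \<psi> z \<noteq> 0) ?F"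
    and Num: "((\<lambda>z. Num z / \<psi> z) \<longlongrightarrow> of_real (C k * S)) ?F"
    and PY: "((\<lambda>z. PY k z / \<psi> z) \<longlongrightarrow> of_real (p k k * S - D2)) ?F"
    and D2: "D2 \<ge> 0" and S: "node_cond \<Omega> \<phi> k \<longleftrightarrow> S > 0"
    by (rule node_alternative[OF k(2)]) (rule that; assumption)
  have C: "C k = ?\<xi>" and p: "p k k = - ?\<xi>" and \<xi>: "?\<xi> \<noteq> 0"
    using k \<Omega> by (simp_all add: C_row_index pick_mat_def interp_data_set_def)
  have S0: "S > 0" using S cond by simp
  have Num0: "eventually (\<lambda>z. Num z / \<psi> z \<noteq> 0) ?F"
    by (rule tendsto_imp_eventually_ne[OF Num]) (use S0 \<xi> C in simp)
  have "((\<lambda>z. (PY k z / \<psi> z) / (of_real ?\<xi> * (Num z / \<psi> z))) \<longlongrightarrow>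
      of_real (- ?\<xi> * S - D2) / (of_real ?\<xi> * of_real (?\<xi> * S))) ?F"
    using PY Num S0 \<xi> by (intro tendsto_divide tendsto_mult tendsto_const) (simp_all add: C p)
  moreover have "eventually (\<lambda>z. (PY k z / \<psi> z) / (of_real ?\<xi> * (Num z / \<psi> z)) =
      - 1 / ((z - of_real (x k)) * w z)) ?F"
    using ev eventually_Den_nonzero Num0
  proof eventually_elim
    case (elim z)
    have ne: "z - of_real (x k) \<noteq> 0" using elim by auto
    have "PY k z * (z - of_real (x k)) = - of_real ?\<xi> * Den z"
      using PY_singular[OF k, of z] elim by (simp add: mult.commute)
    then have PY: "PY k z = - of_real ?\<xi> * Den z / (z - of_real (x k))"
      by (simp only: nonzero_eq_divide_eq[OF ne])
    show ?case
      using elim ne \<xi> by (simp add: PY w_analytic(2))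
  qed
  ultimately have lim: "((\<lambda>z. - 1 / ((z - of_real (x k)) * w z)) \<longlongrightarrow>
      of_real (- ?\<xi> * S - D2) / (of_real ?\<xi> * of_real (?\<xi> * S))) ?F"
    by (rule tendsto_eventually_eq)
  have "(- ?\<xi> * S - D2) / (?\<xi> * (?\<xi> * S)) = - 1 / ?\<xi> - D2 / (?\<xi>\<^sup>2 * S)"
    using S0 \<xi> by (simp add: field_simps power2_eq_square)
  also have "\<dots> \<le> - 1 / ?\<xi>"
    using S0 D2 by simp
  finally have "(- ?\<xi> * S - D2) / (?\<xi> * (?\<xi> * S)) \<le> - 1 / ?\<xi>" .
  moreover have "eventually (\<lambda>z. w z \<noteq> 0) ?F"
    using eventually_Den_nonzero Num0 by eventually_elim (simp add: w_analytic(2))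
  ultimately show ?thesis
    using that[of "(- ?\<xi> * S - D2) / (?\<xi> * (?\<xi> * S))"] lim by simp
qed

text \<open>Comparing the limits of \<open>quot k * (Den / \<psi>)\<close> and
  \<open>PY k / \<psi>\<close> gives \<open>(\<gamma> k - d) * S = D2\<close>. If
  \<open>S \<le> 0\<close>, the left side would be at most zero while \<open>D2 = 1\<close>.\<close>

lemma node_cond_if_regular_solution:
  assumes k: "k < num_reg \<Omega>" and d: "d \<le> \<gamma> k"
    and val: "(w \<longlongrightarrow> of_real (wval \<Omega> k)) (nt k)"
    and der: "(deriv w \<longlongrightarrow> of_real d) (nt k)"
  shows "node_cond \<Omega> \<phi> k"
proof -
  let ?F = "nt k"
  have k': "k < n" using k \<Omega> by (simp add: interp_data_set_def)
  obtain r where r: "r > 0" "w holomorphic_on {z. 0 < Im z} \<inter> ball (complex_of_real (x k)) r"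
    by (rule w_holomorphic_near)
  have quot: "((\<lambda>z. quot k z) \<longlongrightarrow> of_real d) ?F"
    by (rule nontangential_deriv_imp_quotient[OF r(2,1) val der])
  obtain \<psi> S D2 where ev: "eventually (\<lambda>z. \<psi> z \<noteq> 0) ?F"
    and Den: "((\<lambda>z. Den z / \<psi> z) \<longlongrightarrow> of_real (E k * S)) ?F"
    and PY: "((\<lambda>z. PY k z / \<psi> z) \<longlongrightarrow> of_real (p k k * S - D2)) ?F"
    and D2: "S \<le> 0 \<Longrightarrow> D2 = 1" and S: "node_cond \<Omega> \<phi> k \<longleftrightarrow> S > 0"
    by (rule node_alternative[OF k']) (rule that; assumption)
  have E: "E k = 1" and p: "p k k = \<gamma> k"
    using k k' by (simp_all add: E_row_index pick_mat_def)
  have "((\<lambda>z. quot k z * (Den z / \<psi> z)) \<longlongrightarrow> of_real d * of_real S) ?F"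
    using tendsto_mult[OF quot Den] by (simp add: E)
  moreover have "eventually (\<lambda>z. quot k z * (Den z / \<psi> z) = PY k z / \<psi> z) ?F"
    using ev eventually_Den_nonzero by eventually_elim (simp add: PY_regular[OF k])
  ultimately have "((\<lambda>z. PY k z / \<psi> z) \<longlongrightarrow> of_real d * of_real S) ?F"
    by (rule tendsto_eventually_eq)
  from tendsto_unique[OF nontangential_nontriv PY this]
  have "complex_of_real (\<gamma> k * S - D2) = of_real (d * S)" by (simp add: p)
  then have eq: "\<gamma> k * S - D2 = d * S" by (simp only: of_real_eq_iff)
  have "S > 0"
  proof (rule ccontr)
    assume "\<not> S > 0"
    then have "D2 = 1" "(\<gamma> k - d) * S \<le> 0" using D2 d by (auto simp: mult_nonneg_nonpos)
    with eq show False by (simp add: algebra_simps)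
  qed
  then show ?thesis using S by simp
qed

text \<open>The same comparison in product form yields
  \<open>\<xi>\<^sup>2 * S * (- 1 / \<xi> - t) = D2\<close>, so \<open>S \<le> 0\<close> again
  contradicts \<open>D2 = 1\<close>.\<close>

lemma node_cond_if_singular_solution:
  assumes k: "num_reg \<Omega> \<le> k" "k < n" and t: "t \<le> - 1 / \<xi> k"
    and res: "bd_neg_recip_residue (Fin w) (x k) t"
  shows "node_cond \<Omega> \<phi> k"
proof -
  let ?F = "nt k" and ?\<xi> = "\<xi> k"
  obtain L where L: "bd_residue (Fin w) (x k) L" "neg_recip L = Fin (of_real t)"
    using res by (auto simp: bd_neg_recip_residue_def)
  have lim: "((\<lambda>z. - 1 / ((z - of_real (x k)) * w z)) \<longlongrightarrow> of_real t) ?F"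
    and ev_w: "eventually (\<lambda>z. (z - of_real (x k)) * w z \<noteq> 0) ?F"
  proof -
    show "((\<lambda>z. - 1 / ((z - of_real (x k)) * w z)) \<longlongrightarrow> of_real t) ?F"
    proof (cases L)
      case (Fin l)
      \<comment> \<open>A residue zero is excluded because its \<open>neg_recip\<close> is
        \<open>Infty\<close>.\<close>
      then have l: "l \<noteq> 0" "- 1 / l = of_real t" using L(2) by (auto split: if_splits)
      have "((\<lambda>z. - 1 / ((z - of_real (x k)) * w z)) \<longlongrightarrow> - 1 / l) ?F"
        using L(1) Fin l(1) by (intro tendsto_divide tendsto_const) auto
      then show ?thesis by (simp only: l)
    next
      case Infty
      then have "((\<lambda>z. inverse ((z - of_real (x k)) * w z)) \<longlongrightarrow> 0) ?F"
        using L(1) by (intro filterlim_compose[OF tendsto_inverse_0]) simp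
      from tendsto_minus[OF this] show ?thesis
        using L(2) Infty by (simp add: divide_inverse)
    qed
    show "eventually (\<lambda>z. (z - of_real (x k)) * w z \<noteq> 0) ?F"
    proof (cases L)
      case (Fin l)
      then have "l \<noteq> 0" using L(2) by (auto split: if_splits)
      then show ?thesis using L(1) Fin by (intro tendsto_imp_eventually_ne[of _ l]) auto
    next
      case Infty
      show ?thesis
        by (rule filterlim_at_infinity_imp_eventually_ne) (use L(1) Infty in simp)
    qed
  qed
  obtain \<psi> S D2 where ev: "eventually (\<lambda>z. \<psi> z \<noteq> 0) ?F"
    and Num: "((\<lambda>z. Num z / \<psi> z) \<longlongrightarrow> of_real (C k * S)) ?F"
    and PY: "((\<lambda>z. PY k z / \<psi> z) \<longlongrightarrow> of_real (p k k * S - D2)) ?F"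
    and D2: "S \<le> 0 \<Longrightarrow> D2 = 1" and S: "node_cond \<Omega> \<phi> k \<longleftrightarrow> S > 0"
    by (rule node_alternative[OF k(2)]) (rule that; assumption)
  have C: "C k = ?\<xi>" and p: "p k k = - ?\<xi>" and \<xi>: "?\<xi> \<noteq> 0"
    using k \<Omega> by (simp_all add: C_row_index pick_mat_def interp_data_set_def)
  have "((\<lambda>z. of_real ?\<xi> * (- 1 / ((z - of_real (x k)) * w z)) * (Num z / \<psi> z)) \<longlongrightarrow>
      of_real ?\<xi> * of_real t * of_real (?\<xi> * S)) ?F"
    using Num by (intro tendsto_mult tendsto_const lim) (simp add: C)
  moreover have "eventually (\<lambda>z. of_real ?\<xi> * (- 1 / ((z - of_real (x k)) * w z)) * (Num z / \<psi> z) = PY k z / \<psi> z) ?F"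
    using ev eventually_Den_nonzero ev_w
  proof eventually_elim
    case (elim z)
    have ne: "z - of_real (x k) \<noteq> 0" using elim by auto
    have "PY k z * (z - of_real (x k)) = - of_real ?\<xi> * Den z"
      using PY_singular[OF k, of z] elim by (simp add: mult.commute)
    then have PY: "PY k z = - of_real ?\<xi> * Den z / (z - of_real (x k))"
      by (simp only: nonzero_eq_divide_eq[OF ne])
    have "Num z \<noteq> 0" using elim w_analytic(2)[of z] by auto
    then show ?case
      using elim ne by (simp add: PY w_analytic(2))
  qed
  ultimately have "((\<lambda>z. PY k z / \<psi> z) \<longlongrightarrow> of_real ?\<xi> * of_real t * of_real (?\<xi> * S)) ?F"
    by (rule tendsto_eventually_eq)
  from tendsto_unique[OF nontangential_nontriv PY this]
  have "complex_of_real (- ?\<xi> * S - D2) = of_real (?\<xi> * t * (?\<xi> * S))" by (simp add: p)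
  then have eq: "- ?\<xi> * S - D2 = ?\<xi> * t * (?\<xi> * S)" by (simp only: of_real_eq_iff)
  have "S > 0"
  proof (rule ccontr)
    assume "\<not> S > 0"
    then have "D2 = 1" "S \<le> 0" using D2 by auto
    have "?\<xi>\<^sup>2 * S \<le> 0" using \<open>S \<le> 0\<close> by (simp add: mult_nonneg_nonpos)
    then have "?\<xi>\<^sup>2 * S * (- 1 / ?\<xi> - t) \<le> 0"
      by (rule mult_nonpos_nonneg) (use t in simp)
    moreover have "?\<xi>\<^sup>2 * S * (- 1 / ?\<xi> - t) = - ?\<xi> * S - ?\<xi> * t * (?\<xi> * S)"
      using \<xi> by (simp add: power2_eq_square right_diff_distrib) 
    ultimately show False using eq \<open>D2 = 1\<close> by simp
  qed
  then show ?thesis using S by simp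
qed

end


section \<open>Counting negative squares\<close>

text \<open>Bound each product \<open>|c s| |c t|\<close> by the sum of the two squares; every index
  is then counted \<open>2 * k\<close> times.\<close>

lemma form_perturbation:
  fixes c :: "nat \<Rightarrow> complex" and D :: "nat \<Rightarrow> nat \<Rightarrow> complex"
  assumes D: "\<And>s t. s < k \<Longrightarrow> t < k \<Longrightarrow> cmod (D s t) \<le> \<epsilon>" and "0 \<le> \<epsilon>"
  shows "Re (\<Sum>s<k. \<Sum>t<k. cnj (c s) * D s t * c t) \<le> 2 * real k * \<epsilon> * (\<Sum>s<k. (cmod (c s))\<^sup>2)"
proof -
  have "Re (\<Sum>s<k. \<Sum>t<k. cnj (c s) * D s t * c t) \<le> (\<Sum>s<k. \<Sum>t<k. cmod (cnj (c s) * D s t * c t))"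
    unfolding Re_sum by (intro sum_mono complex_Re_le_cmod)
  also have "\<dots> \<le> (\<Sum>s<k. \<Sum>t<k. \<epsilon> * ((cmod (c s))\<^sup>2 + (cmod (c t))\<^sup>2))"
  proof (intro sum_mono)
    fix s t assume "s \<in> {..<k}" "t \<in> {..<k}"
    then have "cmod (D s t) * (cmod (c s) * cmod (c t)) \<le> \<epsilon> * (cmod (c s) * cmod (c t))"
      using D by (intro mult_right_mono) auto
    moreover have "cmod (c s) * cmod (c t) \<le> (cmod (c s))\<^sup>2 + (cmod (c t))\<^sup>2"
      using sum_squares_bound[of "cmod (c s)" "cmod (c t)"] norm_ge_zero[of "c s"] norm_ge_zero[of "c t"]
        mult_nonneg_nonneg[of "cmod (c s)" "cmod (c t)"] by linarith
    then have "\<epsilon> * (cmod (c s) * cmod (c t)) \<le> \<epsilon> * ((cmod (c s))\<^sup>2 + (cmod (c t))\<^sup>2)"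
      by (rule mult_left_mono[OF _ \<open>0 \<le> \<epsilon>\<close>])
    ultimately have "cmod (D s t) * (cmod (c s) * cmod (c t)) \<le> \<epsilon> * ((cmod (c s))\<^sup>2 + (cmod (c t))\<^sup>2)"
      by (rule order_trans)
    then show "cmod (cnj (c s) * D s t * c t) \<le> \<epsilon> * ((cmod (c s))\<^sup>2 + (cmod (c t))\<^sup>2)"
      by (simp add: norm_mult mult_ac)
  qed
  also have "\<dots> = 2 * real k * \<epsilon> * (\<Sum>s<k. (cmod (c s))\<^sup>2)"
    by (simp add: sum.distrib sum_distrib_left[symmetric] algebra_simps)
  finally show ?thesis .
qed

lemma sum_squares_pos:
  fixes c :: "nat \<Rightarrow> complex"
  assumes "\<exists>s<k. c s \<noteq> 0"
  shows "0 < (\<Sum>s<k. (cmod (c s))\<^sup>2)"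
proof -
  obtain s where "s < k" "c s \<noteq> 0" using assms by blast
  then show ?thesis by (intro sum_pos2[of _ s]) auto
qed

lemma hform_combination:
  "hform A n (\<lambda>i. \<Sum>s<k. V i s * c s) =
    (\<Sum>s<k. \<Sum>t<k. cnj (c s) * (\<Sum>i<n. \<Sum>j<n. cnj (V i s) * A $$ (i, j) * V j t) * c t)"
proof -
  have "hform A n (\<lambda>i. \<Sum>s<k. V i s * c s) =
      (\<Sum>i<n. \<Sum>j<n. \<Sum>s<k. \<Sum>t<k. cnj (c s) * (cnj (V i s) * A $$ (i, j) * V j t) * c t)"
    unfolding hform_def cnj_sum complex_cnj_mult
    by (simp only: sum_distrib_right) (simp only: sum_distrib_left mult_ac)
  also have "\<dots> = (\<Sum>i<n. \<Sum>s<k. \<Sum>j<n. \<Sum>t<k. cnj (c s) * (cnj (V i s) * A $$ (i, j) * V j t) * c t)"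
    by (intro sum.cong refl) (rule sum.swap)
  also have "\<dots> = (\<Sum>s<k. \<Sum>i<n. \<Sum>j<n. \<Sum>t<k. cnj (c s) * (cnj (V i s) * A $$ (i, j) * V j t) * c t)"
    by (rule sum.swap)
  also have "\<dots> = (\<Sum>s<k. \<Sum>i<n. \<Sum>t<k. \<Sum>j<n. cnj (c s) * (cnj (V i s) * A $$ (i, j) * V j t) * c t)"
    by (intro sum.cong refl) (rule sum.swap)
  also have "\<dots> = (\<Sum>s<k. \<Sum>t<k. \<Sum>i<n. \<Sum>j<n. cnj (c s) * (cnj (V i s) * A $$ (i, j) * V j t) * c t)"
    by (intro sum.cong refl) (rule sum.swap)
  also have "\<dots> = (\<Sum>s<k. \<Sum>t<k. cnj (c s) * (\<Sum>i<n. \<Sum>j<n. cnj (V i s) * A $$ (i, j) * V j t) * c t)"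
    by (simp only: sum_distrib_left sum_distrib_right)
  finally show ?thesis .
qed

text \<open>On the negative subspace of \<open>A\<close>, subtracting a nonnegative diagonal only
  lowers the form, and the margin \<delta> absorbs the remaining error. The conclusion keeps the
  directions \<open>V\<close> themselves, since they are later multiplied by weights to reach the
  kernel matrix.\<close>

lemma sq_neg_limit:
  fixes A :: "complex mat" and B :: "'t \<Rightarrow> complex mat" and h :: "nat \<Rightarrow> real"
  assumes A: "A \<in> carrier_mat n n" "\<And>i j. i < n \<Longrightarrow> j < n \<Longrightarrow> A $$ (i, j) = cnj (A $$ (j, i))"
    and B: "\<And>t. B t \<in> carrier_mat n n" "\<And>t i j. i < n \<Longrightarrow> j < n \<Longrightarrow> B t $$ (i, j) = cnj (B t $$ (j, i))"
    and h: "\<And>i. i < n \<Longrightarrow> 0 \<le> h i"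
    and lim: "\<And>i j. i < n \<Longrightarrow> j < n \<Longrightarrow>
      ((\<lambda>t. B t $$ (i, j)) \<longlongrightarrow> A $$ (i, j) - (if i = j then of_real (h i) else 0)) F"
  shows "eventually (\<lambda>t. \<exists>V. \<forall>c. (\<exists>s<sq_neg A. c s \<noteq> 0) \<longrightarrow>
    Re (hform (B t) n (\<lambda>i. \<Sum>s<sq_neg A. V i s * c s)) < 0) F"
proof -
  let ?k = "sq_neg A"
  obtain V \<delta> where \<delta>: "\<delta> > 0"
    and V: "\<And>c. Re (hform A n (\<lambda>i. \<Sum>s<?k. V i s * c s)) \<le> - \<delta> * (\<Sum>s<?k. (cmod (c s))\<^sup>2)"
    by (rule negative_subspace[OF A]) (assumption | rule that)+
  define L where "L = Matrix.mat n n (\<lambda>(i, j). A $$ (i, j) - (if i = j then of_real (h i) else 0))"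
  define G where "G = (\<lambda>(M :: complex mat) s t. \<Sum>i<n. \<Sum>j<n. cnj (V i s) * M $$ (i, j) * V j t)"
  \<comment> \<open>\<open>form_perturbation\<close> costs the factor \<open>2 * sq_neg A\<close>;
    the extra one in the denominator keeps the total below \<delta>.\<close>
  define \<epsilon> where "\<epsilon> = \<delta> / (2 * real ?k + 1)"
  have \<epsilon>: "\<epsilon> > 0" "2 * real ?k * \<epsilon> < \<delta>"
    using \<delta> by (auto simp: \<epsilon>_def field_simps)
  have BL: "((\<lambda>u. B u $$ (i, j)) \<longlongrightarrow> L $$ (i, j)) F" if "i < n" "j < n" for i j
    using lim[OF that] that by (simp add: L_def)
  have Glim: "((\<lambda>u. G (B u) s t) \<longlongrightarrow> G L s t) F" for s t
    unfolding G_def by (intro tendsto_intros) (auto intro: BL)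
  have "eventually (\<lambda>u. \<forall>s\<in>{..<?k}. \<forall>t\<in>{..<?k}. cmod (G (B u) s t - G L s t) < \<epsilon>) F"
  proof (intro eventually_ball_finite ballI finite_lessThan)
    fix s t
    show "eventually (\<lambda>u. cmod (G (B u) s t - G L s t) < \<epsilon>) F"
      using tendstoD[OF Glim \<epsilon>(1)] by (simp add: dist_norm)
  qed
  then show ?thesis
  proof eventually_elim
    case (elim u)
    have "Re (hform (B u) n (\<lambda>i. \<Sum>s<?k. V i s * c s)) < 0" if c: "\<exists>s<?k. c s \<noteq> 0" for c
    proof -
      let ?f = "\<lambda>i. \<Sum>s<?k. V i s * c s" and ?c2 = "\<Sum>s<?k. (cmod (c s))\<^sup>2"
      have c2: "?c2 > 0"
        using c by (rule sum_squares_pos)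
      have "hform L n ?f = hform A n ?f - (\<Sum>i<n. of_real (h i * (cmod (?f i))\<^sup>2))"
      proof -
        have "(\<Sum>j<n. cnj (?f i) * L $$ (i, j) * ?f j) =
            (\<Sum>j<n. cnj (?f i) * A $$ (i, j) * ?f j) - of_real (h i * (cmod (?f i))\<^sup>2)" if i: "i < n" for i
        proof -
          have "(\<Sum>j<n. cnj (?f i) * L $$ (i, j) * ?f j) =
              (\<Sum>j<n. cnj (?f i) * A $$ (i, j) * ?f j - (if j = i then of_real (h i) * (cnj (?f i) * ?f i) else 0))"
            using i by (intro sum.cong refl) (auto simp: L_def algebra_simps)
          also have "\<dots> = (\<Sum>j<n. cnj (?f i) * A $$ (i, j) * ?f j) - of_real (h i) * (cnj (?f i) * ?f i)"
            using i by (simp add: sum_subtractf)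
          also have "cnj (?f i) * ?f i = of_real ((cmod (?f i))\<^sup>2)"
            by (simp only: complex_norm_square mult.commute)
          finally show ?thesis by (simp only: of_real_mult)
        qed
        then show ?thesis unfolding hform_def by (simp add: sum_subtractf)
      qed
      then have "Re (hform L n ?f) = Re (hform A n ?f) - (\<Sum>i<n. h i * (cmod (?f i))\<^sup>2)"
        by (simp only: of_real_sum[symmetric] minus_complex.sel Re_complex_of_real)
      also have "\<dots> \<le> Re (hform A n ?f)"
        using sum_nonneg[of "{..<n}" "\<lambda>i. h i * (cmod (?f i))\<^sup>2"] h by simp
      also have "\<dots> \<le> - \<delta> * ?c2" by (rule V)
      finally have 1: "Re (hform L n ?f) \<le> - \<delta> * ?c2" .
      have "hform (B u) n ?f - hform L n ?f = (\<Sum>s<?k. \<Sum>t<?k. cnj (c s) * (G (B u) s t - G L s t) * c t)"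
        unfolding hform_combination G_def[symmetric] sum_subtractf[symmetric]
        by (intro sum.cong refl) (simp add: G_def algebra_simps)
      then have "Re (hform (B u) n ?f) - Re (hform L n ?f) \<le> 2 * real ?k * \<epsilon> * ?c2"
        using form_perturbation[of ?k "\<lambda>s t. G (B u) s t - G L s t" \<epsilon> c] elim \<epsilon>
        by (metis less_eq_real_def lessThan_iff minus_complex.sel(1))
      with 1 have "Re (hform (B u) n ?f) \<le> (2 * real ?k * \<epsilon> - \<delta>) * ?c2"
        by (simp add: algebra_simps)
      also have "\<dots> < 0" using c2 \<epsilon> by (intro mult_neg_pos) auto
      finally show ?thesis .
    qed
    then show ?case by (intro exI[of _ V]) blast
  qed
qed

section \<open>Negative squares of the transform and the final equivalence\<close>

context bip
begin

abbreviation Pc :: "complex mat" where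
  "Pc \<equiv> map_mat complex_of_real (pick_mat \<Omega>)"

lemma Pc_carrier: "Pc \<in> carrier_mat (n) (n)"
  using pick_mat_carrier[of \<Omega>] by simp

lemma Pc_index: "i < n \<Longrightarrow> j < n \<Longrightarrow> Pc $$ (i, j) = of_real (p i j)"
  using pick_mat_carrier[of \<Omega>] by simp

lemma Pc_hermitian:
  assumes "i < n" "j < n"
  shows "Pc $$ (i, j) = cnj (Pc $$ (j, i))"
  using assms by (simp only: Pc_index p_sym[OF assms] complex_cnj_complex_of_real)

text \<open>Dividing the coefficients by \<open>Den\<close> turns the kernel form into the form of
  \<open>P\<close> at \<open>y\<close> plus the form of \<open>H\<close>. As \<open>H\<close> is
  positive, the linear map to \<open>y\<close> carries negative directions to negative directions of
  \<open>P\<close>.\<close>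

lemma sq_neg_kernel_le:
  fixes m :: nat
  assumes z: "\<And>i. i < m \<Longrightarrow> z i \<in> analyticity_domain w"
  shows "sq_neg (kernel_mat w m z) \<le> pick_kappa \<Omega>"
proof -
  let ?n = "n" and ?K = "kernel_mat w m z"
  let ?k = "sq_neg ?K"
  have z': "0 < Im (z i)" "Den (z i) \<noteq> 0" if "i < m" for i
    using z[OF that] by (auto simp: analyticity_domain_w)
  obtain V \<delta> where \<delta>: "\<delta> > 0"
    and V: "\<And>c. Re (hform ?K m (\<lambda>i. \<Sum>s<?k. V i s * c s)) \<le> - \<delta> * (\<Sum>s<?k. (cmod (c s))\<^sup>2)"
    by (rule negative_subspace[OF kernel_mat_carrier kernel_mat_hermitian]) (assumption | rule that)+
  have "?k \<le> sq_neg Pc"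
  proof (rule sq_neg_ge[OF Pc_carrier Pc_hermitian])
    fix c :: "nat \<Rightarrow> complex" assume c: "\<exists>s<?k. c s \<noteq> 0"
    define f where "f = (\<lambda>i. \<Sum>s<?k. V i s * c s)"
    define g where "g = (\<lambda>i. f i / Den (z i))"
    define y where "y = (\<lambda>k. \<Sum>i<m. Y k (z i) * g i)"
    have K: "nev_kernel w (z j) (z i) * (Den (z j) * cnj (Den (z i))) =
        (\<Sum>k<?n. cnj (Y k (z i)) * PY k (z j)) + H (z j) (z i)" if "i < m" "j < m" for i j
    proof -
      have "(w (z j) - cnj (w (z i))) * (Den (z j) * cnj (Den (z i))) =
          Num (z j) * cnj (Den (z i)) - Den (z j) * cnj (Num (z i))"
        using z'[OF that(1)] z'[OF that(2)] by (simp add: w_analytic(2) left_diff_distrib)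
      then show ?thesis
        unfolding kernel_identity[OF z'(1)[OF that(2)] z'(1)[OF that(1)], symmetric] nev_kernel_def
        by (simp only: times_divide_eq_left)
    qed
    have PYsum: "(\<Sum>j<m. PY k (z j) * g j) = (\<Sum>l<?n. of_real (p k l) * y l)" for k
      unfolding PY_def y_def sum_distrib_left sum_distrib_right
      by (subst sum.swap) (simp add: mult_ac)
    have "hform ?K m f = (\<Sum>i<m. \<Sum>j<m. cnj (g i) * (nev_kernel w (z j) (z i) * (Den (z j) * cnj (Den (z i)))) * g j)"
      unfolding hform_def
      by (intro sum.cong refl) (simp add: kernel_mat_index g_def z')
    also have "\<dots> = (\<Sum>i<m. \<Sum>j<m. (\<Sum>k<?n. cnj (Y k (z i) * g i) * (PY k (z j) * g j)) + cnj (g i) * H (z j) (z i) * g j)"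
      by (intro sum.cong refl) (simp add: K distrib_left distrib_right sum_distrib_left sum_distrib_right mult_ac)
    also have "\<dots> = (\<Sum>i<m. \<Sum>j<m. \<Sum>k<?n. cnj (Y k (z i) * g i) * (PY k (z j) * g j)) +
        (kform H m z g)"
      by (simp only: sum.distrib)
    also have "(\<Sum>i<m. \<Sum>j<m. \<Sum>k<?n. cnj (Y k (z i) * g i) * (PY k (z j) * g j)) =
        (\<Sum>i<m. \<Sum>k<?n. \<Sum>j<m. cnj (Y k (z i) * g i) * (PY k (z j) * g j))"
      by (rule sum.cong[OF refl], rule sum.swap)
    also have "\<dots> = (\<Sum>k<?n. \<Sum>i<m. \<Sum>j<m. cnj (Y k (z i) * g i) * (PY k (z j) * g j))"
      by (rule sum.swap)
    also have "\<dots> = (\<Sum>k<?n. cnj (y k) * (\<Sum>j<m. PY k (z j) * g j))"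
      by (simp only: y_def cnj_sum sum_product)
    also have "\<dots> = hform Pc ?n y"
      unfolding hform_def PYsum sum_distrib_left
      by (intro sum.cong refl) (simp only: lessThan_iff Pc_index mult.assoc)
    finally have "Re (hform ?K m f) = Re (hform Pc ?n y) + Re (kform H m z g)"
      by simp
    moreover have "0 \<le> Re (kform H m z g)"
      by (rule psd_onD[OF psd]) (use z' in auto)
    moreover have "Re (hform ?K m f) < 0"
    proof -
      have "(\<Sum>s<?k. (cmod (c s))\<^sup>2) > 0"
        using c by (rule sum_squares_pos)
      then show ?thesis
        using V[of c] \<delta> mult_pos_pos[of \<delta> "\<Sum>s<?k. (cmod (c s))\<^sup>2"] unfolding f_def by linarith
    qed
    ultimately have "Re (hform Pc ?n y) < 0" by linarith
    also have "y = (\<lambda>i. \<Sum>s<?k. (\<Sum>l<m. Y i (z l) / Den (z l) * V l s) * c s)"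
      unfolding y_def g_def f_def sum_distrib_right sum_divide_distrib sum_distrib_left
      by (subst sum.swap) (simp add: mult_ac)
    finally show "Re (hform Pc ?n (\<lambda>i. \<Sum>s<?k. (\<Sum>l<m. Y i (z l) / Den (z l) * V l s) * c s)) < 0" .
  qed
  then show ?thesis by (simp add: pick_kappa_def)
qed

text \<open>
  The points \<open>x\<^sub>j + i t\<close> with weights \<open>\<beta>\<^sub>j\<close> (\<open>1\<close> at regular nodes, \<open>\<xi>\<^sub>j / w\<close> at singular ones)
  turn the kernel matrix into one converging to \<open>P\<close> minus a nonnegative diagonal matrix.
\<close>

lemma sq_neg_kernel_attained:
  assumes cond: "\<And>k. k < n \<Longrightarrow> node_cond \<Omega> \<phi> k"
  obtains z where "\<And>i. i < n \<Longrightarrow> z i \<in> analyticity_domain w"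
    "pick_kappa \<Omega> \<le> sq_neg (kernel_mat w (n) z)"
proof -
  let ?n = "n" and ?l = "num_reg \<Omega>" and ?F = "at_right (0::real)"
  define z where "z = (\<lambda>t j. Complex (x j) t)"
  define \<beta> where "\<beta> = (\<lambda>t j. if j < ?l then 1 else of_real (\<xi> j) / w (z t j))"
  \<comment> \<open>The pair \<open>(\<alpha>, \<beta>)\<close> represents \<open>w\<close> in
    homogeneous coordinates near node \<open>j\<close> and tends to \<open>(C j, E j)\<close>, also
    at singular nodes.\<close>
  define \<alpha> where "\<alpha> = (\<lambda>t j. w (z t j) * \<beta> t j)"
  have vert: "((\<lambda>t. f (z t j)) \<longlongrightarrow> L) ?F" if "(f \<longlongrightarrow> L) (nt j)" for f :: "complex \<Rightarrow> complex" and L j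
    unfolding z_def by (rule filterlim_compose[OF that filterlim_vertical_nontangential])
  have ev_vert: "eventually (\<lambda>t. Q (z t j)) ?F" if "eventually Q (nt j)" for Q j
    using that filterlim_vertical_nontangential unfolding z_def filterlim_iff by blast
  have t_lim: "((\<lambda>t. complex_of_real t) \<longlongrightarrow> 0) ?F"
    by (intro tendsto_eq_intros) auto
  have sub: "z t j - of_real (x j) = \<i> * of_real t" for t j
    by (simp add: z_def complex_eq_iff)
  \<comment> \<open>The third limit is that of the diagonal entries of \<open>B\<close> below;
    \<open>h\<close> is the slack in the inequality at node \<open>j\<close>, times
    \<open>\<xi>\<^sup>2\<close> if the node is singular.\<close>
  have node_data: "\<exists>h\<ge>0. ((\<lambda>t. \<alpha> t j) \<longlongrightarrow> of_real (C j)) ?F \<and> ((\<lambda>t. \<beta> t j) \<longlongrightarrow> of_real (E j)) ?F \<and>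
      ((\<lambda>t. Im (\<alpha> t j * cnj (\<beta> t j)) / t) \<longlongrightarrow> p j j - h) ?F" if j: "j < ?n" for j
  proof (cases "j < ?l")
    case True
    obtain d where d: "d \<le> \<gamma> j" and q: "((\<lambda>z. quot j z) \<longlongrightarrow> of_real d) (nt j)"
      by (rule regular_node_limit[OF True cond[OF j]])
    note q' = vert[OF q, unfolded sub]
    have "((\<lambda>t. (w (z t j) - of_real (wval \<Omega> j)) / (\<i> * of_real t) * (\<i> * of_real t) + of_real (wval \<Omega> j)) \<longlongrightarrow>
        of_real d * (\<i> * 0) + of_real (wval \<Omega> j)) ?F"
      by (intro tendsto_intros q' t_lim)
    moreover have "eventually (\<lambda>t. (w (z t j) - of_real (wval \<Omega> j)) / (\<i> * of_real t) * (\<i> * of_real t) + of_real (wval \<Omega> j) = \<alpha> t j) ?F"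
      using eventually_at_right_less[of 0] by eventually_elim (simp add: \<alpha>_def \<beta>_def True)
    ultimately have "((\<lambda>t. \<alpha> t j) \<longlongrightarrow> of_real d * (\<i> * 0) + of_real (wval \<Omega> j)) ?F"
      by (rule tendsto_eventually_eq)
    then have 1: "((\<lambda>t. \<alpha> t j) \<longlongrightarrow> of_real (C j)) ?F"
      using True j by (simp add: C_row_index)
    have 2: "((\<lambda>t. \<beta> t j) \<longlongrightarrow> of_real (E j)) ?F"
      using True j by (simp add: \<beta>_def E_row_index)
    have "((\<lambda>t. Re ((w (z t j) - of_real (wval \<Omega> j)) / (\<i> * of_real t))) \<longlongrightarrow> d) ?F"
      using tendsto_Re[OF q'] by simp
    moreover have "eventually (\<lambda>t. Re ((w (z t j) - of_real (wval \<Omega> j)) / (\<i> * of_real t)) = Im (\<alpha> t j * cnj (\<beta> t j)) / t) ?F"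
      using eventually_at_right_less[of 0]
      by eventually_elim (simp add: \<alpha>_def \<beta>_def True Re_divide power2_eq_square)
    ultimately have "((\<lambda>t. Im (\<alpha> t j * cnj (\<beta> t j)) / t) \<longlongrightarrow> d) ?F"
      using tendsto_cong by fastforce
    then show ?thesis
      using 1 2 d True j by (intro exI[of _ "\<gamma> j - d"]) (simp add: pick_mat_def)
  next
    case False
    have \<xi>: "\<xi> j \<noteq> 0" using \<Omega> False j by (simp add: interp_data_set_def)
    obtain d where d: "d \<le> - 1 / \<xi> j"
      and q: "((\<lambda>z. - 1 / ((z - of_real (x j)) * w z)) \<longlongrightarrow> of_real d) (nt j)"
      and w0: "eventually (\<lambda>z. w z \<noteq> 0) (nt j)"
      by (rule singular_node_limit[OF _ j cond[OF j]]) (use False in auto)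
    note q' = vert[OF q, unfolded sub]
    have 1: "((\<lambda>t. \<alpha> t j) \<longlongrightarrow> of_real (C j)) ?F"
    proof (rule tendsto_eventually_eq[OF tendsto_const])
      show "eventually (\<lambda>t. of_real (C j) = \<alpha> t j) ?F"
        using ev_vert[OF w0] by eventually_elim (use False j in \<open>simp add: \<alpha>_def \<beta>_def C_row_index\<close>)
    qed
    have "((\<lambda>t. - of_real (\<xi> j) * (- 1 / ((\<i> * of_real t) * w (z t j))) * (\<i> * of_real t)) \<longlongrightarrow>
        - of_real (\<xi> j) * of_real d * (\<i> * 0)) ?F"
      by (intro tendsto_intros q' t_lim)
    moreover have "eventually (\<lambda>t. - of_real (\<xi> j) * (- 1 / ((\<i> * of_real t) * w (z t j))) * (\<i> * of_real t) = \<beta> t j) ?F"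
      using eventually_at_right_less[of 0] by eventually_elim (simp add: \<beta>_def False)
    ultimately have "((\<lambda>t. \<beta> t j) \<longlongrightarrow> - of_real (\<xi> j) * of_real d * (\<i> * 0)) ?F"
      by (rule tendsto_eventually_eq)
    then have 2: "((\<lambda>t. \<beta> t j) \<longlongrightarrow> of_real (E j)) ?F"
      using False j by (simp add: E_row_index)
    have "((\<lambda>t. (\<xi> j)\<^sup>2 * Re (- 1 / ((\<i> * of_real t) * w (z t j)))) \<longlongrightarrow> (\<xi> j)\<^sup>2 * d) ?F"
      using tendsto_mult[OF tendsto_const[of "(\<xi> j)\<^sup>2"] tendsto_Re[OF q']] by simp
    moreover have "eventually (\<lambda>t. (\<xi> j)\<^sup>2 * Re (- 1 / ((\<i> * of_real t) * w (z t j))) = Im (\<alpha> t j * cnj (\<beta> t j)) / t) ?F"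
      using eventually_at_right_less[of 0] ev_vert[OF w0]
    proof eventually_elim
      case (elim t)
      define v where "v = 1 / w (z t j)"
      have \<beta>: "\<beta> t j = of_real (\<xi> j) * v" by (simp add: \<beta>_def False v_def)
      have \<alpha>: "\<alpha> t j = of_real (\<xi> j)" using elim by (simp add: \<alpha>_def \<beta>_def False)
      have "- 1 / ((\<i> * of_real t) * w (z t j)) = \<i> * v / of_real t"
        using elim by (simp add: v_def field_simps)
      then have "Re (- 1 / ((\<i> * of_real t) * w (z t j))) = - Im v / t"
        by simp
      then show ?case
        by (simp add: \<alpha> \<beta> power2_eq_square)
    qed
    ultimately have 3: "((\<lambda>t. Im (\<alpha> t j * cnj (\<beta> t j)) / t) \<longlongrightarrow> (\<xi> j)\<^sup>2 * d) ?F"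
      using tendsto_cong by fastforce
    define h where "h = - \<xi> j - (\<xi> j)\<^sup>2 * d"
    have eq: "(\<xi> j)\<^sup>2 * d = p j j - h"
      using False j by (simp add: pick_mat_def h_def)
    have "(\<xi> j)\<^sup>2 * d \<le> (\<xi> j)\<^sup>2 * (- 1 / \<xi> j)" by (intro mult_left_mono d) simp
    then have "0 \<le> h" using \<xi> by (simp add: power2_eq_square h_def)
    then show ?thesis
      using 1 2 3 unfolding eq by blast
  qed
  have "\<exists>h. \<forall>j. j < ?n \<longrightarrow> 0 \<le> h j \<and> ((\<lambda>t. \<alpha> t j) \<longlongrightarrow> of_real (C j)) ?F \<and>
      ((\<lambda>t. \<beta> t j) \<longlongrightarrow> of_real (E j)) ?F \<and>
      ((\<lambda>t. Im (\<alpha> t j * cnj (\<beta> t j)) / t) \<longlongrightarrow> p j j - h j) ?F"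
    by (intro choice allI) (use node_data in blast)
  then obtain h where "\<forall>j. j < ?n \<longrightarrow> 0 \<le> h j \<and> ((\<lambda>t. \<alpha> t j) \<longlongrightarrow> of_real (C j)) ?F \<and>
      ((\<lambda>t. \<beta> t j) \<longlongrightarrow> of_real (E j)) ?F \<and>
      ((\<lambda>t. Im (\<alpha> t j * cnj (\<beta> t j)) / t) \<longlongrightarrow> p j j - h j) ?F"
    by (elim exE)
  then have h: "\<And>j. j < ?n \<Longrightarrow> 0 \<le> h j"
    and \<alpha>_lim: "\<And>j. j < ?n \<Longrightarrow> ((\<lambda>t. \<alpha> t j) \<longlongrightarrow> of_real (C j)) ?F"
    and \<beta>_lim: "\<And>j. j < ?n \<Longrightarrow> ((\<lambda>t. \<beta> t j) \<longlongrightarrow> of_real (E j)) ?F"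
    and diag_lim: "\<And>j. j < ?n \<Longrightarrow> ((\<lambda>t. Im (\<alpha> t j * cnj (\<beta> t j)) / t) \<longlongrightarrow> p j j - h j) ?F"
    by auto
  define B where "B = (\<lambda>t. Matrix.mat ?n ?n (\<lambda>(i, j). cnj (\<beta> t i) * nev_kernel w (z t j) (z t i) * \<beta> t j))"
  have Bidx: "B t $$ (i, j) = cnj (\<beta> t i) * nev_kernel w (z t j) (z t i) * \<beta> t j" if "i < ?n" "j < ?n" for t i j
    using that by (simp add: B_def)
  \<comment> \<open>In the limit, off the diagonal, this is the displacement equation solved for
    \<open>p i j\<close>.\<close>
  have Beq: "cnj (\<beta> t i) * nev_kernel w (z t j) (z t i) * \<beta> t j =
      (\<alpha> t j * cnj (\<beta> t i) - \<beta> t j * cnj (\<alpha> t i)) / (z t j - cnj (z t i))" for t i j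
    unfolding nev_kernel_def \<alpha>_def by (simp add: diff_divide_distrib algebra_simps)
  have lim: "((\<lambda>t. B t $$ (i, j)) \<longlongrightarrow> Pc $$ (i, j) - (if i = j then of_real (h i) else 0)) ?F"
    if i: "i < ?n" and j: "j < ?n" for i j
  proof (cases "i = j")
    case False
    then have ne: "complex_of_real (x j) - of_real (x i) \<noteq> 0"
      using inj i j by (auto simp: inj_on_def)
    have z_lim: "((\<lambda>t. z t j) \<longlongrightarrow> of_real (x j)) ?F" for j
      by (rule vert[OF nontangential_tendsto])
    have "((\<lambda>t. (\<alpha> t j * cnj (\<beta> t i) - \<beta> t j * cnj (\<alpha> t i)) / (z t j - cnj (z t i))) \<longlongrightarrow>
        (of_real (C j) * cnj (of_real (E i)) - of_real (E j) * cnj (of_real (C i))) /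
        (of_real (x j) - cnj (of_real (x i)))) ?F"
      by (intro tendsto_intros \<alpha>_lim \<beta>_lim z_lim i j) (use ne in simp)
    also have "(of_real (C j) * cnj (of_real (E i)) - of_real (E j) * cnj (of_real (C i))) /
        (of_real (x j) - cnj (of_real (x i))) =
        complex_of_real ((E i * C j - C i * E j) / (x j - x i))"
      by (simp add: mult.commute)
    also have "(E i * C j - C i * E j) / (x j - x i) = p i j"
      unfolding p_displacement[OF i j, symmetric] using inj i j False by (auto simp: inj_on_def)
    finally show ?thesis
      using False by (simp only: Bidx[OF i j] Beq Pc_index[OF i j] if_False diff_zero)
  next
    case True
    have "((\<lambda>t. complex_of_real (Im (\<alpha> t j * cnj (\<beta> t j)) / t)) \<longlongrightarrow> of_real (p j j - h j)) ?F"
      by (intro tendsto_of_real diag_lim j)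
    moreover have "eventually (\<lambda>t. complex_of_real (Im (\<alpha> t j * cnj (\<beta> t j)) / t) = B t $$ (i, j)) ?F"
      using eventually_at_right_less[of 0]
    proof eventually_elim
      case (elim t)
      define u where "u = \<alpha> t j * cnj (\<beta> t j)"
      have "B t $$ (i, j) = (\<alpha> t j * cnj (\<beta> t j) - \<beta> t j * cnj (\<alpha> t j)) / (z t j - cnj (z t j))"
        unfolding Bidx[OF i j] Beq by (simp only: True)
      also have "\<alpha> t j * cnj (\<beta> t j) - \<beta> t j * cnj (\<alpha> t j) = u - cnj u"
        by (simp add: u_def mult.commute)
      also have "u - cnj u = of_real (2 * Im u) * \<i>"
        by (rule complex_diff_cnj)
      also have "z t j - cnj (z t j) = of_real (2 * t) * \<i>"
        by (simp add: z_def complex_eq_iff)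
      also have "of_real (2 * Im u) * \<i> / (of_real (2 * t) * \<i>) = complex_of_real (Im u / t)"
        using elim by simp
      finally show ?case by (simp add: u_def)
    qed
    ultimately have "((\<lambda>t. B t $$ (i, j)) \<longlongrightarrow> of_real (p j j - h j)) ?F"
      by (rule tendsto_eventually_eq)
    then show ?thesis
      unfolding Pc_index[OF i j] using True by simp
  qed
  have "eventually (\<lambda>t. \<exists>V. \<forall>c. (\<exists>s<sq_neg Pc. c s \<noteq> 0) \<longrightarrow>
      Re (hform (B t) ?n (\<lambda>i. \<Sum>s<sq_neg Pc. V i s * c s)) < 0) ?F"
  proof (rule sq_neg_limit[OF Pc_carrier Pc_hermitian _ _ h lim])
    show "B t \<in> carrier_mat ?n ?n" for t by (simp add: B_def)
    show "B t $$ (i, j) = cnj (B t $$ (j, i))" if "i < ?n" "j < ?n" for t i j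
      unfolding Bidx[OF that] Bidx[OF that(2,1)] nev_kernel_hermitian[of w "z t i" "z t j"]
      by (simp add: mult_ac)
  qed
  moreover have "eventually (\<lambda>t. \<forall>j\<in>{..<?n}. 0 < Im (z t j) \<and> Den (z t j) \<noteq> 0) ?F"
    by (intro eventually_ball_finite ballI finite_lessThan ev_vert eventually_Den_nonzero)
  ultimately have "\<exists>t. (\<exists>V. \<forall>c. (\<exists>s<sq_neg Pc. c s \<noteq> 0) \<longrightarrow>
      Re (hform (B t) ?n (\<lambda>i. \<Sum>s<sq_neg Pc. V i s * c s)) < 0) \<and>
      (\<forall>j\<in>{..<?n}. 0 < Im (z t j) \<and> Den (z t j) \<noteq> 0)"
    by (intro eventually_happens'[OF trivial_limit_at_right_real] eventually_conj)
  then obtain t V where V: "\<forall>c. (\<exists>s<sq_neg Pc. c s \<noteq> 0) \<longrightarrow>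
      Re (hform (B t) ?n (\<lambda>i. \<Sum>s<sq_neg Pc. V i s * c s)) < 0"
    and zt: "\<forall>j\<in>{..<?n}. 0 < Im (z t j) \<and> Den (z t j) \<noteq> 0"
    by (elim exE conjE)
  have "sq_neg Pc \<le> sq_neg (kernel_mat w ?n (z t))"
  proof (rule sq_neg_ge[OF kernel_mat_carrier kernel_mat_hermitian])
    fix c :: "nat \<Rightarrow> complex" assume c: "\<exists>s<sq_neg Pc. c s \<noteq> 0"
    \<comment> \<open>\<open>B t\<close> arises from the kernel matrix by congruence with the
      diagonal of weights, so its negative directions transfer after multiplication by
      \<beta>.\<close>
    have "hform (kernel_mat w ?n (z t)) ?n (\<lambda>i. \<Sum>s<sq_neg Pc. (\<beta> t i * V i s) * c s) =
        hform (B t) ?n (\<lambda>i. \<Sum>s<sq_neg Pc. V i s * c s)"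
    proof -
      have "(\<Sum>s<sq_neg Pc. (\<beta> t i * V i s) * c s) = \<beta> t i * (\<Sum>s<sq_neg Pc. V i s * c s)" for i
        by (simp add: sum_distrib_left mult.assoc)
      then show ?thesis
        unfolding hform_def by (intro sum.cong refl) (simp add: Bidx kernel_mat_index mult_ac)
    qed
    then show "Re (hform (kernel_mat w ?n (z t)) ?n (\<lambda>i. \<Sum>s<sq_neg Pc. (\<beta> t i * V i s) * c s)) < 0"
      using V c by simp
  qed
  then show ?thesis
    using that[of "z t"] zt by (simp add: analyticity_domain_w pick_kappa_def)
qed

lemma w_in_nev_class:
  assumes cond: "\<And>k. k < n \<Longrightarrow> node_cond \<Omega> \<phi> k"
  shows "w \<in> nev_class (pick_kappa \<Omega>)"
proof -
  have "\<exists>m\<ge>1. \<exists>z. (\<forall>i<m. z i \<in> analyticity_domain w) \<and> sq_neg (kernel_mat w m z) = pick_kappa \<Omega>"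
  proof (cases "n = 0")
    case False
    obtain z where z: "\<And>i. i < n \<Longrightarrow> z i \<in> analyticity_domain w"
      "pick_kappa \<Omega> \<le> sq_neg (kernel_mat w (n) z)"
      by (rule sq_neg_kernel_attained[OF cond]) (assumption | rule that)+
    then have "sq_neg (kernel_mat w (n) z) = pick_kappa \<Omega>"
      using sq_neg_kernel_le[of "n" z] by simp
    then show ?thesis using z(1) False by (intro exI[of _ "n"]) auto
  next
    \<comment> \<open>Without nodes \<open>pick_kappa\<close> is zero; since
      \<open>nev_class\<close> asks for \<open>m \<ge> 1\<close>, a single point replaces the empty
      matrix.\<close>
    case True
    obtain d :: "nat \<Rightarrow> real" where "sq_neg Pc = card {l. l < n \<and> d l < 0}"
      by (rule hermitian_spectral[OF Pc_carrier Pc_hermitian]) (assumption | rule that)+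
    then have "pick_kappa \<Omega> = 0"
      by (simp add: pick_kappa_def True)
    moreover obtain z0 where "z0 \<in> analyticity_domain w"
      using Den_nonzero by (auto simp: analyticity_domain_w)
    ultimately show ?thesis
      using sq_neg_kernel_le[of 1 "\<lambda>_. z0"] by (intro exI[of _ 1]) auto
  qed
  then show ?thesis
    unfolding nev_class_def using w_mero sq_neg_kernel_le by blast
qed

lemma solves_iff: "solves_bip_ineq \<Omega> w \<longleftrightarrow> (\<forall>k<n. node_cond \<Omega> \<phi> k)"
proof
  assume sol: "solves_bip_ineq \<Omega> w"
  show "\<forall>k<n. node_cond \<Omega> \<phi> k"
  proof (intro allI impI)
    fix k assume k: "k < n"
    show "node_cond \<Omega> \<phi> k"
    proof (cases "k < num_reg \<Omega>")
      case True
      then obtain d where "d \<le> \<gamma> k"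
        "(w \<longlongrightarrow> of_real (wval \<Omega> k)) (nt k)"
        "(deriv w \<longlongrightarrow> of_real d) (nt k)"
        using sol by (auto simp: solves_bip_ineq_def)
      then show ?thesis by (rule node_cond_if_regular_solution[OF True])
    next
      case False
      then obtain t where "bd_neg_recip_residue (Fin w) (x k) t" "t \<le> - 1 / \<xi> k"
        using sol k unfolding solves_bip_ineq_def by (meson not_le)
      then show ?thesis using node_cond_if_singular_solution[of k t] k False by simp
    qed
  qed
next
  assume cond: "\<forall>k<n. node_cond \<Omega> \<phi> k"
  have "bd_value (Fin w) (x i) (Fin (of_real (wval \<Omega> i))) \<and>
      (\<exists>d. bd_deriv (Fin w) (x i) (Fin (of_real d)) \<and> d \<le> \<gamma> i)" if i: "i < num_reg \<Omega>" for i
  proof -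
    have "node_cond \<Omega> \<phi> i" using cond i \<Omega> by (auto simp: interp_data_set_def)
    then obtain d where d: "d \<le> \<gamma> i"
      and q: "((\<lambda>z. quot i z) \<longlongrightarrow> of_real d) (nt i)"
      by (rule regular_node_limit[OF i])
    obtain r where r: "r > 0" "w holomorphic_on {z. 0 < Im z} \<inter> ball (complex_of_real (x i)) r"
      by (rule w_holomorphic_near)
    show ?thesis
      using nontangential_quotient_imp_deriv[OF r(2,1) q] d by auto
  qed
  moreover have "\<exists>t. bd_neg_recip_residue (Fin w) (x j) t \<and> t \<le> - 1 / \<xi> j"
    if j: "num_reg \<Omega> \<le> j" "j < n" for j
  proof -
    have "node_cond \<Omega> \<phi> j" using cond j by simp
    then obtain t where t: "t \<le> - 1 / \<xi> j"
      and lim: "((\<lambda>z. - 1 / ((z - of_real (x j)) * w z)) \<longlongrightarrow> of_real t) (nt j)"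
      and w0: "eventually (\<lambda>z. w z \<noteq> 0) (nt j)"
      by (rule singular_node_limit[OF j])
    let ?r = "\<lambda>z. (z - of_real (x j)) * w z"
    have "bd_neg_recip_residue (Fin w) (x j) t"
    proof (cases "t = 0")
      \<comment> \<open>Here the residue is infinite, as
        \<open>neg_recip Infty = Fin 0\<close>.\<close>
      case True
      have "((\<lambda>z. 1 / ?r z) \<longlongrightarrow> 0) (nt j)"
        using tendsto_minus[OF lim] True by simp
      moreover have "eventually (\<lambda>z. ?r z \<noteq> 0) (nt j)"
        using w0 eventually_nontangential_ne by eventually_elim simp
      ultimately have "filterlim ?r at_infinity (nt j)"
        by (rule tendsto_recip_imp_at_infinity)
      then show ?thesis
        unfolding bd_neg_recip_residue_def using True by (intro exI[of _ Infty]) simp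
    next
      case False
      have "((\<lambda>z. - 1 / (- 1 / ?r z)) \<longlongrightarrow> - 1 / of_real t) (nt j)"
        by (intro tendsto_divide tendsto_const lim) (use False in simp)
      then show ?thesis
        unfolding bd_neg_recip_residue_def using False by (intro exI[of _ "Fin (- 1 / of_real t)"]) simp
    qed
    then show ?thesis using t by blast
  qed
  ultimately show "solves_bip_ineq \<Omega> w"
    unfolding solves_bip_ineq_def using w_in_nev_class cond by simp
qed

end

theorem theorem2p11:
  fixes \<Omega> :: interp_data
    and w :: "complex \<Rightarrow> complex"
    and \<phi> :: "(complex \<Rightarrow> complex) with_inf"
  assumes "interp_data_set \<Omega>"
    and "invertible_mat (pick_mat \<Omega>)"
    and "w nicely_meromorphic_on upper_half_plane"
    and "\<phi> \<in> nev0_ext"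
    and "is_lft (Theta \<Omega>) \<phi> w"
  shows "solves_bip_ineq \<Omega> w \<longleftrightarrow>
    (\<forall>i<num_nodes \<Omega>.
       (e_til \<Omega> i \<noteq> 0 \<longrightarrow> cond_C1 \<Omega> \<phi> i \<or> cond_C2 \<Omega> \<phi> i \<or> cond_C3 \<Omega> \<phi> i) \<and>
       (e_til \<Omega> i = 0 \<longrightarrow> cond_Ct1 \<Omega> \<phi> i \<or> cond_Ct2 \<Omega> \<phi> i \<or> cond_Ct3 \<Omega> \<phi> i))"
proof -
  interpret bip \<Omega> w \<phi> using assms by (rule bip.intro)
  show ?thesis using solves_iff unfolding node_cond_def .
qed

end
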